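(* Let $A$ be a DG algebra over a commutative ring $R$, $M$ a left DG $A$-module, and $P$ a projective resolution of $M$ with augmentation $\epsilon\colon P_{0,*}\to M$. Then the induced map $\epsilon\colon TP\to M$ from the total complex is a $q$-cofibrant approximation of $M$, i.e. $TP$ is $q$-cofibrant and $\epsilon$ is a surjective quasi-isomorphism.
   Context: For a DG $R$-module $N$ write $B_n(N)\subset Z_n(N)\subset N_n$ for boundaries and cycles. A DG $R$-module $Q$ is $s$-projective if all $B_n(Q)$ and $H_n(Q)$ are projective $R$-modules. A map $p\colon E\to N$ of DG $A$-modules is an $s$-epimorphism if $E_n\to N_n$ and $Z_n(E)\to Z_n(N)$ are surjective for all $n$. A sequence $L\xrightarrow{f}N\xrightarrow{g}N'$ of DG $A$-modules is $s$-exact if $f$ is the composite of an $s$-epimorphism $L\to K$ and the inclusion of a kernel $K$ of $g$. A projective resolution of $M$ is an $s$-exact sequence of DG $A$-modules $\cdots\to P_{p,*}\to P_{p-1,*}\to\cdots\to P_{0,*}\to M\to 0$ with each $P_{p,*}=A\otimes_R Q_{p,*}$ for an $s$-projective DG $R$-module $Q_{p,*}$ (grading: $P_{p,q}$ is the degree $q$ part of $P_{p,*}$). Its total complex $TP$ has $TP_n=\bigoplus_{p+q=n}P_{p,q}$ with differential $d^0+d^1$, where $d^0$ is the internal differential of $P_{p,*}$ and $d^1=(-1)^q d$ on $P_{p,q}$, $d\colon P_{p,*}\to P_{p-1,*}$ the resolution map. The $q$-model structure on DG $A$-modules has quasi-isomorphisms as weak equivalences, degreewise surjections as fibrations, and cofibrations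 the maps with the left lifting property against surjective quasi-isomorphisms; $X$ is $q$-cofibrant if $0\to X$ is a cofibration. *)

theory Defs
  imports Main
begin

record ('r, 'm) rmod =
  rcar :: "'m set"
  radd :: "'m \<Rightarrow> 'm \<Rightarrow> 'm"
  rzero :: "'m"
  rsmul :: "'r \<Rightarrow> 'm \<Rightarrow> 'm"

definition rmodule :: "('r::comm_ring_1, 'm) rmod \<Rightarrow> bool" where
  "rmodule M \<longleftrightarrow>
     rzero M \<in> rcar M \<and>
     (\<forall>x\<in>rcar M. \<forall>y\<in>rcar M. radd M x y \<in> rcar M) \<and>
     (\<forall>r. \<forall>x\<in>rcar M. rsmul M r x \<in> rcar M) \<and>
     (\<forall>x\<in>rcar M. \<forall>y\<in>rcar M. \<forall>z\<in>rcar M. radd M (radd M x y) z = radd M x (radd M y z)) \<and>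
     (\<forall>x\<in>rcar M. \<forall>y\<in>rcar M. radd M x y = radd M y x) \<and>
     (\<forall>x\<in>rcar M. radd M (rzero M) x = x) \<and>
     (\<forall>x\<in>rcar M. \<exists>y\<in>rcar M. radd M x y = rzero M) \<and>
     (\<forall>r. \<forall>x\<in>rcar M. \<forall>y\<in>rcar M. rsmul M r (radd M x y) = radd M (rsmul M r x) (rsmul M r y)) \<and>
     (\<forall>r s. \<forall>x\<in>rcar M. rsmul M (r + s) x = radd M (rsmul M r x) (rsmul M s x)) \<and>
     (\<forall>r s. \<forall>x\<in>rcar M. rsmul M (r * s) x = rsmul M r (rsmul M s x)) \<and>
     (\<forall>x\<in>rcar M. rsmul M 1 x = x)"

definition rlin :: "('r::comm_ring_1, 'm) rmod \<Rightarrow> ('r, 'n) rmod \<Rightarrow> ('m \<Rightarrow> 'n) \<Rightarrow> bool" where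
  "rlin M N f \<longleftrightarrow>
     (\<forall>x\<in>rcar M. f x \<in> rcar N) \<and>
     (\<forall>x\<in>rcar M. \<forall>y\<in>rcar M. f (radd M x y) = radd N (f x) (f y)) \<and>
     (\<forall>r. \<forall>x\<in>rcar M. f (rsmul M r x) = rsmul N r (f x))"

definition subm :: "('r, 'm) rmod \<Rightarrow> 'm set \<Rightarrow> ('r, 'm) rmod" where
  "subm M S = M\<lparr>rcar := S\<rparr>"

definition quotm :: "('r, 'm) rmod \<Rightarrow> 'm set \<Rightarrow> ('r, 'm set) rmod" where
  "quotm M S = \<lparr> rcar = {{radd M x s | s. s \<in> S} | x. x \<in> rcar M},
                radd = (\<lambda>X Y. {radd M x y | x y. x \<in> X \<and> y \<in> Y}),
                rzero = S,
                rsmul = (\<lambda>r X. {radd M (rsmul M r x) s | x s. x \<in> X \<and> s \<in> S}) \<rparr>"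

definition free_mod :: "'b set \<Rightarrow> ('r::comm_ring_1, 'b \<Rightarrow> 'r) rmod" where
  "free_mod S = \<lparr> rcar = {f. finite {x. f x \<noteq> 0} \<and> {x. f x \<noteq> 0} \<subseteq> S},
                 radd = (\<lambda>f g x. f x + g x),
                 rzero = (\<lambda>x. 0),
                 rsmul = (\<lambda>r f x. r * f x) \<rparr>"

text \<open>projective = direct summand of a free module.  A basis indexed by a subset of the
  element type suffices (every module is a quotient of the free module on its carrier).\<close>
definition projective :: "('r::comm_ring_1, 'm) rmod \<Rightarrow> bool" where
  "projective M \<longleftrightarrow> rmodule M \<and>
     (\<exists>(S::'m set) i r. rlin M (free_mod S) i \<and> rlin (free_mod S) M r \<and>
        (\<forall>x\<in>rcar M. r (i x) = x))"

record ('r, 'm) dgmod =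
  gcomp :: "int \<Rightarrow> ('r, 'm) rmod"
  gd :: "int \<Rightarrow> 'm \<Rightarrow> 'm"

definition dg_rmodule :: "('r::comm_ring_1, 'm, 'z) dgmod_scheme \<Rightarrow> bool" where
  "dg_rmodule M \<longleftrightarrow>
     (\<forall>n. rmodule (gcomp M n)) \<and>
     (\<forall>n. rlin (gcomp M n) (gcomp M (n - 1)) (gd M n)) \<and>
     (\<forall>n. \<forall>x\<in>rcar (gcomp M n). gd M (n - 1) (gd M n x) = rzero (gcomp M (n - 2)))"

definition cycles :: "('r, 'm, 'z) dgmod_scheme \<Rightarrow> int \<Rightarrow> 'm set" where
  "cycles M n = {x \<in> rcar (gcomp M n). gd M n x = rzero (gcomp M (n - 1))}"

definition bounds :: "('r, 'm, 'z) dgmod_scheme \<Rightarrow> int \<Rightarrow> 'm set" where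
  "bounds M n = gd M (n + 1) ` rcar (gcomp M (n + 1))"

definition homology :: "('r, 'm, 'z) dgmod_scheme \<Rightarrow> int \<Rightarrow> ('r, 'm set) rmod" where
  "homology M n = quotm (subm (gcomp M n) (cycles M n)) (bounds M n)"

definition s_projective :: "('r::comm_ring_1, 'm, 'z) dgmod_scheme \<Rightarrow> bool" where
  "s_projective Q \<longleftrightarrow>
     (\<forall>n. projective (subm (gcomp Q n) (bounds Q n)) \<and> projective (homology Q n))"

definition dg_rmap :: "('r::comm_ring_1, 'm, 'z) dgmod_scheme \<Rightarrow> ('r, 'n, 'y) dgmod_scheme
                        \<Rightarrow> (int \<Rightarrow> 'm \<Rightarrow> 'n) \<Rightarrow> bool" where
  "dg_rmap M N f \<longleftrightarrow>
     (\<forall>n. rlin (gcomp M n) (gcomp N n) (f n)) \<and>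
     (\<forall>n. \<forall>x\<in>rcar (gcomp M n). f (n - 1) (gd M n x) = gd N n (f n x))"

definition sgnr :: "int \<Rightarrow> 'r::comm_ring_1" where
  "sgnr k = (if even k then 1 else - 1)"

record ('r, 'a) dgalg = "('r, 'a) dgmod" +
  amul :: "int \<Rightarrow> int \<Rightarrow> 'a \<Rightarrow> 'a \<Rightarrow> 'a"
  aone :: "'a"

definition dg_algebra :: "('r::comm_ring_1, 'a, 'z) dgalg_scheme \<Rightarrow> bool" where
  "dg_algebra A \<longleftrightarrow> dg_rmodule A \<and>
     aone A \<in> rcar (gcomp A 0) \<and>
     (\<forall>i j. \<forall>a\<in>rcar (gcomp A i). \<forall>b\<in>rcar (gcomp A j). amul A i j a b \<in> rcar (gcomp A (i + j))) \<and>
     (\<forall>i j. \<forall>a\<in>rcar (gcomp A i). \<forall>a'\<in>rcar (gcomp A i). \<forall>b\<in>rcar (gcomp A j).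
        amul A i j (radd (gcomp A i) a a') b = radd (gcomp A (i + j)) (amul A i j a b) (amul A i j a' b)) \<and>
     (\<forall>i j. \<forall>a\<in>rcar (gcomp A i). \<forall>b\<in>rcar (gcomp A j). \<forall>b'\<in>rcar (gcomp A j).
        amul A i j a (radd (gcomp A j) b b') = radd (gcomp A (i + j)) (amul A i j a b) (amul A i j a b')) \<and>
     (\<forall>i j r. \<forall>a\<in>rcar (gcomp A i). \<forall>b\<in>rcar (gcomp A j).
        amul A i j (rsmul (gcomp A i) r a) b = rsmul (gcomp A (i + j)) r (amul A i j a b) \<and>
        amul A i j a (rsmul (gcomp A j) r b) = rsmul (gcomp A (i + j)) r (amul A i j a b)) \<and>
     (\<forall>i j k. \<forall>a\<in>rcar (gcomp A i). \<forall>b\<in>rcar (gcomp A j). \<forall>c\<in>rcar (gcomp A k).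
        amul A (i + j) k (amul A i j a b) c = amul A i (j + k) a (amul A j k b c)) \<and>
     (\<forall>i. \<forall>a\<in>rcar (gcomp A i). amul A 0 i (aone A) a = a \<and> amul A i 0 a (aone A) = a) \<and>
     (\<forall>i j. \<forall>a\<in>rcar (gcomp A i). \<forall>b\<in>rcar (gcomp A j).
        gd A (i + j) (amul A i j a b) =
          radd (gcomp A (i + j - 1)) (amul A (i - 1) j (gd A i a) b)
               (rsmul (gcomp A (i + j - 1)) (sgnr i) (amul A i (j - 1) a (gd A j b))))"

record ('r, 'a, 'm) dgamod = "('r, 'm) dgmod" +
  mact :: "int \<Rightarrow> int \<Rightarrow> 'a \<Rightarrow> 'm \<Rightarrow> 'm"

definition dg_amodule :: "('r::comm_ring_1, 'a, 'y) dgalg_scheme \<Rightarrow> ('r, 'a, 'm, 'z) dgamod_scheme \<Rightarrow> bool" where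
  "dg_amodule A M \<longleftrightarrow> dg_rmodule M \<and>
     (\<forall>i j. \<forall>a\<in>rcar (gcomp A i). \<forall>x\<in>rcar (gcomp M j). mact M i j a x \<in> rcar (gcomp M (i + j))) \<and>
     (\<forall>i j. \<forall>a\<in>rcar (gcomp A i). \<forall>a'\<in>rcar (gcomp A i). \<forall>x\<in>rcar (gcomp M j).
        mact M i j (radd (gcomp A i) a a') x = radd (gcomp M (i + j)) (mact M i j a x) (mact M i j a' x)) \<and>
     (\<forall>i j. \<forall>a\<in>rcar (gcomp A i). \<forall>x\<in>rcar (gcomp M j). \<forall>x'\<in>rcar (gcomp M j).
        mact M i j a (radd (gcomp M j) x x') = radd (gcomp M (i + j)) (mact M i j a x) (mact M i j a x')) \<and>
     (\<forall>i j r. \<forall>a\<in>rcar (gcomp A i). \<forall>x\<in>rcar (gcomp M j).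
        mact M i j (rsmul (gcomp A i) r a) x = rsmul (gcomp M (i + j)) r (mact M i j a x) \<and>
        mact M i j a (rsmul (gcomp M j) r x) = rsmul (gcomp M (i + j)) r (mact M i j a x)) \<and>
     (\<forall>i j k. \<forall>a\<in>rcar (gcomp A i). \<forall>b\<in>rcar (gcomp A j). \<forall>x\<in>rcar (gcomp M k).
        mact M (i + j) k (amul A i j a b) x = mact M i (j + k) a (mact M j k b x)) \<and>
     (\<forall>k. \<forall>x\<in>rcar (gcomp M k). mact M 0 k (aone A) x = x) \<and>
     (\<forall>i j. \<forall>a\<in>rcar (gcomp A i). \<forall>x\<in>rcar (gcomp M j).
        gd M (i + j) (mact M i j a x) =
          radd (gcomp M (i + j - 1)) (mact M (i - 1) j (gd A i a) x)
               (rsmul (gcomp M (i + j - 1)) (sgnr i) (mact M i (j - 1) a (gd M j x))))"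

definition dg_amap :: "('r::comm_ring_1, 'a, 'y) dgalg_scheme \<Rightarrow> ('r, 'a, 'm, 'z) dgamod_scheme
                        \<Rightarrow> ('r, 'a, 'n, 'w) dgamod_scheme \<Rightarrow> (int \<Rightarrow> 'm \<Rightarrow> 'n) \<Rightarrow> bool" where
  "dg_amap A M N f \<longleftrightarrow> dg_rmap M N f \<and>
     (\<forall>i j. \<forall>a\<in>rcar (gcomp A i). \<forall>x\<in>rcar (gcomp M j). f (i + j) (mact M i j a x) = mact N i j a (f j x))"

definition s_epi :: "('r, 'm, 'z) dgmod_scheme \<Rightarrow> ('r, 'n, 'y) dgmod_scheme \<Rightarrow> (int \<Rightarrow> 'm \<Rightarrow> 'n) \<Rightarrow> bool" where
  "s_epi E N p \<longleftrightarrow> (\<forall>n. p n ` rcar (gcomp E n) = rcar (gcomp N n)) \<and>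
                    (\<forall>n. p n ` cycles E n = cycles N n)"

text \<open>L -f-> N -g-> N' is s-exact: f factors as an s-epimorphism onto the kernel K of g
  followed by the inclusion K \<subseteq> N (K_n = ker g_n, Z_n(K) = Z_n(N) \<inter> ker g_n).\<close>
definition s_exact :: "('r, 'l, 'z) dgmod_scheme \<Rightarrow> (int \<Rightarrow> 'l \<Rightarrow> 'm) \<Rightarrow> ('r, 'm, 'y) dgmod_scheme
                       \<Rightarrow> (int \<Rightarrow> 'm \<Rightarrow> 'n) \<Rightarrow> ('r, 'n, 'w) dgmod_scheme \<Rightarrow> bool" where
  "s_exact L f N g N' \<longleftrightarrow>
     (\<forall>n. f n ` rcar (gcomp L n) = {x \<in> rcar (gcomp N n). g n x = rzero (gcomp N' n)}) \<and>
     (\<forall>n. f n ` cycles L n = {x \<in> cycles N n. g n x = rzero (gcomp N' n)})"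

definition hmap :: "('r, 'n, 'y) dgmod_scheme \<Rightarrow> (int \<Rightarrow> 'm \<Rightarrow> 'n) \<Rightarrow> int \<Rightarrow> 'm set \<Rightarrow> 'n set" where
  "hmap N f n X = {radd (gcomp N n) (f n x) b | x b. x \<in> X \<and> b \<in> bounds N n}"

definition quasi_iso :: "('r, 'm, 'z) dgmod_scheme \<Rightarrow> ('r, 'n, 'y) dgmod_scheme \<Rightarrow> (int \<Rightarrow> 'm \<Rightarrow> 'n) \<Rightarrow> bool" where
  "quasi_iso M N f \<longleftrightarrow> (\<forall>n. bij_betw (hmap N f n) (rcar (homology M n)) (rcar (homology N n)))"

definition ext_up :: "'t itself \<Rightarrow> ('r::comm_ring_1, 'a, 'y) dgalg_scheme \<Rightarrow> ('r, 'q, 'z) dgmod_scheme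
                      \<Rightarrow> ('r, 'a, 'p, 'w) dgamod_scheme \<Rightarrow> (int \<Rightarrow> 'q \<Rightarrow> 'p) \<Rightarrow> bool" where
  "ext_up T A Q P iota \<longleftrightarrow>
     (\<forall>(N :: ('r, 'a, 't) dgamod) (g :: int \<Rightarrow> 'q \<Rightarrow> 't).
        dg_amodule A N \<and> dg_rmap Q N g \<longrightarrow>
        (\<exists>h. dg_amap A P N h \<and> (\<forall>n. \<forall>x\<in>rcar (gcomp Q n). h n (iota n x) = g n x) \<and>
             (\<forall>h'. dg_amap A P N h' \<and> (\<forall>n. \<forall>x\<in>rcar (gcomp Q n). h' n (iota n x) = g n x) \<longrightarrow>
                   (\<forall>n. \<forall>x\<in>rcar (gcomp P n). h' n x = h n x))))"

text \<open>P \<cong> A \<otimes>_R Q with unit iota.  Testing against modules with element type 'p (P itself)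
  and with element type (int \<times> 'a \<times> 'q \<Rightarrow> 'r) set (large enough to contain a copy of the
  standard construction of A \<otimes>_R Q) characterises A \<otimes>_R Q up to isomorphism.\<close>
definition is_tensor_ext :: "('r::comm_ring_1, 'a, 'y) dgalg_scheme \<Rightarrow> ('r, 'q, 'z) dgmod_scheme
                      \<Rightarrow> ('r, 'a, 'p, 'w) dgamod_scheme \<Rightarrow> (int \<Rightarrow> 'q \<Rightarrow> 'p) \<Rightarrow> bool" where
  "is_tensor_ext A Q P iota \<longleftrightarrow> dg_rmap Q P iota \<and>
     ext_up TYPE('p) A Q P iota \<and>
     ext_up TYPE((int \<times> 'a \<times> 'q \<Rightarrow> 'r) set) A Q P iota"

text \<open>P p is P_{p,*}; dres p : P_{p+1,*} \<rightarrow> P_{p,*} is the resolution map.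
  TP_n = \<Oplus>_{p \<ge> 0} P_{p,n-p}, elements are finitely supported sequences.\<close>
definition totalc :: "(nat \<Rightarrow> ('r::comm_ring_1, 'a, 'p) dgamod) \<Rightarrow> (nat \<Rightarrow> int \<Rightarrow> 'p \<Rightarrow> 'p)
                      \<Rightarrow> ('r, 'a, nat \<Rightarrow> 'p) dgamod" where
  "totalc P dres = \<lparr>
     gcomp = (\<lambda>n. \<lparr> rcar = {x. (\<forall>p. x p \<in> rcar (gcomp (P p) (n - int p))) \<and>
                             finite {p. x p \<noteq> rzero (gcomp (P p) (n - int p))}},
                   radd = (\<lambda>x y p. radd (gcomp (P p) (n - int p)) (x p) (y p)),
                   rzero = (\<lambda>p. rzero (gcomp (P p) (n - int p))),
                   rsmul = (\<lambda>r x p. rsmul (gcomp (P p) (n - int p)) r (x p)) \<rparr>),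
     gd = (\<lambda>n x p. radd (gcomp (P p) (n - 1 - int p))
                        (gd (P p) (n - int p) (x p))
                        (rsmul (gcomp (P p) (n - 1 - int p)) (sgnr (n - 1 - int p))
                               (dres p (n - 1 - int p) (x (Suc p))))),
     mact = (\<lambda>i j a x p. mact (P p) i (j - int p) a (x p)) \<rparr>"

definition total_aug :: "(int \<Rightarrow> 'p \<Rightarrow> 'm) \<Rightarrow> int \<Rightarrow> (nat \<Rightarrow> 'p) \<Rightarrow> 'm" where
  "total_aug eps n x = eps n (x 0)"

definition q_cofibrant :: "'e itself \<Rightarrow> 'n itself \<Rightarrow> ('r::comm_ring_1, 'a, 'y) dgalg_scheme
                           \<Rightarrow> ('r, 'a, 'x, 'z) dgamod_scheme \<Rightarrow> bool" where
  "q_cofibrant TE TN A X \<longleftrightarrow> dg_amodule A X \<and>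
     (\<forall>(E :: ('r, 'a, 'e) dgamod) (N :: ('r, 'a, 'n) dgamod) p g.
        dg_amodule A E \<and> dg_amodule A N \<and> dg_amap A E N p \<and>
        (\<forall>n. p n ` rcar (gcomp E n) = rcar (gcomp N n)) \<and> quasi_iso E N p \<and>
        dg_amap A X N g \<longrightarrow>
        (\<exists>h. dg_amap A X E h \<and> (\<forall>n. \<forall>x\<in>rcar (gcomp X n). p n (h n x) = g n x)))"

end

theory Submission
  imports Defs "HOL-Algebra.FiniteProduct"
begin

text \<open>Lifting against a surjective quasi-isomorphism \<open>\<pi>: E \<rightarrow> N\<close>.  A map out of \<open>TP\<close> is a sequence of
  \<open>A\<close>-linear maps \<open>h\<^sub>p\<close> on the \<open>P\<^sub>p\<close> with \<open>d h\<^sub>p = h\<^sub>p d\<^sup>0 + h\<^sub>p\<^sub>-\<^sub>1 d\<^sup>1\<close>, so the lift is built by recursion on \<open>p\<close>,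
  the perturbation \<open>w = h\<^sub>p\<^sub>-\<^sub>1 d\<^sup>1\<close> being known.  By the universal property of \<open>A \<otimes> Q\<^sub>p\<close> it suffices to
  solve \<open>d k = k d + w\<close>, \<open>\<pi> k = g\<close> on \<open>Q\<^sub>p\<close>.  There \<open>s\<close>-projectivity splits degree \<open>n\<close> into \<open>B\<^sub>n\<close>, \<open>H\<^sub>n\<close> and a copy
  of \<open>B\<^sub>n\<^sub>-\<^sub>1\<close>: on that copy any lift of \<open>g\<close> will do and it dictates \<open>k\<close> on \<open>B\<^sub>n\<^sub>-\<^sub>1\<close>, while on \<open>H\<^sub>n\<close> one lifts along
  the surjection \<open>e \<mapsto> (d e, \<pi> e)\<close> given by the acyclicity of the kernel of \<open>\<pi>\<close>.

  The augmentation is a quasi-isomorphism because exactness of the rows lets one push a cycle, modulo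
  boundaries, into ever higher filtration; once it is concentrated in a single \<open>P\<^sub>p\<close>, it is a \<open>d\<^sup>0\<close>-cycle
  in the kernel of \<open>d\<^sup>1\<close>, and exactness on cycles makes it a boundary.\<close>

section \<open>Modules with explicit carriers\<close>

text \<open>Two obstacles shape the argument. The hypothesis \<open>is_tensor_ext\<close> offers the
  universal property of A \<otimes> Q only for targets with two particular element types, while
  cofibrancy is tested against modules of arbitrary type. However, an extension of a map from Q only
  reaches the submodule generated by the image of Q, and that submodule is small enough to be copied
  into one of the two types; the other type serves to show that P itself is generated by Q. Moreover
  the universal property produces chain maps, while the maps on the single P's satisfy a perturbed
  equation and are in general not chain maps. So it is applied to a contractible target built from
  E, whose incoming chain maps are the merely linear maps into E; the perturbed equation is then
  checked on products a q. The sign of d^1, together with d^1 d^1 = 0, makes the perturbation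
  anticommute with the differentials, which d d = 0 forces on any solvable equation of this
  kind.\<close>

lemma rmodule_rules [simp]:
  assumes "rmodule M"
  shows rzero_in: "rzero M \<in> rcar M"
    and radd_in: "\<lbrakk>x \<in> rcar M; y \<in> rcar M\<rbrakk> \<Longrightarrow> radd M x y \<in> rcar M"
    and rsmul_in: "x \<in> rcar M \<Longrightarrow> rsmul M r x \<in> rcar M"
    and radd_zero_left: "x \<in> rcar M \<Longrightarrow> radd M (rzero M) x = x"
    and one_rsmul: "x \<in> rcar M \<Longrightarrow> rsmul M 1 x = x"
    and rsmul_rsmul: "x \<in> rcar M \<Longrightarrow> rsmul M r (rsmul M s x) = rsmul M (r * s) x"
    and rsmul_radd: "\<lbrakk>x \<in> rcar M; y \<in> rcar M\<rbrakk> \<Longrightarrow> rsmul M r (radd M x y) = radd M (rsmul M r x) (rsmul M r y)"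
  using assms unfolding rmodule_def by metis+

lemma radd_assoc:
  "\<lbrakk>rmodule M; x \<in> rcar M; y \<in> rcar M; z \<in> rcar M\<rbrakk> \<Longrightarrow> radd M (radd M x y) z = radd M x (radd M y z)"
  unfolding rmodule_def by blast

lemma radd_commute:
  "\<lbrakk>rmodule M; x \<in> rcar M; y \<in> rcar M\<rbrakk> \<Longrightarrow> radd M x y = radd M y x"
  unfolding rmodule_def by blast

lemma radd_left_commute:
  "\<lbrakk>rmodule M; x \<in> rcar M; y \<in> rcar M; z \<in> rcar M\<rbrakk> \<Longrightarrow> radd M x (radd M y z) = radd M y (radd M x z)"
  by (metis radd_assoc radd_commute)

lemmas radd_ac = radd_assoc radd_commute radd_left_commute

lemma add_rsmul:
  "\<lbrakk>rmodule M; x \<in> rcar M\<rbrakk> \<Longrightarrow> rsmul M (r + s) x = radd M (rsmul M r x) (rsmul M s x)"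
  unfolding rmodule_def by blast

lemma radd_zero_right [simp]:
  "\<lbrakk>rmodule M; x \<in> rcar M\<rbrakk> \<Longrightarrow> radd M x (rzero M) = x"
  using radd_commute[of M x "rzero M"] by simp

lemma radd_cancel_left:
  assumes "rmodule M" "x \<in> rcar M" "y \<in> rcar M" "z \<in> rcar M"
  shows "radd M x y = radd M x z \<longleftrightarrow> y = z"
proof
  obtain x' where x': "x' \<in> rcar M" "radd M x x' = rzero M"
    using assms(1,2) unfolding rmodule_def by metis
  assume "radd M x y = radd M x z"
  then have "radd M x' (radd M x y) = radd M x' (radd M x z)" by simp
  then show "y = z"
    using assms x' by (simp add: radd_assoc[symmetric] radd_commute[of M x' x])
qed simp

lemma rsmul_zero_left [simp]:
  assumes "rmodule M" "x \<in> rcar M"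
  shows "rsmul M 0 x = rzero M"
  using add_rsmul[OF assms, of 0 0] assms radd_cancel_left[of M "rsmul M 0 x" "rsmul M 0 x" "rzero M"]
  by simp

lemma rsmul_rzero [simp]:
  assumes "rmodule M"
  shows "rsmul M r (rzero M) = rzero M"
  using rsmul_rsmul[OF assms rzero_in[OF assms], of r 0] assms by simp

abbreviation rneg :: "('r::comm_ring_1, 'm) rmod \<Rightarrow> 'm \<Rightarrow> 'm" where
  "rneg M x \<equiv> rsmul M (- 1) x"

lemma radd_rneg [simp]:
  assumes "rmodule M" "x \<in> rcar M"
  shows "radd M x (rneg M x) = rzero M" "radd M (rneg M x) x = rzero M"
  using add_rsmul[OF assms, of 1 "- 1"] add_rsmul[OF assms, of "- 1" 1] assms by simp_all

lemma radd_rneg_cancel [simp]: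
  assumes "rmodule M" "x \<in> rcar M" "y \<in> rcar M"
  shows "radd M x (radd M (rneg M x) y) = y" "radd M (rneg M x) (radd M x y) = y"
  using assms by (simp_all add: radd_assoc[symmetric])

lemma rlin_in [simp]: "\<lbrakk>rlin M N f; x \<in> rcar M\<rbrakk> \<Longrightarrow> f x \<in> rcar N"
  and rlin_radd: "\<lbrakk>rlin M N f; x \<in> rcar M; y \<in> rcar M\<rbrakk> \<Longrightarrow> f (radd M x y) = radd N (f x) (f y)"
  and rlin_rsmul: "\<lbrakk>rlin M N f; x \<in> rcar M\<rbrakk> \<Longrightarrow> f (rsmul M r x) = rsmul N r (f x)"
  unfolding rlin_def by auto

lemma rlin_rzero:
  assumes "rlin M N f" "rmodule M" "rmodule N"
  shows "f (rzero M) = rzero N"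
  using rlin_rsmul[OF assms(1), of "rzero M" 0] assms by simp

lemma rlin_comp: "\<lbrakk>rlin L M f; rlin M N g\<rbrakk> \<Longrightarrow> rlin L N (\<lambda>x. g (f x))"
  unfolding rlin_def by auto

lemma rlin_sum:
  "\<lbrakk>rmodule N; rlin M N f; rlin M N g\<rbrakk> \<Longrightarrow> rlin M N (\<lambda>x. radd N (f x) (g x))"
  unfolding rlin_def by (auto simp: radd_ac)

lemma rlin_scale:
  "\<lbrakk>rmodule N; rlin M N f\<rbrakk> \<Longrightarrow> rlin M N (\<lambda>x. rsmul N r (f x))"
  unfolding rlin_def by (auto simp: mult.commute)

lemma rlin_zero: "rmodule N \<Longrightarrow> rlin M N (\<lambda>x. rzero N)"
  unfolding rlin_def by simp

lemma subm_simps [simp]: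
  "rcar (subm M S) = S" "radd (subm M S) = radd M" "rzero (subm M S) = rzero M"
  "rsmul (subm M S) = rsmul M"
  unfolding subm_def by simp_all

lemma rmodule_subm:
  assumes "rmodule M" "S \<subseteq> rcar M" "rzero M \<in> S"
    "\<And>x y. \<lbrakk>x \<in> S; y \<in> S\<rbrakk> \<Longrightarrow> radd M x y \<in> S" "\<And>r x. x \<in> S \<Longrightarrow> rsmul M r x \<in> S"
  shows "rmodule (subm M S)"
proof -
  have [simp]: "x \<in> rcar M" if "x \<in> S" for x using that assms(2) by auto
  have "\<exists>y\<in>S. radd M x y = rzero M" if "x \<in> S" for x
    using that assms by (intro bexI[of _ "rneg M x"]) auto
  then show ?thesis
    unfolding rmodule_def using assms by (simp add: radd_ac add_rsmul)
qed

definition prodm :: "('r::comm_ring_1, 'm) rmod \<Rightarrow> ('r, 'n) rmod \<Rightarrow> ('r, 'm \<times> 'n) rmod" where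
  "prodm M N = \<lparr> rcar = rcar M \<times> rcar N,
                radd = (\<lambda>x y. (radd M (fst x) (fst y), radd N (snd x) (snd y))),
                rzero = (rzero M, rzero N),
                rsmul = (\<lambda>r x. (rsmul M r (fst x), rsmul N r (snd x))) \<rparr>"

lemma prodm_simps [simp]:
  "rcar (prodm M N) = rcar M \<times> rcar N"
  "radd (prodm M N) x y = (radd M (fst x) (fst y), radd N (snd x) (snd y))"
  "rzero (prodm M N) = (rzero M, rzero N)"
  "rsmul (prodm M N) r x = (rsmul M r (fst x), rsmul N r (snd x))"
  unfolding prodm_def by simp_all

lemma rmodule_prodm [simp]:
  assumes "rmodule M" "rmodule N"
  shows "rmodule (prodm M N)"
proof -
  have "\<exists>y\<in>rcar (prodm M N). radd (prodm M N) x y = rzero (prodm M N)" if "x \<in> rcar (prodm M N)" for x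
    using that assms by (intro bexI[of _ "rneg (prodm M N) x"]) auto
  then show ?thesis
    unfolding rmodule_def using assms by (auto simp: radd_ac add_rsmul)
qed

lemma rlin_prodm: "rlin M (prodm N N') (\<lambda>x. (f x, f' x)) \<longleftrightarrow> rlin M N f \<and> rlin M N' f'"
  unfolding rlin_def by auto

section \<open>Direct sums and projective modules\<close>

text \<open>Serves two purposes: free modules are sums of lines, and each degree of the total
  complex is a sum over the resolution index. One extension lemma covers both.\<close>

definition dsum :: "('s \<Rightarrow> ('r::comm_ring_1, 'm) rmod) \<Rightarrow> ('r, 's \<Rightarrow> 'm) rmod" where
  "dsum M = \<lparr> rcar = {x. (\<forall>s. x s \<in> rcar (M s)) \<and> finite {s. x s \<noteq> rzero (M s)}},
             radd = (\<lambda>x y s. radd (M s) (x s) (y s)),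
             rzero = (\<lambda>s. rzero (M s)),
             rsmul = (\<lambda>r x s. rsmul (M s) r (x s)) \<rparr>"

definition single :: "('s \<Rightarrow> ('r, 'm) rmod) \<Rightarrow> 's \<Rightarrow> 'm \<Rightarrow> 's \<Rightarrow> 'm" where
  "single M s x = (\<lambda>t. if t = s then x else rzero (M t))"

lemma dsum_simps [simp]:
  "x \<in> rcar (dsum M) \<longleftrightarrow> (\<forall>s. x s \<in> rcar (M s)) \<and> finite {s. x s \<noteq> rzero (M s)}"
  "radd (dsum M) x y = (\<lambda>s. radd (M s) (x s) (y s))"
  "rzero (dsum M) = (\<lambda>s. rzero (M s))"
  "rsmul (dsum M) r x = (\<lambda>s. rsmul (M s) r (x s))"
  unfolding dsum_def by simp_all

lemma rmodule_dsum [simp]: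
  assumes "\<And>s. rmodule (M s)"
  shows "rmodule (dsum M)"
proof -
  have add: "radd (dsum M) x y \<in> rcar (dsum M)" if "x \<in> rcar (dsum M)" "y \<in> rcar (dsum M)" for x y
  proof -
    have "{s. radd (M s) (x s) (y s) \<noteq> rzero (M s)} \<subseteq> {s. x s \<noteq> rzero (M s)} \<union> {s. y s \<noteq> rzero (M s)}"
      using assms by auto
    then show ?thesis
      using that assms by (auto intro: finite_subset)
  qed
  have smul: "rsmul (dsum M) r x \<in> rcar (dsum M)" if "x \<in> rcar (dsum M)" for r x
  proof -
    have "{s. rsmul (M s) r (x s) \<noteq> rzero (M s)} \<subseteq> {s. x s \<noteq> rzero (M s)}"
      using assms by auto
    then show ?thesis
      using that assms by (auto intro: finite_subset)
  qed
  have "\<exists>y\<in>rcar (dsum M). radd (dsum M) x y = rzero (dsum M)" if "x \<in> rcar (dsum M)" for x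
    using that assms by (intro bexI[OF _ smul[of x "- 1"]]) auto
  then show ?thesis
    unfolding rmodule_def using add smul assms
    by (auto simp: radd_ac add_rsmul fun_eq_iff)
qed

lemma single_in [simp]:
  assumes "\<And>s. rmodule (M s)" "x \<in> rcar (M s)"
  shows "single M s x \<in> rcar (dsum M)"
proof -
  have "{t. single M s x t \<noteq> rzero (M t)} \<subseteq> {s}" by (auto simp: single_def)
  then show ?thesis using assms by (auto simp: single_def intro: finite_subset)
qed

lemma rlin_single:
  "(\<And>s. rmodule (M s)) \<Longrightarrow> rlin (M s) (dsum M) (single M s)"
  using single_in[of M _ s] unfolding rlin_def by (auto simp: single_def fun_eq_iff)

lemma dsum_induct [consumes 2, case_names zero add]:
  assumes M: "\<And>s. rmodule (M s)"
    and "x \<in> rcar (dsum M)"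
    and zero: "Pr (rzero (dsum M))"
    and step: "\<And>s y z. \<lbrakk>y \<in> rcar (M s); z \<in> rcar (dsum M); Pr z\<rbrakk> \<Longrightarrow> Pr (radd (dsum M) (single M s y) z)"
  shows "Pr x"
proof -
  have "finite S \<Longrightarrow> \<forall>x\<in>rcar (dsum M). {s. x s \<noteq> rzero (M s)} \<subseteq> S \<longrightarrow> Pr x" for S
  proof (induction S rule: finite_induct)
    case empty
    have "x = rzero (dsum M)" if "{s. x s \<noteq> rzero (M s)} \<subseteq> {}" for x
      using that by auto
    then show ?case using zero by blast
  next
    case (insert s S)
    show ?case
    proof (intro ballI impI)
      fix x assume x: "x \<in> rcar (dsum M)" and sub: "{t. x t \<noteq> rzero (M t)} \<subseteq> insert s S"
      define z where "z = (\<lambda>t. if t = s then rzero (M t) else x t)"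
      have "{t. z t \<noteq> rzero (M t)} \<subseteq> {t. x t \<noteq> rzero (M t)}" by (auto simp: z_def)
      then have z: "z \<in> rcar (dsum M)"
        using x M by (auto simp: z_def intro: finite_subset)
      moreover have "{t. z t \<noteq> rzero (M t)} \<subseteq> S" using sub by (auto simp: z_def)
      ultimately have "Pr z" using insert.IH by blast
      moreover have "x = radd (dsum M) (single M s (x s)) z"
        using x M by (auto simp: single_def z_def)
      ultimately show "Pr x" using step[of "x s" s z] x z by simp
    qed
  qed
  from this[of "{s. x s \<noteq> rzero (M s)}"] assms(2) show ?thesis by simp
qed

text \<open>The sum over the support is taken as a \<open>finprod\<close> in the commutative monoid
  on \<open>rcar N\<close>, which settles independence of the order. Linearity compares elements
  with different supports, hence \<open>h_eq\<close>: any finite set containing the support gives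
  the same value.\<close>

lemma dsum_extension:
  assumes M: "\<And>s. rmodule (M s)" and N: "rmodule N" and u: "\<And>s. rlin (M s) N (u s)"
  shows "\<exists>h. rlin (dsum M) N h \<and> (\<forall>s. \<forall>x\<in>rcar (M s). h (single M s x) = u s x)"
proof -
  define G where "G = \<lparr>carrier = rcar N, mult = radd N, one = rzero N\<rparr>"
  have G: "comm_monoid G"
    using N unfolding G_def by unfold_locales (auto simp: radd_ac)
  interpret comm_monoid G by (fact G)
  have one_G: "\<one>\<^bsub>G\<^esub> = rzero N" "rzero N \<in> carrier G" by (simp_all add: G_def N)
  define supp where "supp x = {s. x s \<noteq> rzero (M s)}" for x
  define h where "h x = finprod G (\<lambda>s. u s (x s)) (supp x)" for x
  have u0: "u s (rzero (M s)) = \<one>\<^bsub>G\<^esub>" for s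
    using rlin_rzero[OF u M N] by (simp add: G_def)
  have uG: "u s x \<in> carrier G" if "x \<in> rcar (M s)" for s x
    using rlin_in[OF u that] by (simp add: G_def)
  have h_eq: "h x = finprod G (\<lambda>s. u s (x s)) S"
    if "x \<in> rcar (dsum M)" "finite S" "supp x \<subseteq> S" for x S
    unfolding h_def using that
    by (intro finprod_mono_neutral_cong_left) (auto simp: supp_def u0 uG)
  have "rlin (dsum M) N h"
    unfolding rlin_def
  proof (intro conjI ballI allI)
    fix x assume x: "x \<in> rcar (dsum M)"
    then have "h x \<in> carrier G" unfolding h_def by (intro finprod_closed) (auto simp: uG)
    then show "h x \<in> rcar N" by (simp add: G_def)
    fix r
    have rx: "rsmul (dsum M) r x \<in> rcar (dsum M)" using x by (intro rsmul_in rmodule_dsum M)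
    have "supp (rsmul (dsum M) r x) \<subseteq> supp x" by (auto simp: supp_def M)
    then have "h (rsmul (dsum M) r x) = finprod G (\<lambda>s. u s (rsmul (dsum M) r x s)) (supp x)"
      using x by (intro h_eq rx) (auto simp: supp_def)
    also have "\<dots> = finprod G (\<lambda>s. rsmul N r (u s (x s))) (supp x)"
      using x uG N by (intro finprod_cong') (auto simp: rlin_rsmul[OF u] G_def)
    also have "\<dots> = rsmul N r (finprod G (\<lambda>s. u s (x s)) (supp x))"
    proof -
      have "finprod G (\<lambda>s. rsmul N r (u s (x s))) S = rsmul N r (finprod G (\<lambda>s. u s (x s)) S)
              \<and> finprod G (\<lambda>s. u s (x s)) S \<in> carrier G" if "finite S" for S
        using that
      proof (induction S rule: finite_induct)
        case (insert s S)
        have "u s (x s) \<in> rcar N" for s using x by (intro rlin_in[OF u]) auto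
        then have "(\<lambda>s. u s (x s)) \<in> S \<rightarrow> carrier G" "(\<lambda>s. rsmul N r (u s (x s))) \<in> S \<rightarrow> carrier G"
          "\<And>s. u s (x s) \<in> carrier G" "\<And>s. rsmul N r (u s (x s)) \<in> carrier G"
          using N by (auto simp: G_def)
        moreover have "rsmul N r (radd N y z) = radd N (rsmul N r y) (rsmul N r z)"
          if "y \<in> carrier G" "z \<in> carrier G" for y z
          using that N by (simp add: G_def)
        then have "rsmul N r (y \<otimes>\<^bsub>G\<^esub> z) = rsmul N r y \<otimes>\<^bsub>G\<^esub> rsmul N r z"
          if "y \<in> carrier G" "z \<in> carrier G" for y z
          using that by (simp add: G_def)
        ultimately show ?case using insert by simp
      qed (simp_all add: N one_G)
      then show ?thesis using x by (auto simp: supp_def)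
    qed
    finally show "h (rsmul (dsum M) r x) = rsmul N r (h x)" by (simp add: h_def)
  next
    fix x y assume x: "x \<in> rcar (dsum M)" and y: "y \<in> rcar (dsum M)"
    have xy: "radd (dsum M) x y \<in> rcar (dsum M)" using x y by (intro radd_in rmodule_dsum M)
    let ?S = "supp x \<union> supp y"
    have fin: "finite ?S" using x y by (auto simp: supp_def)
    have "supp (radd (dsum M) x y) \<subseteq> ?S" by (auto simp: supp_def M)
    then have "h (radd (dsum M) x y) = finprod G (\<lambda>s. u s (radd (dsum M) x y s)) ?S"
      using fin xy by (intro h_eq) auto
    also have "\<dots> = finprod G (\<lambda>s. u s (x s) \<otimes>\<^bsub>G\<^esub> u s (y s)) ?S"
      using x y uG by (intro finprod_cong') (auto simp: rlin_radd[OF u] G_def N)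
    also have "\<dots> = finprod G (\<lambda>s. u s (x s)) ?S \<otimes>\<^bsub>G\<^esub> finprod G (\<lambda>s. u s (y s)) ?S"
      using x y uG by (intro finprod_multf) auto
    also have "\<dots> = radd N (h x) (h y)"
      using x y fin by (simp add: G_def h_eq[of _ ?S])
    finally show "h (radd (dsum M) x y) = radd N (h x) (h y)" .
  qed
  moreover have "h (single M s x) = u s x" if "x \<in> rcar (M s)" for s x
  proof -
    have "h (single M s x) = finprod G (\<lambda>t. u t (single M s x t)) {s}"
      using that by (intro h_eq single_in M) (auto simp: supp_def single_def)
    also have "\<dots> = u s x"
      using that uG by (simp add: single_def)
    finally show ?thesis .
  qed
  ultimately show ?thesis by blast
qed

text \<open>The zero module for \<open>False\<close> lets a sum indexed by the whole type express a
  free module whose basis is only a subset \<open>S\<close>.\<close>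

definition line_mod :: "bool \<Rightarrow> ('r::comm_ring_1, 'r) rmod" where
  "line_mod b = \<lparr>rcar = (if b then UNIV else {0}), radd = (+), rzero = 0, rsmul = (*)\<rparr>"

lemma rmodule_line_mod [simp]: "rmodule (line_mod b)"
proof -
  have "\<exists>y. x + y = 0" for x :: 'a by (rule exI[of _ "- x"]) simp
  then show ?thesis
    by (auto simp: rmodule_def line_mod_def algebra_simps)
qed

lemma free_mod_eq_dsum: "free_mod S = dsum (\<lambda>s. line_mod (s \<in> S))"
proof -
  have "(\<forall>s. x s \<in> (if s \<in> S then UNIV else {0})) \<longleftrightarrow> {s. x s \<noteq> 0} \<subseteq> S" for x :: "'b \<Rightarrow> 'a"
    by auto
  then show ?thesis
    by (auto simp: free_mod_def dsum_def line_mod_def)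
qed

lemma rmodule_free_mod [simp]: "rmodule (free_mod S)"
  by (simp add: free_mod_eq_dsum)

abbreviation unit_vec :: "'b set \<Rightarrow> 'b \<Rightarrow> 'b \<Rightarrow> 'r::comm_ring_1" where
  "unit_vec S s \<equiv> single (\<lambda>s. line_mod (s \<in> S)) s 1"

lemma unit_vec_in [simp]: "s \<in> S \<Longrightarrow> unit_vec S s \<in> rcar (free_mod S)"
  unfolding free_mod_eq_dsum by (rule single_in[OF rmodule_line_mod]) (simp add: line_mod_def)

lemma free_mod_extension:
  assumes N: "rmodule N" and v: "\<And>s. s \<in> S \<Longrightarrow> v s \<in> rcar N"
  obtains h where "rlin (free_mod S) N h" "\<And>s. s \<in> S \<Longrightarrow> h (unit_vec S s) = v s"
proof -
  let ?u = "\<lambda>s r. if s \<in> S then rsmul N r (v s) else rzero N"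
  have u: "rlin (line_mod (s \<in> S)) N (?u s)" for s
    using N v by (cases "s \<in> S") (simp_all add: rlin_def line_mod_def add_rsmul)
  obtain h where h: "rlin (dsum (\<lambda>s. line_mod (s \<in> S))) N h
      \<and> (\<forall>s. \<forall>x\<in>rcar (line_mod (s \<in> S)). h (single (\<lambda>s. line_mod (s \<in> S)) s x) = ?u s x)"
    using dsum_extension[where M = "\<lambda>s. line_mod (s \<in> S)" and u = ?u, OF rmodule_line_mod N u] ..
  show thesis
  proof
    show "rlin (free_mod S) N h" using h by (simp add: free_mod_eq_dsum)
    show "h (unit_vec S s) = v s" if "s \<in> S" for s
      using h that N v by (simp add: line_mod_def)
  qed
qed

lemma free_mod_linear_eq:
  assumes f: "rlin (free_mod S) N f" and g: "rlin (free_mod S) N g" and N: "rmodule N"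
    and eq: "\<And>s. s \<in> S \<Longrightarrow> f (unit_vec S s) = g (unit_vec S s)" and x: "x \<in> rcar (free_mod S)"
  shows "f x = g x"
proof -
  let ?M = "\<lambda>s. line_mod (s \<in> S) :: ('a, 'a) rmod"
  have f': "rlin (dsum ?M) N f" and g': "rlin (dsum ?M) N g"
    using f g by (simp_all add: free_mod_eq_dsum)
  have sing: "single ?M s y \<in> rcar (dsum ?M)" if "y \<in> rcar (?M s)" for s y
    by (rule single_in) (simp_all add: that)
  have D: "rmodule (dsum ?M)" by simp
  from x have "x \<in> rcar (dsum ?M)" by (simp only: free_mod_eq_dsum)
  from rmodule_line_mod this show ?thesis
  proof (induction x rule: dsum_induct)
    case zero
    then show ?case using rlin_rzero[OF f' D N] rlin_rzero[OF g' D N] by simp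
  next
    case (add s y z)
    have "f (single ?M s y) = g (single ?M s y)"
    proof (cases "s \<in> S")
      case True
      then have "unit_vec S s \<in> rcar (dsum ?M)" by (intro sing) (simp add: line_mod_def)
      moreover have "single ?M s y = rsmul (dsum ?M) y (unit_vec S s)"
        by (auto simp: single_def line_mod_def)
      ultimately show ?thesis
        using eq[OF True] rlin_rsmul[OF f'] rlin_rsmul[OF g'] by metis
    next
      case False
      then have "single ?M s y = rzero (dsum ?M)"
        using add(1) by (auto simp: single_def line_mod_def)
      then show ?thesis using rlin_rzero[OF f' D N] rlin_rzero[OF g' D N] by simp
    qed
    then show ?case
      using rlin_radd[OF f' sing[OF add(1)] add(2)] rlin_radd[OF g' sing[OF add(1)] add(2)] add(3)
      by simp
  qed
qed

text \<open>Choose preimages for the images of the unit vectors, extend linearly, and restrict along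
  the retraction. Only values of \<open>u\<close> are asked to have preimages, so \<open>f\<close>
  may be the differential (with values in boundaries) or e \<mapsto> (d e, \<pi> e), neither of
  which is onto its target in general.\<close>

lemma projective_lift:
  assumes "projective M" and X: "rmodule X" and Y: "rmodule Y" and f: "rlin X Y f" and u: "rlin M Y u"
    and surj: "\<And>m. m \<in> rcar M \<Longrightarrow> u m \<in> f ` rcar X"
  obtains v where "rlin M X v" "\<And>m. m \<in> rcar M \<Longrightarrow> f (v m) = u m"
proof -
  obtain S :: "'b set" and i r where ir: "rlin M (free_mod S) i" "rlin (free_mod S) M r"
    "\<And>x. x \<in> rcar M \<Longrightarrow> r (i x) = x"
    using assms(1) unfolding projective_def by blast
  have "\<exists>x. x \<in> rcar X \<and> f x = u (r (unit_vec S s))" if "s \<in> S" for s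
    using surj[OF rlin_in[OF ir(2) unit_vec_in[OF that]]] by (metis imageE)
  then obtain e where e: "\<And>s. s \<in> S \<Longrightarrow> e s \<in> rcar X \<and> f (e s) = u (r (unit_vec S s))"
    by metis
  then have "e s \<in> rcar X" if "s \<in> S" for s using that by simp
  then obtain h where h: "rlin (free_mod S) X h" "\<And>s. s \<in> S \<Longrightarrow> h (unit_vec S s) = e s"
    using free_mod_extension[OF X] by metis
  have fh: "f (h x) = u (r x)" if "x \<in> rcar (free_mod S)" for x
    using free_mod_linear_eq[OF rlin_comp[OF h(1) f] rlin_comp[OF ir(2) u] Y _ that] h(2) e by simp
  show thesis
  proof
    show "rlin M X (\<lambda>m. h (i m))" by (rule rlin_comp[OF ir(1) h(1)])
    show "f (h (i m)) = u m" if "m \<in> rcar M" for m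
      using fh[OF rlin_in[OF ir(1) that]] ir(3)[OF that] by simp
  qed
qed

section \<open>Cosets and homology\<close>

definition closed_sub :: "('r::comm_ring_1, 'm) rmod \<Rightarrow> 'm set \<Rightarrow> bool" where
  "closed_sub M S \<longleftrightarrow> S \<subseteq> rcar M \<and> rzero M \<in> S \<and>
     (\<forall>x\<in>S. \<forall>y\<in>S. radd M x y \<in> S) \<and> (\<forall>r. \<forall>x\<in>S. rsmul M r x \<in> S)"

definition coset :: "('r, 'm) rmod \<Rightarrow> 'm set \<Rightarrow> 'm \<Rightarrow> 'm set" where
  "coset M S x = {radd M x s | s. s \<in> S}"

lemma rmodule_closed_sub: "\<lbrakk>rmodule M; closed_sub M S\<rbrakk> \<Longrightarrow> rmodule (subm M S)"
  unfolding closed_sub_def by (intro rmodule_subm) auto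

lemma coset_eq_iff:
  assumes M: "rmodule M" and S: "closed_sub M S" and x: "x \<in> rcar M" and y: "y \<in> rcar M"
  shows "coset M S x = coset M S y \<longleftrightarrow> radd M x (rneg M y) \<in> S"
proof
  have sub: "s \<in> rcar M" if "s \<in> S" for s using S that by (auto simp: closed_sub_def)
  assume eq: "coset M S x = coset M S y"
  have "x \<in> coset M S x" unfolding coset_def using M S x by (auto simp: closed_sub_def intro!: exI[of _ "rzero M"])
  then obtain s where s: "s \<in> S" "x = radd M y s" unfolding eq by (auto simp: coset_def)
  have "radd M x (rneg M y) = s"
    using s M y sub by (simp add: radd_ac)
  then show "radd M x (rneg M y) \<in> S" using s by simp
next
  have sub: "s \<in> rcar M" if "s \<in> S" for s using S that by (auto simp: closed_sub_def)
  have incl: "coset M S x \<subseteq> coset M S y" if "radd M x (rneg M y) \<in> S" "x \<in> rcar M" "y \<in> rcar M" for x y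
  proof
    fix z assume "z \<in> coset M S x"
    then obtain s where s: "s \<in> S" "z = radd M x s" by (auto simp: coset_def)
    have "z = radd M y (radd M (radd M x (rneg M y)) s)"
      using s that M sub by (simp add: radd_ac)
    moreover have "radd M (radd M x (rneg M y)) s \<in> S" using S s that by (auto simp: closed_sub_def)
    ultimately show "z \<in> coset M S y" by (auto simp: coset_def)
  qed
  assume "radd M x (rneg M y) \<in> S"
  moreover from this have "rneg M (radd M x (rneg M y)) \<in> S" using S by (auto simp: closed_sub_def)
  then have "radd M y (rneg M x) \<in> S" using M x y by (simp add: radd_ac)
  ultimately show "coset M S x = coset M S y" using incl x y by blast
qed

text \<open>The operations of \<open>quotm\<close> are sums of sets rather than operations on
  representatives, so additivity and homogeneity are equalities of sets, each proved by two
  inclusions.\<close>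

lemma rlin_coset:
  assumes M: "rmodule M" and Z: "closed_sub M Z" and S: "closed_sub M S"
  shows "rlin (subm M Z) (quotm (subm M Z) S) (coset M S)"
proof -
  have [simp]: "x \<in> rcar M" if "x \<in> Z" for x using Z that by (auto simp: closed_sub_def)
  have [simp]: "s \<in> rcar M" if "s \<in> S" for s using S that by (auto simp: closed_sub_def)
  have add: "coset M S (radd M x y) = {radd M u v | u v. u \<in> coset M S x \<and> v \<in> coset M S y}"
    if "x \<in> Z" "y \<in> Z" for x y
  proof (rule subset_antisym; rule subsetI)
    fix z assume "z \<in> coset M S (radd M x y)"
    then obtain s where s: "s \<in> S" "z = radd M (radd M x y) s" by (auto simp: coset_def)
    have "z = radd M (radd M x s) (radd M y (rzero M))" using s that M by (simp add: radd_ac)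
    then show "z \<in> {radd M u v | u v. u \<in> coset M S x \<and> v \<in> coset M S y}"
      using s S by (auto simp: coset_def closed_sub_def)
  next
    fix z assume "z \<in> {radd M u v | u v. u \<in> coset M S x \<and> v \<in> coset M S y}"
    then obtain s t where s: "s \<in> S" "t \<in> S" "z = radd M (radd M x s) (radd M y t)"
      by (auto simp: coset_def)
    have "z = radd M (radd M x y) (radd M s t)" using s that M by (simp add: radd_ac)
    then show "z \<in> coset M S (radd M x y)"
      using s S by (auto simp: coset_def closed_sub_def)
  qed
  have smul: "coset M S (rsmul M r x) = {radd M (rsmul M r u) s | u s. u \<in> coset M S x \<and> s \<in> S}"
    if "x \<in> Z" for r x
  proof (rule subset_antisym; rule subsetI)
    fix z assume "z \<in> coset M S (rsmul M r x)"
    then obtain s where s: "s \<in> S" "z = radd M (rsmul M r x) s" by (auto simp: coset_def)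
    have "z = radd M (rsmul M r (radd M x (rzero M))) s" using s that M by (simp add: radd_ac)
    then show "z \<in> {radd M (rsmul M r u) s | u s. u \<in> coset M S x \<and> s \<in> S}"
      using s S by (auto simp: coset_def closed_sub_def)
  next
    fix z assume "z \<in> {radd M (rsmul M r u) s | u s. u \<in> coset M S x \<and> s \<in> S}"
    then obtain s t where s: "s \<in> S" "t \<in> S" "z = radd M (rsmul M r (radd M x t)) s"
      by (auto simp: coset_def)
    have "z = radd M (rsmul M r x) (radd M (rsmul M r t) s)" using s that M by (simp add: radd_ac)
    then show "z \<in> coset M S (rsmul M r x)"
      using s S by (auto simp: coset_def closed_sub_def)
  qed
  show ?thesis
    unfolding rlin_def quotm_def using add smul by (auto simp: coset_def)
qed

section \<open>Differential graded modules\<close>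

locale dg_rmod =
  fixes M :: "('r::comm_ring_1, 'm, 'z) dgmod_scheme"
  assumes dg_rmodule: "dg_rmodule M"
begin

lemma rmodule_gcomp [simp]: "rmodule (gcomp M n)"
  and rlin_gd: "rlin (gcomp M n) (gcomp M (n - 1)) (gd M n)"
  and gd_gd [simp]: "x \<in> rcar (gcomp M n) \<Longrightarrow> gd M (n - 1) (gd M n x) = rzero (gcomp M (n - 2))"
  using dg_rmodule unfolding dg_rmodule_def by blast+

lemma gd_in [simp]: "\<lbrakk>x \<in> rcar (gcomp M n); m = n - 1\<rbrakk> \<Longrightarrow> gd M n x \<in> rcar (gcomp M m)"
  by (simp add: rlin_in[OF rlin_gd])

lemma gd_radd [simp]:
  "\<lbrakk>x \<in> rcar (gcomp M n); y \<in> rcar (gcomp M n)\<rbrakk> \<Longrightarrow>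
    gd M n (radd (gcomp M n) x y) = radd (gcomp M (n - 1)) (gd M n x) (gd M n y)"
  and gd_rsmul [simp]: "x \<in> rcar (gcomp M n) \<Longrightarrow> gd M n (rsmul (gcomp M n) r x) = rsmul (gcomp M (n - 1)) r (gd M n x)"
  and gd_rzero [simp]: "gd M n (rzero (gcomp M n)) = rzero (gcomp M (n - 1))"
  using rlin_radd[OF rlin_gd] rlin_rsmul[OF rlin_gd] rlin_rzero[OF rlin_gd] by auto

lemma closed_sub_cycles [simp]: "closed_sub (gcomp M n) (cycles M n)"
  unfolding closed_sub_def cycles_def by auto

lemma bounds_iff: "x \<in> bounds M n \<longleftrightarrow> (\<exists>y\<in>rcar (gcomp M (n + 1)). x = gd M (n + 1) y)"
  unfolding bounds_def by blast

lemma closed_sub_bounds [simp]: "closed_sub (gcomp M n) (bounds M n)"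
  unfolding closed_sub_def
proof (intro conjI ballI allI subsetI)
  have eq: "n + 1 - 1 = n" by simp
  have r: "radd (gcomp M n) (gd M (n + 1) u) (gd M (n + 1) v) = gd M (n + 1) (radd (gcomp M (n + 1)) u v)"
    "rsmul (gcomp M n) r (gd M (n + 1) u) = gd M (n + 1) (rsmul (gcomp M (n + 1)) r u)"
    if "u \<in> rcar (gcomp M (n + 1))" "v \<in> rcar (gcomp M (n + 1))" for u v r
    using that by simp_all
  show "x \<in> rcar (gcomp M n)" if "x \<in> bounds M n" for x
    using that by (auto simp: bounds_def)
  show "rzero (gcomp M n) \<in> bounds M n"
    unfolding bounds_iff by (intro bexI[of _ "rzero (gcomp M (n + 1))"]) auto
  show "radd (gcomp M n) x y \<in> bounds M n" if "x \<in> bounds M n" "y \<in> bounds M n" for x y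
    using that r(1) unfolding bounds_iff by (metis radd_in rmodule_gcomp)
  show "rsmul (gcomp M n) r x \<in> bounds M n" if "x \<in> bounds M n" for x r
    using that r(2) unfolding bounds_iff by (metis rsmul_in rmodule_gcomp)
qed

lemma bounds_cycles: "x \<in> bounds M n \<Longrightarrow> x \<in> cycles M n"
  using gd_gd[of _ "n + 1"] by (auto simp: bounds_def cycles_def)

lemma cycles_in: "x \<in> cycles M n \<Longrightarrow> x \<in> rcar (gcomp M n)"
  by (simp add: cycles_def)

lemma rcar_homology: "rcar (homology M n) = coset (gcomp M n) (bounds M n) ` cycles M n"
  unfolding homology_def quotm_def coset_def by auto

lemma gd_bounds: "x \<in> rcar (gcomp M n) \<Longrightarrow> gd M n x \<in> bounds M (n - 1)"
  by (simp add: bounds_def)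

end

lemma dg_rmap_rules:
  assumes "dg_rmap M N f"
  shows dg_rmap_rlin: "rlin (gcomp M n) (gcomp N n) (f n)"
    and dg_rmap_gd: "x \<in> rcar (gcomp M n) \<Longrightarrow> f (n - 1) (gd M n x) = gd N n (f n x)"
  using assms unfolding dg_rmap_def by auto

text \<open>The direct image of a coset under \<open>f n\<close> may be smaller than a coset; the
  boundaries of \<open>N\<close> added in \<open>hmap\<close> fill it up, and boundaries of
  \<open>M\<close> are sent to boundaries of \<open>N\<close>.\<close>

lemma hmap_coset:
  assumes M: "dg_rmodule M" and N: "dg_rmodule N" and f: "dg_rmap M N f" and x: "x \<in> rcar (gcomp M n)"
  shows "hmap N f n (coset (gcomp M n) (bounds M n) x) = coset (gcomp N n) (bounds N n) (f n x)"
proof -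
  interpret M: dg_rmod M by (unfold_locales) (fact M)
  interpret N: dg_rmod N by (unfold_locales) (fact N)
  note lin = dg_rmap_rlin[OF f]
  have N_sub: "closed_sub (gcomp N n) (bounds N n)" and M_sub: "closed_sub (gcomp M n) (bounds M n)" by simp_all
  have fb: "f n s \<in> bounds N n" if "s \<in> bounds M n" for s
    using that dg_rmap_gd[OF f, of _ "n + 1"] rlin_in[OF lin, of _ "n + 1"]
    by (auto simp: bounds_def)
  have eq: "radd (gcomp N n) (f n (radd (gcomp M n) x s)) b
      = radd (gcomp N n) (f n x) (radd (gcomp N n) (f n s) b)"
    if "s \<in> bounds M n" "b \<in> bounds N n" for s b
  proof -
    have "s \<in> rcar (gcomp M n)" "b \<in> rcar (gcomp N n)"
      using that M_sub N_sub by (auto simp: closed_sub_def)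
    then show ?thesis using x by (simp add: rlin_radd[OF lin] radd_assoc rlin_in[OF lin])
  qed
  show ?thesis
  proof (rule subset_antisym; rule subsetI)
    fix y assume "y \<in> hmap N f n (coset (gcomp M n) (bounds M n) x)"
    then obtain s b where sb: "s \<in> bounds M n" "b \<in> bounds N n"
      "y = radd (gcomp N n) (f n (radd (gcomp M n) x s)) b"
      unfolding hmap_def coset_def by blast
    have "radd (gcomp N n) (f n s) b \<in> bounds N n"
      using fb[OF sb(1)] sb(2) N_sub by (simp add: closed_sub_def)
    then show "y \<in> coset (gcomp N n) (bounds N n) (f n x)"
      unfolding coset_def sb(3) eq[OF sb(1,2)] by blast
  next
    fix y assume "y \<in> coset (gcomp N n) (bounds N n) (f n x)"
    then obtain b where b: "b \<in> bounds N n" "y = radd (gcomp N n) (f n x) b"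
      unfolding coset_def by blast
    have "rzero (gcomp M n) \<in> bounds M n" using M_sub by (simp add: closed_sub_def)
    moreover have "x = radd (gcomp M n) x (rzero (gcomp M n))" using x by simp
    ultimately have "x \<in> coset (gcomp M n) (bounds M n) x" unfolding coset_def by blast
    then show "y \<in> hmap N f n (coset (gcomp M n) (bounds M n) x)"
      unfolding hmap_def using b by blast
  qed
qed

text \<open>Removes cosets from the rest of the proof. Injectivity on homology is a statement about
  kernels because differences of cycles are cycles and \<open>f n\<close> respects them.\<close>

lemma quasi_iso_iff:
  assumes M: "dg_rmodule M" and N: "dg_rmodule N" and f: "dg_rmap M N f"
  shows "quasi_iso M N f \<longleftrightarrow> (\<forall>n. (\<forall>x\<in>cycles M n. f n x \<in> bounds N n \<longrightarrow> x \<in> bounds M n) \<and>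
    (\<forall>y\<in>cycles N n. \<exists>x\<in>cycles M n. radd (gcomp N n) y (rneg (gcomp N n) (f n x)) \<in> bounds N n))"
  unfolding quasi_iso_def
proof (intro iff_allI)
  fix n
  interpret M: dg_rmod M by (unfold_locales) (fact M)
  interpret N: dg_rmod N by (unfold_locales) (fact N)
  note lin = dg_rmap_rlin[OF f, of n]
  let ?c = "coset (gcomp M n) (bounds M n)" and ?c' = "coset (gcomp N n) (bounds N n)"
  have fz: "f n x \<in> cycles N n" if "x \<in> cycles M n" for x
    using that dg_rmap_gd[OF f, of x n] rlin_in[OF lin, of x] rlin_rzero[OF dg_rmap_rlin[OF f, of "n - 1"]]
    by (auto simp: cycles_def)
  have h: "hmap N f n (?c x) = ?c' (f n x)" if "x \<in> cycles M n" for x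
    using hmap_coset[OF M N f] M.cycles_in[OF that] .
  have diff: "radd (gcomp M n) x (rneg (gcomp M n) y) \<in> cycles M n" if "x \<in> cycles M n" "y \<in> cycles M n" for x y
    using that M.closed_sub_cycles unfolding closed_sub_def by blast
  have fdiff: "f n (radd (gcomp M n) x (rneg (gcomp M n) y)) = radd (gcomp N n) (f n x) (rneg (gcomp N n) (f n y))"
    if "x \<in> cycles M n" "y \<in> cycles M n" for x y
    using that lin by (simp add: rlin_radd[OF lin] rlin_rsmul[OF lin] M.cycles_in)
  have inj: "inj_on (hmap N f n) (?c ` cycles M n) \<longleftrightarrow> (\<forall>x\<in>cycles M n. f n x \<in> bounds N n \<longrightarrow> x \<in> bounds M n)"
    (is "?I \<longleftrightarrow> ?I'")
  proof
    assume I: ?I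
    show ?I'
    proof (intro ballI impI)
      fix x assume x: "x \<in> cycles M n" "f n x \<in> bounds N n"
      let ?z = "rzero (gcomp M n)"
      have z: "?z \<in> cycles M n" by (simp add: cycles_def)
      have "?c' (f n x) = ?c' (f n ?z)"
        using x fz N.cycles_in by (simp add: coset_eq_iff rlin_rzero[OF lin])
      then have "hmap N f n (?c x) = hmap N f n (?c ?z)" by (simp only: h[OF x(1)] h[OF z])
      then have "?c x = ?c ?z" using I x(1) z by (meson imageI inj_on_def)
      then show "x \<in> bounds M n" using x(1) M.cycles_in by (simp add: coset_eq_iff)
    qed
  next
    assume I: ?I'
    show ?I
    proof (rule inj_onI, elim imageE, simp only:)
      fix x y assume xy: "x \<in> cycles M n" "y \<in> cycles M n" "hmap N f n (?c x) = hmap N f n (?c y)"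
      then have "radd (gcomp N n) (f n x) (rneg (gcomp N n) (f n y)) \<in> bounds N n"
        using fz N.cycles_in by (simp add: h coset_eq_iff)
      then show "?c x = ?c y"
        using I diff[of x y] fdiff[of x y] xy M.cycles_in by (simp add: coset_eq_iff)
    qed
  qed
  have "hmap N f n ` (?c ` cycles M n) = (\<lambda>x. ?c' (f n x)) ` cycles M n"
    using h by (auto simp: image_iff)
  moreover have "(\<lambda>x. ?c' (f n x)) ` cycles M n \<subseteq> ?c' ` cycles N n"
    using fz by blast
  ultimately have "hmap N f n ` (?c ` cycles M n) = ?c' ` cycles N n \<longleftrightarrow>
      ?c' ` cycles N n \<subseteq> (\<lambda>x. ?c' (f n x)) ` cycles M n"
    by (metis subset_antisym order_refl)
  also have "\<dots> \<longleftrightarrow> (\<forall>y\<in>cycles N n. \<exists>x\<in>cycles M n. ?c' y = ?c' (f n x))"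
    by (simp add: subset_eq image_iff)
  also have "\<dots> \<longleftrightarrow> (\<forall>y\<in>cycles N n. \<exists>x\<in>cycles M n. radd (gcomp N n) y (rneg (gcomp N n) (f n x)) \<in> bounds N n)"
    using fz N.cycles_in by (simp add: coset_eq_iff cong: bex_cong)
  finally show "bij_betw (hmap N f n) (rcar (homology M n)) (rcar (homology N n)) \<longleftrightarrow>
    (\<forall>x\<in>cycles M n. f n x \<in> bounds N n \<longrightarrow> x \<in> bounds M n) \<and>
    (\<forall>y\<in>cycles N n. \<exists>x\<in>cycles M n. radd (gcomp N n) y (rneg (gcomp N n) (f n x)) \<in> bounds N n)"
    unfolding M.rcar_homology N.rcar_homology bij_betw_def using inj by simp
qed

section \<open>Signs, DG algebras and DG modules over them\<close>

lemma sgnr_simps [simp]: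
  "sgnr 0 = 1" "sgnr (i + j) = sgnr i * sgnr j" "sgnr (i - 1) = - sgnr i" "sgnr i * sgnr i = 1"
  by (auto simp: sgnr_def)

locale dg_alg = dg_rmod A for A :: "('r::comm_ring_1, 'a) dgalg" +
  assumes dg_algebra: "dg_algebra A"
begin

lemma aone_in [simp]: "aone A \<in> rcar (gcomp A 0)"
  and amul_in [simp]: "\<And>i j k a b. \<lbrakk>a \<in> rcar (gcomp A i); b \<in> rcar (gcomp A j); k = i + j\<rbrakk> \<Longrightarrow> amul A i j a b \<in> rcar (gcomp A k)"
  and gd_amul: "\<And>i j a b. \<lbrakk>a \<in> rcar (gcomp A i); b \<in> rcar (gcomp A j)\<rbrakk> \<Longrightarrow>
    gd A (i + j) (amul A i j a b) =
          radd (gcomp A (i + j - 1)) (amul A (i - 1) j (gd A i a) b)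
               (rsmul (gcomp A (i + j - 1)) (sgnr i) (amul A i (j - 1) a (gd A j b)))"
  using dg_algebra unfolding dg_algebra_def by simp_all

end

lemma dg_algI: "dg_algebra A \<Longrightarrow> dg_alg A"
  by unfold_locales (simp_all add: dg_algebra_def)

locale dg_amod = A: dg_alg A + dg_rmod M
  for A :: "('r::comm_ring_1, 'a) dgalg" and M :: "('r, 'a, 'm) dgamod" +
  assumes dg_amodule: "dg_amodule A M"
begin

lemma mact_in [simp]:
  "\<lbrakk>a \<in> rcar (gcomp A i); x \<in> rcar (gcomp M j); k = i + j\<rbrakk> \<Longrightarrow> mact M i j a x \<in> rcar (gcomp M k)"
  using dg_amodule unfolding dg_amodule_def by simp

lemma mact_radd_left [simp]:
  "\<lbrakk>a \<in> rcar (gcomp A i); a' \<in> rcar (gcomp A i); x \<in> rcar (gcomp M j)\<rbrakk> \<Longrightarrow>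
     mact M i j (radd (gcomp A i) a a') x = radd (gcomp M (i + j)) (mact M i j a x) (mact M i j a' x)"
  using dg_amodule unfolding dg_amodule_def by simp

lemma mact_radd_right [simp]:
  "\<lbrakk>a \<in> rcar (gcomp A i); x \<in> rcar (gcomp M j); x' \<in> rcar (gcomp M j)\<rbrakk> \<Longrightarrow>
     mact M i j a (radd (gcomp M j) x x') = radd (gcomp M (i + j)) (mact M i j a x) (mact M i j a x')"
  using dg_amodule unfolding dg_amodule_def by simp

lemma mact_rsmul [simp]:
  assumes "a \<in> rcar (gcomp A i)" "x \<in> rcar (gcomp M j)"
  shows "mact M i j (rsmul (gcomp A i) r a) x = rsmul (gcomp M (i + j)) r (mact M i j a x)"
    and "mact M i j a (rsmul (gcomp M j) r x) = rsmul (gcomp M (i + j)) r (mact M i j a x)"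
  using dg_amodule assms unfolding dg_amodule_def by simp_all

lemma mact_rzero [simp]:
  "x \<in> rcar (gcomp M j) \<Longrightarrow> mact M i j (rzero (gcomp A i)) x = rzero (gcomp M (i + j))"
  "a \<in> rcar (gcomp A i) \<Longrightarrow> mact M i j a (rzero (gcomp M j)) = rzero (gcomp M (i + j))"
  using mact_rsmul(1)[of "rzero (gcomp A i)" i x j 0] mact_rsmul(2)[of a i "rzero (gcomp M j)" j 0] by simp_all

lemma mact_amul:
  "\<lbrakk>a \<in> rcar (gcomp A i); b \<in> rcar (gcomp A j); x \<in> rcar (gcomp M k); n = i + j\<rbrakk> \<Longrightarrow>
     mact M n k (amul A i j a b) x = mact M i (j + k) a (mact M j k b x)"
  using dg_amodule unfolding dg_amodule_def by simp

lemma mact_aone [simp]: "x \<in> rcar (gcomp M k) \<Longrightarrow> mact M 0 k (aone A) x = x"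
  using dg_amodule unfolding dg_amodule_def by simp

lemma gd_mact:
  "\<lbrakk>a \<in> rcar (gcomp A i); x \<in> rcar (gcomp M j); n = i + j\<rbrakk> \<Longrightarrow>
     gd M n (mact M i j a x) =
       radd (gcomp M (n - 1)) (mact M (i - 1) j (gd A i a) x)
            (rsmul (gcomp M (n - 1)) (sgnr i) (mact M i (j - 1) a (gd M j x)))"
  using dg_amodule unfolding dg_amodule_def by simp

end

lemma dg_amoduleI:
  assumes "dg_rmodule M"
    and "\<And>i j a x. \<lbrakk>a \<in> rcar (gcomp A i); x \<in> rcar (gcomp M j)\<rbrakk> \<Longrightarrow> mact M i j a x \<in> rcar (gcomp M (i + j))"
    and "\<And>i j a a' x. \<lbrakk>a \<in> rcar (gcomp A i); a' \<in> rcar (gcomp A i); x \<in> rcar (gcomp M j)\<rbrakk> \<Longrightarrow>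
      mact M i j (radd (gcomp A i) a a') x = radd (gcomp M (i + j)) (mact M i j a x) (mact M i j a' x)"
    and "\<And>i j a x x'. \<lbrakk>a \<in> rcar (gcomp A i); x \<in> rcar (gcomp M j); x' \<in> rcar (gcomp M j)\<rbrakk> \<Longrightarrow>
      mact M i j a (radd (gcomp M j) x x') = radd (gcomp M (i + j)) (mact M i j a x) (mact M i j a x')"
    and "\<And>i j r a x. \<lbrakk>a \<in> rcar (gcomp A i); x \<in> rcar (gcomp M j)\<rbrakk> \<Longrightarrow>
      mact M i j (rsmul (gcomp A i) r a) x = rsmul (gcomp M (i + j)) r (mact M i j a x)"
    and "\<And>i j r a x. \<lbrakk>a \<in> rcar (gcomp A i); x \<in> rcar (gcomp M j)\<rbrakk> \<Longrightarrow>
      mact M i j a (rsmul (gcomp M j) r x) = rsmul (gcomp M (i + j)) r (mact M i j a x)"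
    and "\<And>i j k a b x. \<lbrakk>a \<in> rcar (gcomp A i); b \<in> rcar (gcomp A j); x \<in> rcar (gcomp M k)\<rbrakk> \<Longrightarrow>
      mact M (i + j) k (amul A i j a b) x = mact M i (j + k) a (mact M j k b x)"
    and "\<And>k x. x \<in> rcar (gcomp M k) \<Longrightarrow> mact M 0 k (aone A) x = x"
    and "\<And>i j a x. \<lbrakk>a \<in> rcar (gcomp A i); x \<in> rcar (gcomp M j)\<rbrakk> \<Longrightarrow>
      gd M (i + j) (mact M i j a x) = radd (gcomp M (i + j - 1)) (mact M (i - 1) j (gd A i a) x)
        (rsmul (gcomp M (i + j - 1)) (sgnr i) (mact M i (j - 1) a (gd M j x)))"
  shows "dg_amodule A M"
  unfolding dg_amodule_def by (intro conjI allI ballI assms)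

lemma dg_amodI: "\<lbrakk>dg_algebra A; dg_amodule A M\<rbrakk> \<Longrightarrow> dg_amod A M"
  by unfold_locales (simp_all add: dg_algebra_def dg_amodule_def)

lemma dg_amap_rules:
  assumes "dg_amap A M N f"
  shows dg_amap_rmap: "dg_rmap M N f"
    and dg_amap_rlin: "rlin (gcomp M n) (gcomp N n) (f n)"
    and dg_amap_gd: "x \<in> rcar (gcomp M n) \<Longrightarrow> f (n - 1) (gd M n x) = gd N n (f n x)"
    and dg_amap_mact: "\<lbrakk>a \<in> rcar (gcomp A i); y \<in> rcar (gcomp M j)\<rbrakk> \<Longrightarrow> f (i + j) (mact M i j a y) = mact N i j a (f j y)"
  using assms unfolding dg_amap_def dg_rmap_def by auto

section \<open>Extending maps along the unit of the tensor product\<close>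

text \<open>The submodule \<open>S\<close> of \<open>C\<close> transported to another element type
  along the injection \<theta>: operations decode with \<open>inv_into\<close>, act in
  \<open>C\<close> and encode again. With the identity as \<theta> it is the submodule
  itself.\<close>

definition image_mod :: "(int \<Rightarrow> 'm \<Rightarrow> 't) \<Rightarrow> (int \<Rightarrow> 'm set) \<Rightarrow> ('r::comm_ring_1, 'a, 'm) dgamod \<Rightarrow> ('r, 'a, 't) dgamod" where
  "image_mod \<theta> S C = \<lparr>
     gcomp = (\<lambda>n. \<lparr> rcar = \<theta> n ` S n,
       radd = (\<lambda>x y. \<theta> n (radd (gcomp C n) (inv_into (S n) (\<theta> n) x) (inv_into (S n) (\<theta> n) y))),
       rzero = \<theta> n (rzero (gcomp C n)),
       rsmul = (\<lambda>r x. \<theta> n (rsmul (gcomp C n) r (inv_into (S n) (\<theta> n) x))) \<rparr>),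
     gd = (\<lambda>n x. \<theta> (n - 1) (gd C n (inv_into (S n) (\<theta> n) x))),
     mact = (\<lambda>i j a x. \<theta> (i + j) (mact C i j a (inv_into (S j) (\<theta> j) x))) \<rparr>"

locale dg_image = dg_amod A C
  for A :: "('r::comm_ring_1, 'a) dgalg" and C :: "('r, 'a, 'm) dgamod" +
  fixes S :: "int \<Rightarrow> 'm set" and \<theta> :: "int \<Rightarrow> 'm \<Rightarrow> 't"
  assumes inj: "inj_on (\<theta> n) (S n)"
    and closed: "closed_sub (gcomp C n) (S n)"
    and gd_closed: "x \<in> S n \<Longrightarrow> gd C n x \<in> S (n - 1)"
    and mact_closed: "\<lbrakk>a \<in> rcar (gcomp A i); x \<in> S j\<rbrakk> \<Longrightarrow> mact C i j a x \<in> S (i + j)"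
begin

lemma S_rules [simp]:
  "x \<in> S n \<Longrightarrow> x \<in> rcar (gcomp C n)"
  "rzero (gcomp C n) \<in> S n"
  "\<lbrakk>x \<in> S n; y \<in> S n\<rbrakk> \<Longrightarrow> radd (gcomp C n) x y \<in> S n"
  "x \<in> S n \<Longrightarrow> rsmul (gcomp C n) r x \<in> S n"
  "\<lbrakk>x \<in> S n; m = n - 1\<rbrakk> \<Longrightarrow> gd C n x \<in> S m"
  "\<lbrakk>a \<in> rcar (gcomp A i); x \<in> S j; k = i + j\<rbrakk> \<Longrightarrow> mact C i j a x \<in> S k"
  "x \<in> S n \<Longrightarrow> inv_into (S n) (\<theta> n) (\<theta> n x) = x"
  using closed[of n] gd_closed mact_closed inj by (auto simp: closed_sub_def)

lemma image_in [simp]: "x \<in> S n \<Longrightarrow> \<theta> n x \<in> \<theta> n ` S n"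
  by simp

lemma image_mod_simps [simp]:
  "rcar (gcomp (image_mod \<theta> S C) n) = \<theta> n ` S n"
  "rzero (gcomp (image_mod \<theta> S C) n) = \<theta> n (rzero (gcomp C n))"
  "\<lbrakk>x \<in> S n; y \<in> S n\<rbrakk> \<Longrightarrow> radd (gcomp (image_mod \<theta> S C) n) (\<theta> n x) (\<theta> n y) = \<theta> n (radd (gcomp C n) x y)"
  "x \<in> S n \<Longrightarrow> rsmul (gcomp (image_mod \<theta> S C) n) r (\<theta> n x) = \<theta> n (rsmul (gcomp C n) r x)"
  "x \<in> S n \<Longrightarrow> gd (image_mod \<theta> S C) n (\<theta> n x) = \<theta> (n - 1) (gd C n x)"
  "x \<in> S j \<Longrightarrow> mact (image_mod \<theta> S C) i j a (\<theta> j x) = \<theta> (i + j) (mact C i j a x)"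
  unfolding image_mod_def by simp_all

lemma rmodule_image: "rmodule (gcomp (image_mod \<theta> S C) n)"
proof -
  have "\<exists>y\<in>rcar (gcomp (image_mod \<theta> S C) n).
      radd (gcomp (image_mod \<theta> S C) n) (\<theta> n x) y = rzero (gcomp (image_mod \<theta> S C) n)" if "x \<in> S n" for x
    using that by (intro bexI[of _ "\<theta> n (rneg (gcomp C n) x)"]) simp_all
  then show ?thesis
    unfolding rmodule_def by (auto simp: radd_ac add_rsmul)
qed

lemma dg_amodule_image: "dg_amodule A (image_mod \<theta> S C)"
proof -
  have "dg_rmodule (image_mod \<theta> S C)"
    unfolding dg_rmodule_def rlin_def using rmodule_image by auto
  moreover have "mact (image_mod \<theta> S C) (i + j) k (amul A i j a b) (\<theta> k x) =
      mact (image_mod \<theta> S C) i (j + k) a (mact (image_mod \<theta> S C) j k b (\<theta> k x))"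
    if "a \<in> rcar (gcomp A i)" "b \<in> rcar (gcomp A j)" "x \<in> S k" for i j k a b x
    using that mact_amul[of a i b j x k "i + j"] by (simp add: add.assoc)
  moreover have "gd (image_mod \<theta> S C) (i + j) (mact (image_mod \<theta> S C) i j a (\<theta> j x)) =
      radd (gcomp (image_mod \<theta> S C) (i + j - 1)) (mact (image_mod \<theta> S C) (i - 1) j (gd A i a) (\<theta> j x))
        (rsmul (gcomp (image_mod \<theta> S C) (i + j - 1)) (sgnr i)
           (mact (image_mod \<theta> S C) i (j - 1) a (gd (image_mod \<theta> S C) j (\<theta> j x))))"
    if "a \<in> rcar (gcomp A i)" "x \<in> S j" for i j a x
  proof -
    have "S (i - 1 + j) = S (i + j - 1)" "S (i + (j - 1)) = S (i + j - 1)" by (simp_all add: algebra_simps)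
    with that gd_mact[of a i x j "i + j"] show ?thesis by (simp add: add_diff_eq diff_add_eq)
  qed
  ultimately show ?thesis
    unfolding dg_amodule_def by auto
qed

lemma dg_amap_inv: "dg_amap A (image_mod \<theta> S C) C (\<lambda>n. inv_into (S n) (\<theta> n))"
  unfolding dg_amap_def dg_rmap_def rlin_def by auto

lemma dg_rmap_image:
  assumes "dg_rmap Q C \<kappa>" and "\<And>n q. q \<in> rcar (gcomp Q n) \<Longrightarrow> \<kappa> n q \<in> S n"
    and Q: "dg_rmodule Q"
  shows "dg_rmap Q (image_mod \<theta> S C) (\<lambda>n q. \<theta> n (\<kappa> n q))"
proof -
  interpret Q: dg_rmod Q by unfold_locales (fact Q)
  show ?thesis
    using assms(2) rlin_radd[OF dg_rmap_rlin[OF assms(1)]] rlin_rsmul[OF dg_rmap_rlin[OF assms(1)]]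
      dg_rmap_gd[OF assms(1)]
    unfolding dg_rmap_def rlin_def by simp
qed

end

text \<open>The A-submodule generated by the image of \<kappa>. Adding one product at a time gives
  an induction principle in which identities need only be checked on a single product a \<kappa>(q)
  and carried across a sum.\<close>

inductive gen :: "('r::comm_ring_1, 'a) dgalg \<Rightarrow> ('r, 'q) dgmod \<Rightarrow> ('r, 'a, 'm) dgamod \<Rightarrow> (int \<Rightarrow> 'q \<Rightarrow> 'm) \<Rightarrow> int \<Rightarrow> 'm \<Rightarrow> bool"
  for A Q C \<kappa> where
  gen_zero: "gen A Q C \<kappa> n (rzero (gcomp C n))"
| gen_add: "\<lbrakk>a \<in> rcar (gcomp A i); q \<in> rcar (gcomp Q j); gen A Q C \<kappa> (i + j) x\<rbrakk>
    \<Longrightarrow> gen A Q C \<kappa> (i + j) (radd (gcomp C (i + j)) (mact C i j a (\<kappa> j q)) x)"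

locale dg_gen = dg_amod A C + Q: dg_rmod Q
  for A :: "('r::comm_ring_1, 'a) dgalg" and C :: "('r, 'a, 'm) dgamod" and Q :: "('r, 'q) dgmod" +
  fixes \<kappa> :: "int \<Rightarrow> 'q \<Rightarrow> 'm"
  assumes map: "dg_rmap Q C \<kappa>"
begin

abbreviation "G \<equiv> gen A Q C \<kappa>"

lemma map_in [simp]: "q \<in> rcar (gcomp Q n) \<Longrightarrow> \<kappa> n q \<in> rcar (gcomp C n)"
  using rlin_in[OF dg_rmap_rlin[OF map]] .

lemma gen_in [simp]: "G n x \<Longrightarrow> x \<in> rcar (gcomp C n)"
  by (induction rule: gen.induct) simp_all

lemma gen_mult: "\<lbrakk>a \<in> rcar (gcomp A i); q \<in> rcar (gcomp Q j); n = i + j\<rbrakk> \<Longrightarrow> G n (mact C i j a (\<kappa> j q))"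
  using gen_add[OF _ _ gen_zero, of a A i q Q j C \<kappa>] by simp

lemma gen_unit: "q \<in> rcar (gcomp Q n) \<Longrightarrow> G n (\<kappa> n q)"
  using gen_mult[of "aone A" 0 q n n] by simp

lemma gen_radd: "G n x \<Longrightarrow> G n y \<Longrightarrow> G n (radd (gcomp C n) x y)"
proof (induction rule: gen.induct)
  case (gen_add a i q j x)
  then show ?case
    using gen.gen_add[OF gen_add(1,2) gen_add.IH[OF gen_add.prems]] by (simp add: radd_assoc)
qed simp

lemma gen_rsmul: "G n x \<Longrightarrow> G n (rsmul (gcomp C n) r x)"
proof (induction rule: gen.induct)
  case (gen_add a i q j x)
  then show ?case
    using gen.gen_add[OF rsmul_in[OF A.rmodule_gcomp gen_add(1)] gen_add(2) gen_add.IH] by simp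
qed (simp add: gen_zero)

text \<open>Since \<kappa> is a chain map, the Leibniz rule turns d (a \<kappa>(q)) into the two
  products with factors (d a, q) and (a, d q), again of the generating form.\<close>

lemma gen_gd: "G n x \<Longrightarrow> G (n - 1) (gd C n x)"
proof (induction rule: gen.induct)
  case (gen_add a i q j x)
  have "G (i + j - 1) (mact C (i - 1) j (gd A i a) (\<kappa> j q))"
    using gen_add by (intro gen_mult) auto
  moreover have "G (i + j - 1) (rsmul (gcomp C (i + j - 1)) (sgnr i) (mact C i (j - 1) a (\<kappa> (j - 1) (gd Q j q))))"
    using gen_add by (intro gen_rsmul gen_mult) auto
  ultimately show ?case
    using gen_add gen_radd by (simp add: gd_mact dg_rmap_gd[OF map])
qed (simp add: gen_zero)

lemma gen_mact: "G j x \<Longrightarrow> b \<in> rcar (gcomp A k) \<Longrightarrow> G (k + j) (mact C k j b x)"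
proof (induction rule: gen.induct)
  case (gen_add a i q j x)
  have "G (k + (i + j)) (mact C (k + i) j (amul A k i b a) (\<kappa> j q))"
    using gen_add by (intro gen_mult) auto
  then show ?case
    using gen_add gen_radd by (simp add: mact_amul)
qed (simp add: gen_zero)

lemma dg_image_gen:
  assumes "\<And>n. inj_on (\<theta> n) {x. G n x}"
  shows "dg_image A C (\<lambda>n. {x. G n x}) \<theta>"
  by unfold_locales
    (auto simp: closed_sub_def gen_zero gen_radd gen_rsmul gen_gd gen_mact assms)

text \<open>The submodule generated by the image of \<open>\<kappa>\<close> is small: it is covered by the linear
  combinations of formal symbols \<open>(i, a, q)\<close>, so it can be coded by sets of such combinations.\<close>
lemma gen_code:
  "\<exists>\<theta> :: int \<Rightarrow> 'm \<Rightarrow> (int \<times> 'a \<times> 'q \<Rightarrow> 'r) set. \<forall>n. inj_on (\<theta> n) {x. G n x}"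
proof -
  \<comment> \<open>The symbol (i, a, q) stands for the product a \<kappa>(q) in degree n. The index
    i is recorded because the same \<open>a\<close> may belong to the carriers of several
    degrees.\<close>
  define Sy where "Sy n = {(i, a, q). a \<in> rcar (gcomp A i) \<and> q \<in> rcar (gcomp Q (n - i))}" for n
  define v where "v n = (\<lambda>(i, a, q). mact C i (n - i) a (\<kappa> (n - i) q))" for n
  have "\<exists>L. rlin (free_mod (Sy n)) (gcomp C n) L \<and> (\<forall>s\<in>Sy n. L (unit_vec (Sy n) s) = v n s)" for n
  proof -
    have "v n s \<in> rcar (gcomp C n)" if "s \<in> Sy n" for s
      using that by (auto simp: Sy_def v_def)
    then show ?thesis
      using free_mod_extension[of "gcomp C n" "Sy n" "v n"] rmodule_gcomp by metis
  qed
  then obtain L where L: "\<And>n. rlin (free_mod (Sy n)) (gcomp C n) (L n)"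
    "\<And>n s. s \<in> Sy n \<Longrightarrow> L n (unit_vec (Sy n) s) = v n s"
    by metis
  have cover: "x \<in> L n ` rcar (free_mod (Sy n))" if "G n x" for n x
    using that
  proof (induction rule: gen.induct)
    case (gen_zero n)
    show ?case
      using rlin_rzero[OF L(1)] rzero_in[OF rmodule_free_mod] by (metis imageI rmodule_free_mod rmodule_gcomp)
  next
    case (gen_add a i q j x)
    then obtain y where y: "y \<in> rcar (free_mod (Sy (i + j)))" "x = L (i + j) y" by blast
    have s: "(i, a, q) \<in> Sy (i + j)" using gen_add by (simp add: Sy_def)
    let ?u = "unit_vec (Sy (i + j)) (i, a, q)"
    have "radd (gcomp C (i + j)) (mact C i j a (\<kappa> j q)) x = L (i + j) (radd (free_mod (Sy (i + j))) ?u y)"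
      using rlin_radd[OF L(1) unit_vec_in[OF s] y(1)] L(2)[OF s] y(2) by (simp add: v_def)
    then show ?case
      using radd_in[OF rmodule_free_mod unit_vec_in[OF s] y(1)] by blast
  qed
  \<comment> \<open>An element is coded by its fibre under \<open>L n\<close>. Fibres over distinct
    elements are disjoint, and by \<open>cover\<close> they are nonempty on the generated submodule,
    so the code determines the element.\<close>
  have "inj_on (\<lambda>x. {y \<in> rcar (free_mod (Sy n)). L n y = x}) {x. G n x}" for n
    using cover by (intro inj_onI) blast
  then show ?thesis by (intro exI[of _ "\<lambda>n x. {y \<in> rcar (free_mod (Sy n)). L n y = x}"] allI)
qed

end

section \<open>Generation of the tensor product and extension into arbitrary types\<close>

locale dg_tensor = dg_gen A X Q \<iota>
  for A :: "('r::comm_ring_1, 'a) dgalg" and X :: "('r, 'a, 'p) dgamod" and Q :: "('r, 'q) dgmod" and \<iota> +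
  assumes tensor: "is_tensor_ext A Q X \<iota>"
begin

text \<open>Extend \<iota> to a map from \<open>X\<close> into its generated submodule. Followed by
  the inclusion, it is an endomorphism of \<open>X\<close> that fixes the image of \<open>Q\<close>,
  hence the identity by uniqueness. The submodule has the element type of \<open>X\<close>, so the
  first test type suffices.\<close>

lemma tensor_gen:
  assumes "x \<in> rcar (gcomp X n)"
  shows "G n x"
proof -
  interpret S: dg_image A X "\<lambda>n. {x. G n x}" "\<lambda>n x. x"
    by (rule dg_image_gen) simp
  let ?S = "image_mod (\<lambda>n x. x) (\<lambda>n. {x. G n x}) X"
  note ext = tensor[unfolded is_tensor_ext_def ext_up_def, THEN conjunct2, THEN conjunct1, rule_format]
  have "dg_rmap Q ?S \<iota>" using S.dg_rmap_image[OF map _ Q.dg_rmodule] gen_unit by simp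
  then obtain h where h: "dg_amap A X ?S h" "\<And>n q. q \<in> rcar (gcomp Q n) \<Longrightarrow> h n (\<iota> n q) = \<iota> n q"
    using ext[OF conjI[OF S.dg_amodule_image]] by metis
  have hG: "G n (h n x)" if "x \<in> rcar (gcomp X n)" for n x
    using rlin_in[OF dg_amap_rlin[OF h(1)] that] by simp
  have inv: "inv_into {x. G n x} (\<lambda>x. x) y = y" if "G n y" for n y
    using S.S_rules(7)[of y n] that by simp
  have hX: "dg_amap A X X h"
  proof -
    have "rlin (gcomp X n) (gcomp X n) (\<lambda>x. inv_into {x. G n x} (\<lambda>x. x) (h n x))" for n
      by (rule rlin_comp[OF dg_amap_rlin[OF h(1)] dg_amap_rlin[OF S.dg_amap_inv]])
    then have "rlin (gcomp X n) (gcomp X n) (h n)" for n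
      unfolding rlin_def by (simp add: inv hG)
    moreover have "h (n - 1) (gd X n x) = gd X n (h n x)" if "x \<in> rcar (gcomp X n)" for n x
      using dg_amap_gd[OF h(1) that] S.image_mod_simps(5)[of "h n x" n] hG[OF that] by simp
    moreover have "h (i + j) (mact X i j a x) = mact X i j a (h j x)"
      if "a \<in> rcar (gcomp A i)" "x \<in> rcar (gcomp X j)" for i j a x
      using dg_amap_mact[OF h(1) that] S.image_mod_simps(6)[of "h j x" j] hG[OF that(2)] by simp
    ultimately show ?thesis unfolding dg_amap_def dg_rmap_def by blast
  qed
  have idX: "dg_amap A X X (\<lambda>n x. x)"
    unfolding dg_amap_def dg_rmap_def rlin_def by simp
  \<comment> \<open>The universal map for the target \<open>X\<close> and \<iota>; both
    \<open>h\<close> and the identity must agree with it.\<close>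
  obtain h0 where h0: "\<And>h'. dg_amap A X X h' \<Longrightarrow> (\<forall>n. \<forall>q\<in>rcar (gcomp Q n). h' n (\<iota> n q) = \<iota> n q)
      \<Longrightarrow> (\<forall>n. \<forall>x\<in>rcar (gcomp X n). h' n x = h0 n x)"
    using ext[OF conjI[OF dg_amodule map]] by blast
  have "h n x = x"
    using h0[OF hX] h0[OF idX] h(2) assms by simp
  then show ?thesis using hG[OF assms] by simp
qed

lemma tensor_induct [consumes 1, case_names zero add]:
  assumes "x \<in> rcar (gcomp X n)"
    and "\<And>n. Pr n (rzero (gcomp X n))"
    and "\<And>i j a q x. \<lbrakk>a \<in> rcar (gcomp A i); q \<in> rcar (gcomp Q j); x \<in> rcar (gcomp X (i + j)); Pr (i + j) x\<rbrakk>
      \<Longrightarrow> Pr (i + j) (radd (gcomp X (i + j)) (mact X i j a (\<iota> j q)) x)"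
  shows "Pr n x"
  using tensor_gen[OF assms(1)]
  by (induction rule: gen.induct) (auto intro: assms gen_in)

text \<open>The element type of \<open>C\<close> is arbitrary, so the universal property does not
  apply to \<open>C\<close>. It does apply to a coded copy of the submodule generated by \<kappa>,
  whose type is the second test type; decoding carries the extension back into
  \<open>C\<close>.\<close>

lemma tensor_extend:
  fixes C :: "('r, 'a, 'c) dgamod"
  assumes C: "dg_amodule A C" and \<kappa>: "dg_rmap Q C \<kappa>"
  obtains h where "dg_amap A X C h" "\<And>n q. q \<in> rcar (gcomp Q n) \<Longrightarrow> h n (\<iota> n q) = \<kappa> n q"
proof -
  interpret C: dg_amod A C by (rule dg_amodI[OF A.dg_algebra C])
  interpret C: dg_gen A C Q \<kappa> by unfold_locales (fact \<kappa>)
  obtain \<theta> :: "int \<Rightarrow> _ \<Rightarrow> (int \<times> 'a \<times> 'q \<Rightarrow> 'r) set" where \<theta>: "\<And>n. inj_on (\<theta> n) {x. C.G n x}"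
    using C.gen_code by auto
  interpret S: dg_image A C "\<lambda>n. {x. C.G n x}" \<theta>
    by (rule C.dg_image_gen) (fact \<theta>)
  let ?S = "image_mod \<theta> (\<lambda>n. {x. C.G n x}) C"
  have ext: "\<exists>h. dg_amap A X N h \<and> (\<forall>n. \<forall>x\<in>rcar (gcomp Q n). h n (\<iota> n x) = g n x)"
    if "dg_amodule A N" "dg_rmap Q N g" for N :: "('r, 'a, (int \<times> 'a \<times> 'q \<Rightarrow> 'r) set) dgamod" and g
    using tensor that unfolding is_tensor_ext_def ext_up_def by (elim conjE allE[of _ N] allE[of _ g]) auto
  have "dg_rmap Q ?S (\<lambda>n q. \<theta> n (\<kappa> n q))"
    using S.dg_rmap_image[OF \<kappa> _ Q.dg_rmodule] C.gen_unit by simp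
  from ext[OF S.dg_amodule_image this] obtain h where h: "dg_amap A X ?S h" "\<And>n q. q \<in> rcar (gcomp Q n) \<Longrightarrow> h n (\<iota> n q) = \<theta> n (\<kappa> n q)"
    by auto
  let ?h = "\<lambda>n x. inv_into {x. C.G n x} (\<theta> n) (h n x)"
  show thesis
  proof
    have "dg_amap A X C ?h"
      unfolding dg_amap_def dg_rmap_def
    proof (intro conjI allI ballI)
      show "rlin (gcomp X n) (gcomp C n) (?h n)" for n
        by (rule rlin_comp[OF dg_amap_rlin[OF h(1)] dg_amap_rlin[OF S.dg_amap_inv]])
      show "?h (n - 1) (gd X n x) = gd C n (?h n x)" if "x \<in> rcar (gcomp X n)" for n x
        using that dg_amap_gd[OF h(1) that] dg_amap_gd[OF S.dg_amap_inv rlin_in[OF dg_amap_rlin[OF h(1)] that]]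
        by simp
      show "?h (i + j) (mact X i j a x) = mact C i j a (?h j x)"
        if "a \<in> rcar (gcomp A i)" "x \<in> rcar (gcomp X j)" for i j a x
        using that dg_amap_mact[OF h(1) that]
          dg_amap_mact[OF S.dg_amap_inv that(1) rlin_in[OF dg_amap_rlin[OF h(1)] that(2)]]
        by simp
    qed
    then show "dg_amap A X C ?h" .
    show "?h n (\<iota> n q) = \<kappa> n q" if "q \<in> rcar (gcomp Q n)" for n q
      using h(2)[OF that] S.S_rules(7) C.gen_unit[OF that] by simp
  qed
qed

end

text \<open>The coinduced module: graded linear maps into \<open>E\<close> that need not commute with the
  differentials correspond to chain maps into \<open>cone A E\<close> via \<open>x \<mapsto> (k x, k (d x))\<close>.
  Only the graded module underlying \<open>E\<close> enters.\<close>

definition cone :: "('r::comm_ring_1, 'a) dgalg \<Rightarrow> ('r, 'a, 'm) dgamod \<Rightarrow> ('r, 'a, 'm \<times> 'm) dgamod" where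
  "cone A E = \<lparr>
     gcomp = (\<lambda>n. prodm (gcomp E n) (gcomp E (n - 1))),
     gd = (\<lambda>n x. (snd x, rzero (gcomp E (n - 2)))),
     mact = (\<lambda>i j a x. (mact E i j a (fst x),
       radd (gcomp E (i + j - 1)) (mact E (i - 1) j (gd A i a) (fst x))
         (rsmul (gcomp E (i + j - 1)) (sgnr i) (mact E i (j - 1) a (snd x))))) \<rparr>"

lemma cone_simps [simp]:
  "gcomp (cone A E) n = prodm (gcomp E n) (gcomp E (n - 1))"
  "gd (cone A E) n x = (snd x, rzero (gcomp E (n - 2)))"
  "mact (cone A E) i j a x = (mact E i j a (fst x),
       radd (gcomp E (i + j - 1)) (mact E (i - 1) j (gd A i a) (fst x))
         (rsmul (gcomp E (i + j - 1)) (sgnr i) (mact E i (j - 1) a (snd x))))"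
  unfolding cone_def by simp_all

lemma radd_rsmul_minus:
  "\<lbrakk>rmodule M; x \<in> rcar M\<rbrakk> \<Longrightarrow> radd M (rsmul M r x) (rsmul M (- r) x) = rzero M"
  by (simp add: add_rsmul[symmetric])

text \<open>The Leibniz rule for 1 = 1 1 reads d 1 = d 1 + d 1. Needed for the unit to act as the
  identity on \<open>cone A M\<close>, where d a enters the action.\<close>

lemma (in dg_alg) gd_aone [simp]: "gd A 0 (aone A) = rzero (gcomp A (- 1))"
proof -
  have one: "amul A 0 i (aone A) a = a" "amul A i 0 a (aone A) = a" if "a \<in> rcar (gcomp A i)" for i a
    using dg_algebra that unfolding dg_algebra_def by simp_all
  have "gd A 0 (aone A) = radd (gcomp A (- 1)) (gd A 0 (aone A)) (gd A 0 (aone A))"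
    using gd_amul[of "aone A" 0 "aone A" 0] one[of "aone A" 0] one[of "gd A 0 (aone A)" "- 1"] by simp
  then show ?thesis
    using radd_cancel_left[of "gcomp A (- 1)" "gd A 0 (aone A)" "gd A 0 (aone A)" "rzero (gcomp A (- 1))"]
    by simp
qed

context dg_amod
begin

lemma dg_rmodule_cone: "dg_rmodule (cone A M)"
  unfolding dg_rmodule_def rlin_def by auto

text \<open>The second coordinate of the action is k (d (a x)) expanded by the Leibniz rule, with k
  x and k (d x) replaced by the two coordinates. In the Leibniz identity for the cone, the two terms
  with d a applied to the second coordinate have opposite signs and cancel.\<close>

lemma dg_amodule_cone: "dg_amodule A (cone A M)"
proof -
  note idx = add_diff_eq diff_add_eq diff_diff_eq add.assoc[symmetric]
  have act: "mact (cone A M) i j a x \<in> rcar (gcomp (cone A M) (i + j))"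
    if "a \<in> rcar (gcomp A i)" "x \<in> rcar (gcomp (cone A M) j)" for i j a x
    using that by auto
  have left: "mact (cone A M) i j (radd (gcomp A i) a a') x =
      radd (gcomp (cone A M) (i + j)) (mact (cone A M) i j a x) (mact (cone A M) i j a' x)"
    if "a \<in> rcar (gcomp A i)" "a' \<in> rcar (gcomp A i)" "x \<in> rcar (gcomp (cone A M) j)" for i j a a' x
    using that by (auto simp: idx radd_ac)
  have right: "mact (cone A M) i j a (radd (gcomp (cone A M) j) x x') =
      radd (gcomp (cone A M) (i + j)) (mact (cone A M) i j a x) (mact (cone A M) i j a x')"
    if "a \<in> rcar (gcomp A i)" "x \<in> rcar (gcomp (cone A M) j)" "x' \<in> rcar (gcomp (cone A M) j)" for i j a x x'
    using that by (auto simp: idx radd_ac)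
  have smul: "mact (cone A M) i j (rsmul (gcomp A i) r a) x = rsmul (gcomp (cone A M) (i + j)) r (mact (cone A M) i j a x)"
    "mact (cone A M) i j a (rsmul (gcomp (cone A M) j) r x) = rsmul (gcomp (cone A M) (i + j)) r (mact (cone A M) i j a x)"
    if "a \<in> rcar (gcomp A i)" "x \<in> rcar (gcomp (cone A M) j)" for i j a x r
    using that by (auto simp: idx mult.commute)
  have assoc: "mact (cone A M) (i + j) k (amul A i j a b) x = mact (cone A M) i (j + k) a (mact (cone A M) j k b x)"
    if "a \<in> rcar (gcomp A i)" "b \<in> rcar (gcomp A j)" "x \<in> rcar (gcomp (cone A M) k)" for i j k a b x
    using that by (auto simp: idx radd_ac A.gd_amul mact_amul)
  have one: "mact (cone A M) 0 k (aone A) x = x" if "x \<in> rcar (gcomp (cone A M) k)" for k x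
    using that by auto
  have leib: "gd (cone A M) (i + j) (mact (cone A M) i j a x) =
      radd (gcomp (cone A M) (i + j - 1)) (mact (cone A M) (i - 1) j (gd A i a) x)
        (rsmul (gcomp (cone A M) (i + j - 1)) (sgnr i) (mact (cone A M) i (j - 1) a (gd (cone A M) j x)))"
    if "a \<in> rcar (gcomp A i)" "x \<in> rcar (gcomp (cone A M) j)" for i j a x
    using that by (auto simp: idx radd_ac radd_rsmul_minus)
  show ?thesis
    by (rule dg_amoduleI) (fact dg_rmodule_cone act left right smul assoc one leib)+
qed

end

lemma rlin_into_subm: "\<lbrakk>rlin M N f; \<And>x. x \<in> rcar M \<Longrightarrow> f x \<in> S\<rbrakk> \<Longrightarrow> rlin M (subm N S) f"
  unfolding rlin_def by simp

lemma rlin_from_subm: "\<lbrakk>rlin M N f; S \<subseteq> rcar M\<rbrakk> \<Longrightarrow> rlin (subm M S) N f"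
  unfolding rlin_def subset_eq by simp

text \<open>The linear maps \<open>k\<close> give a chain map into the cone; extend that one and
  keep the first coordinate, on which A acts as on \<open>E\<close>.\<close>

lemma (in dg_tensor) tensor_extend_linear:
  fixes E :: "('r, 'a, 'e) dgamod"
  assumes E: "dg_amodule A E" and k: "\<And>n. rlin (gcomp Q n) (gcomp E n) (k n)"
  obtains h where "\<And>n. rlin (gcomp X n) (gcomp E n) (h n)"
    "\<And>i j a x. \<lbrakk>a \<in> rcar (gcomp A i); x \<in> rcar (gcomp X j)\<rbrakk> \<Longrightarrow> h (i + j) (mact X i j a x) = mact E i j a (h j x)"
    "\<And>n q. q \<in> rcar (gcomp Q n) \<Longrightarrow> h n (\<iota> n q) = k n q"
proof -
  interpret E: dg_amod A E by (rule dg_amodI[OF A.dg_algebra E])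
  have "dg_rmap Q (cone A E) (\<lambda>n q. (k n q, k (n - 1) (gd Q n q)))"
    unfolding dg_rmap_def
  proof (intro conjI allI ballI)
    show "rlin (gcomp Q n) (gcomp (cone A E) n) (\<lambda>q. (k n q, k (n - 1) (gd Q n q)))" for n
      using k[of n] rlin_comp[OF Q.rlin_gd k, of n] by (simp add: rlin_prodm)
    show "(k (n - 1) (gd Q n q), k (n - 1 - 1) (gd Q (n - 1) (gd Q n q))) =
        gd (cone A E) n (k n q, k (n - 1) (gd Q n q))" if "q \<in> rcar (gcomp Q n)" for n q
      using that rlin_rzero[OF k Q.rmodule_gcomp E.rmodule_gcomp, of "n - 2"] by simp
  qed
  then obtain h where h: "dg_amap A X (cone A E) h"
    "\<And>n q. q \<in> rcar (gcomp Q n) \<Longrightarrow> h n (\<iota> n q) = (k n q, k (n - 1) (gd Q n q))"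
    using tensor_extend[OF E.dg_amodule_cone] by blast
  show thesis
  proof
    show "rlin (gcomp X n) (gcomp E n) (\<lambda>x. fst (h n x))" for n
      using dg_amap_rlin[OF h(1), of n] unfolding rlin_def by auto
    show "fst (h (i + j) (mact X i j a x)) = mact E i j a (fst (h j x))"
      if "a \<in> rcar (gcomp A i)" "x \<in> rcar (gcomp X j)" for i j a x
      using dg_amap_mact[OF h(1) that] by simp
    show "fst (h n (\<iota> n q)) = k n q" if "q \<in> rcar (gcomp Q n)" for n q
      using h(2)[OF that] by simp
  qed
qed

section \<open>Lifting against surjective quasi-isomorphisms\<close>

text \<open>Injectivity on homology gives a primitive e' of \<open>x\<close>; its image may miss
  \<open>y\<close> by a cycle. Surjectivity on homology realises this cycle up to a boundary, and
  the boundary lifts because \<pi> is onto. Both corrections are cycles, so the differential stays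
  \<open>x\<close>.\<close>

lemma surjective_quasi_iso_lift:
  assumes E: "dg_rmodule E" and N: "dg_rmodule N" and \<pi>: "dg_rmap E N \<pi>" and q: "quasi_iso E N \<pi>"
    and surj: "\<And>n. \<pi> n ` rcar (gcomp E n) = rcar (gcomp N n)"
    and x: "x \<in> cycles E (n - 1)" and y: "y \<in> rcar (gcomp N n)" and xy: "\<pi> (n - 1) x = gd N n y"
  obtains e where "e \<in> rcar (gcomp E n)" "gd E n e = x" "\<pi> n e = y"
proof -
  interpret E: dg_rmod E by unfold_locales (fact E)
  interpret N: dg_rmod N by unfold_locales (fact N)
  note lin = dg_rmap_rlin[OF \<pi>]
  note q = q[unfolded quasi_iso_iff[OF E N \<pi>], rule_format]
  have "\<pi> (n - 1) x \<in> bounds N (n - 1)" using xy y N.gd_bounds by simp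
  then have "x \<in> bounds E (n - 1)" using q x by blast
  then obtain e' where e': "e' \<in> rcar (gcomp E n)" "x = gd E n e'" by (auto simp: bounds_def)
  have \<pi>e': "\<pi> n e' \<in> rcar (gcomp N n)" using rlin_in[OF lin e'(1)] .
  \<comment> \<open>The defect of e'; it is a cycle because d \<pi>(e') = \<pi>(x) = d y.\<close>
  define z where "z = radd (gcomp N n) y (rneg (gcomp N n) (\<pi> n e'))"
  have "z \<in> cycles N n"
    using y \<pi>e' xy dg_rmap_gd[OF \<pi> e'(1)] e'(2) by (simp add: z_def cycles_def)
  then obtain c where c: "c \<in> cycles E n" "radd (gcomp N n) z (rneg (gcomp N n) (\<pi> n c)) \<in> bounds N n"
    using q by blast
  have cE: "c \<in> rcar (gcomp E n)" "gd E n c = rzero (gcomp E (n - 1))" using c(1) by (simp_all add: cycles_def)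
  obtain u where u: "u \<in> rcar (gcomp N (n + 1))" "radd (gcomp N n) z (rneg (gcomp N n) (\<pi> n c)) = gd N (n + 1) u"
    using c(2) by (auto simp: bounds_def)
  obtain v where v: "v \<in> rcar (gcomp E (n + 1))" "u = \<pi> (n + 1) v" using u(1) surj[of "n + 1"] by blast
  have dv: "gd E (n + 1) v \<in> rcar (gcomp E n)" "gd E n (gd E (n + 1) v) = rzero (gcomp E (n - 1))"
    using v(1) E.gd_gd[of v "n + 1"] by simp_all
  have \<pi>dv: "\<pi> n (gd E (n + 1) v) = radd (gcomp N n) z (rneg (gcomp N n) (\<pi> n c))"
    using dg_rmap_gd[OF \<pi> v(1)] u(2) v(2) by simp
  have \<pi>c: "\<pi> n c \<in> rcar (gcomp N n)" using rlin_in[OF lin cE(1)] .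
  show thesis
  proof
    let ?e = "radd (gcomp E n) e' (radd (gcomp E n) c (gd E (n + 1) v))"
    show "?e \<in> rcar (gcomp E n)" using e' cE dv by simp
    show "gd E n ?e = x" using e' cE dv by simp
    have "\<pi> n ?e = radd (gcomp N n) (\<pi> n e') (radd (gcomp N n) (\<pi> n c)
        (radd (gcomp N n) z (rneg (gcomp N n) (\<pi> n c))))"
      using e' cE dv \<pi>dv by (simp add: rlin_radd[OF lin])
    also have "\<dots> = y"
      using y \<pi>e' \<pi>c by (simp add: z_def radd_ac)
    finally show "\<pi> n ?e = y" .
  qed
qed

lemma rlin_id_subm: "S \<subseteq> rcar M \<Longrightarrow> rlin (subm M S) M (\<lambda>x. x)"
  unfolding rlin_def by auto

text \<open>The compatibility conditions \<open>dw\<close> and \<open>dg\<close> are what any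
  solution forces: apply d to d k = k d + w, and apply \<pi> to it.\<close>

lemma s_projective_lift:
  fixes Q :: "('r::comm_ring_1, 'q) dgmod" and E :: "('r, 'e, 'y) dgmod_scheme" and N :: "('r, 'n, 'z) dgmod_scheme"
  assumes Q: "dg_rmodule Q" and sp: "s_projective Q"
    and E: "dg_rmodule E" and N: "dg_rmodule N" and \<pi>: "dg_rmap E N \<pi>" and qi: "quasi_iso E N \<pi>"
    and surj: "\<And>n. \<pi> n ` rcar (gcomp E n) = rcar (gcomp N n)"
    and w: "\<And>n. rlin (gcomp Q n) (gcomp E (n - 1)) (w n)"
    and g: "\<And>n. rlin (gcomp Q n) (gcomp N n) (g n)"
    and dw: "\<And>n q. q \<in> rcar (gcomp Q n) \<Longrightarrow>
      gd E (n - 1) (w n q) = rneg (gcomp E (n - 2)) (w (n - 1) (gd Q n q))"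
    and dg: "\<And>n q. q \<in> rcar (gcomp Q n) \<Longrightarrow>
      gd N n (g n q) = radd (gcomp N (n - 1)) (g (n - 1) (gd Q n q)) (\<pi> (n - 1) (w n q))"
  obtains k where "\<And>n. rlin (gcomp Q n) (gcomp E n) (k n)"
    "\<And>n q. q \<in> rcar (gcomp Q n) \<Longrightarrow> gd E n (k n q) = radd (gcomp E (n - 1)) (k (n - 1) (gd Q n q)) (w n q)"
    "\<And>n q. q \<in> rcar (gcomp Q n) \<Longrightarrow> \<pi> n (k n q) = g n q"
proof -
  interpret Q: dg_rmod Q by unfold_locales (fact Q)
  interpret E: dg_rmod E by unfold_locales (fact E)
  interpret N: dg_rmod N by unfold_locales (fact N)
  note lin\<pi> = dg_rmap_rlin[OF \<pi>]
  let ?B = "\<lambda>n. subm (gcomp Q n) (bounds Q n)"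
  let ?Z = "\<lambda>n. subm (gcomp Q n) (cycles Q n)"
  let ?H = "homology Q"
  have projB: "projective (?B n)" and projH: "projective (?H n)" for n
    using sp by (simp_all add: s_projective_def)
  have Bsub: "bounds Q n \<subseteq> rcar (gcomp Q n)" and Zsub: "cycles Q n \<subseteq> rcar (gcomp Q n)" for n
    using Q.closed_sub_bounds[of n] Q.closed_sub_cycles[of n] unfolding closed_sub_def by blast+
  have rZ: "rmodule (?Z n)" and rB: "rmodule (?B n)" and rH: "rmodule (?H n)" for n
    using projH[of n] projB[of n] by (simp_all add: rmodule_closed_sub projective_def)
  \<comment> \<open>A linear choice of primitives, obtained by lifting the identity of the
    projective module B_n through d. The image of \<open>s\<close> is the copy of B_n in degree n +
    1.\<close>
  have "\<exists>s. rlin (?B n) (gcomp Q (n + 1)) s \<and> (\<forall>b\<in>bounds Q n. gd Q (n + 1) (s b) = b)" for n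
  proof -
    have "rlin (gcomp Q (n + 1)) (gcomp Q n) (gd Q (n + 1))" using Q.rlin_gd[of "n + 1"] by simp
    from projective_lift[OF projB _ _ this rlin_id_subm[OF Bsub]]
    obtain s where "rlin (?B n) (gcomp Q (n + 1)) s" "\<And>b. b \<in> rcar (?B n) \<Longrightarrow> gd Q (n + 1) (s b) = b"
      by (auto simp: bounds_def)
    then show ?thesis by auto
  qed
  then obtain s where s: "\<And>n. rlin (?B n) (gcomp Q (n + 1)) (s n)"
    "\<And>n b. b \<in> bounds Q n \<Longrightarrow> gd Q (n + 1) (s n b) = b"
    by metis
  let ?cos = "\<lambda>n. coset (gcomp Q n) (bounds Q n)"
  have lin_cos: "rlin (?Z n) (?H n) (?cos n)" for n
    using rlin_coset[of "gcomp Q n" "cycles Q n" "bounds Q n"] by (simp add: homology_def)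
  \<comment> \<open>Projectivity of homology gives linear cycle representatives, the second
    splitting.\<close>
  have "\<exists>c. rlin (?H n) (?Z n) c \<and> (\<forall>X\<in>rcar (?H n). ?cos n (c X) = X)" for n
  proof -
    have "rlin (?H n) (?H n) (\<lambda>x. x)" by (simp add: rlin_def rH)
    from projective_lift[OF projH rZ rH lin_cos this]
    obtain c where "rlin (?H n) (?Z n) c" "\<And>X. X \<in> rcar (?H n) \<Longrightarrow> ?cos n (c X) = X"
      by (auto simp: Q.rcar_homology)
    then show ?thesis by blast
  qed
  then obtain c where c: "\<And>n. rlin (?H n) (?Z n) (c n)"
    "\<And>n X. X \<in> rcar (?H n) \<Longrightarrow> ?cos n (c n X) = X"
    by metis
  have cos_in: "?cos n z \<in> rcar (?H n)" if "z \<in> cycles Q n" for n z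
    using that by (simp add: Q.rcar_homology)
  have c_in: "c n X \<in> cycles Q n" if "X \<in> rcar (?H n)" for n X
    using rlin_in[OF c(1) that] by simp
  have s_in: "s n b \<in> rcar (gcomp Q (n + 1))" if "b \<in> bounds Q n" for n b
    using rlin_in[OF s(1), of b n] that by simp
  \<comment> \<open>The free choice: \<open>l b\<close> will be the value of \<open>k\<close> on
    \<open>s b\<close>, constrained only by \<pi>.\<close>
  have "\<exists>l. rlin (?B n) (gcomp E (n + 1)) l \<and> (\<forall>b\<in>bounds Q n. \<pi> (n + 1) (l b) = g (n + 1) (s n b))" for n
    using projective_lift[OF projB E.rmodule_gcomp N.rmodule_gcomp lin\<pi> rlin_comp[OF s(1) g]]
      surj[of "n + 1"] rlin_in[OF g s_in]
    by (metis subm_simps(1))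
  then obtain l where l: "\<And>n. rlin (?B n) (gcomp E (n + 1)) (l n)"
    "\<And>n b. b \<in> bounds Q n \<Longrightarrow> \<pi> (n + 1) (l n b) = g (n + 1) (s n b)"
    by metis
  \<comment> \<open>On a cycle z the term k (d z) vanishes, so \<open>k\<close> must solve d e = w z
    and \<pi> e = g z. These two facts are the hypotheses of
    \<open>surjective_quasi_iso_lift\<close> for that pair.\<close>
  have w_cyc: "w n z \<in> cycles E (n - 1)" if "z \<in> cycles Q n" for n z
    using dw[of z n] that rlin_in[OF w, of z n] rlin_rzero[OF w, of "n - 1"]
    by (simp add: cycles_def)
  have g_cyc: "gd N n (g n z) = \<pi> (n - 1) (w n z)" if "z \<in> cycles Q n" for n z
    using dg[of z n] that rlin_in[OF w, of z n] rlin_rzero[OF g, of "n - 1"] rlin_in[OF lin\<pi>, of "w n z" "n - 1"]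
    by (simp add: cycles_def)
  have "\<exists>u. rlin (?H n) (gcomp E n) u \<and> (\<forall>X\<in>rcar (?H n). gd E n (u X) = w n (c n X) \<and> \<pi> n (u X) = g n (c n X))" for n
  proof -
    have 1: "rlin (gcomp E n) (prodm (gcomp E (n - 1)) (gcomp N n)) (\<lambda>e. (gd E n e, \<pi> n e))"
      by (simp add: rlin_prodm E.rlin_gd lin\<pi>)
    have 2: "rlin (?H n) (prodm (gcomp E (n - 1)) (gcomp N n)) (\<lambda>X. (w n (c n X), g n (c n X)))"
      using rlin_comp[OF c(1) rlin_from_subm[OF w Zsub]] rlin_comp[OF c(1) rlin_from_subm[OF g Zsub]]
      by (simp add: rlin_prodm)
    have "(w n (c n X), g n (c n X)) \<in> (\<lambda>e. (gd E n e, \<pi> n e)) ` rcar (gcomp E n)" if "X \<in> rcar (?H n)" for X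
    proof -
      note z = c_in[OF that]
      obtain e where "e \<in> rcar (gcomp E n)" "gd E n e = w n (c n X)" "\<pi> n e = g n (c n X)"
        using surjective_quasi_iso_lift[OF E N \<pi> qi surj w_cyc[OF z] rlin_in[OF g Q.cycles_in[OF z]]]
          g_cyc[OF z] by metis
      then show ?thesis by (intro image_eqI[of _ _ e]) simp_all
    qed
    from projective_lift[OF projH E.rmodule_gcomp rmodule_prodm[OF E.rmodule_gcomp N.rmodule_gcomp] 1 2 this]
    obtain u where "rlin (?H n) (gcomp E n) u"
      "\<And>X. X \<in> rcar (?H n) \<Longrightarrow> (gd E n (u X), \<pi> n (u X)) = (w n (c n X), g n (c n X))" by blast
    then show ?thesis by auto
  qed
  then obtain u where u: "\<And>n. rlin (?H n) (gcomp E n) (u n)"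
    "\<And>n X. X \<in> rcar (?H n) \<Longrightarrow> gd E n (u n X) = w n (c n X)"
    "\<And>n X. X \<in> rcar (?H n) \<Longrightarrow> \<pi> n (u n X) = g n (c n X)"
    by metis

  \<comment> \<open>The boundary part of a cycle: what remains after subtracting the chosen
    representative of its class.\<close>
  define v where "v n z = radd (gcomp Q n) z (rneg (gcomp Q n) (c n (?cos n z)))" for n z
  have v_in: "v n z \<in> bounds Q n" if "z \<in> cycles Q n" for n z
  proof -
    have "c n (?cos n z) \<in> cycles Q n" using c_in cos_in that by blast
    moreover have "?cos n z = ?cos n (c n (?cos n z))" using c(2)[OF cos_in[OF that]] by simp
    ultimately show ?thesis
      using coset_eq_iff[OF Q.rmodule_gcomp Q.closed_sub_bounds] that Q.cycles_in unfolding v_def by blast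
  qed
  have lin_v: "rlin (?Z n) (?B n) (v n)" for n
  proof -
    have "rlin (?Z n) (gcomp Q n) (\<lambda>z. c n (?cos n z))"
      using rlin_comp[OF lin_cos rlin_comp[OF c(1) rlin_id_subm[OF Zsub]]] .
    then have "rlin (?Z n) (gcomp Q n) (v n)"
      unfolding v_def by (intro rlin_sum rlin_scale rlin_id_subm Zsub Q.rmodule_gcomp)
    then show ?thesis using v_in by (intro rlin_into_subm) auto
  qed
  \<comment> \<open>\<open>m\<close> is \<open>k\<close> on cycles. With k (s b) = l b, the equation
    at s b reads d (l b) = k b + w (s b); the last two terms are its solution for k b, and
    \<open>u\<close> supplies the value on the representative of the class.\<close>
  define m where "m n z = radd (gcomp E n) (u n (?cos n z))
      (radd (gcomp E n) (gd E (n + 1) (l n (v n z))) (rneg (gcomp E n) (w (n + 1) (s n (v n z)))))" for n z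
  have lin_m: "rlin (?Z n) (gcomp E n) (m n)" for n
  proof -
    have d: "rlin (gcomp E (n + 1)) (gcomp E n) (gd E (n + 1))" using E.rlin_gd[of "n + 1"] by simp
    have w': "rlin (gcomp Q (n + 1)) (gcomp E n) (w (n + 1))" using w[of "n + 1"] by simp
    show ?thesis
      unfolding m_def
      by (intro rlin_sum rlin_scale E.rmodule_gcomp rlin_comp[OF lin_cos u(1)]
          rlin_comp[OF lin_v rlin_comp[OF l(1) d]] rlin_comp[OF lin_v rlin_comp[OF s(1) w']])
  qed
  have m: "gd E n (m n z) = w n z" "\<pi> n (m n z) = g n z" if z: "z \<in> cycles Q n" for n z
  proof -
    let ?c = "c n (?cos n z)" and ?v = "v n z"
    let ?s = "s n ?v"
    note H = cos_in[OF z] and b = v_in[OF z]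
    have cQ: "?c \<in> rcar (gcomp Q n)" and vQ: "?v \<in> rcar (gcomp Q n)" and zQ: "z \<in> rcar (gcomp Q n)"
      using c_in[OF H] b z Zsub Bsub by blast+
    have sQ: "?s \<in> rcar (gcomp Q (n + 1))" by (rule s_in[OF b])
    have split: "z = radd (gcomp Q n) ?c ?v"
      using zQ cQ by (simp add: v_def radd_ac)
    have uE: "u n (?cos n z) \<in> rcar (gcomp E n)" using rlin_in[OF u(1) H] .
    have lE: "l n ?v \<in> rcar (gcomp E (n + 1))" using rlin_in[OF l(1)] b by simp
    have dlE: "gd E (n + 1) (l n ?v) \<in> rcar (gcomp E n)" using lE by simp
    have ddl: "gd E n (gd E (n + 1) (l n ?v)) = rzero (gcomp E (n - 1))" using E.gd_gd[OF lE] by simp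
    have wsE: "w (n + 1) ?s \<in> rcar (gcomp E n)" using rlin_in[OF w sQ] by simp
    have wE: "w n ?v \<in> rcar (gcomp E (n - 1))" "w n ?c \<in> rcar (gcomp E (n - 1))"
      using rlin_in[OF w] vQ cQ by blast+
    have dws: "gd E n (w (n + 1) ?s) = rneg (gcomp E (n - 1)) (w n ?v)"
      using dw[OF sQ] s(2)[OF b] by simp
    have "gd E n (m n z) = radd (gcomp E (n - 1)) (w n ?c) (w n ?v)"
      using uE dlE wsE ddl dws u(2)[OF H] wE by (simp add: m_def)
    also have "\<dots> = w n z"
      using rlin_radd[OF w cQ vQ] split by simp
    finally show "gd E n (m n z) = w n z" .
    have \<pi>E: "\<pi> n (w (n + 1) ?s) \<in> rcar (gcomp N n)" using rlin_in[OF lin\<pi> wsE] .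
    have gN: "g n ?v \<in> rcar (gcomp N n)" "g n ?c \<in> rcar (gcomp N n)"
      using rlin_in[OF g] vQ cQ by blast+
    have "\<pi> n (gd E (n + 1) (l n ?v)) = radd (gcomp N n) (g n ?v) (\<pi> n (w (n + 1) ?s))"
      using dg_rmap_gd[OF \<pi> lE] l(2)[OF b] dg[OF sQ] s(2)[OF b] by simp
    then have "\<pi> n (m n z) = radd (gcomp N n) (g n ?c) (g n ?v)"
      using uE dlE wsE u(3)[OF H] \<pi>E gN
      by (simp add: m_def rlin_radd[OF lin\<pi>] rlin_rsmul[OF lin\<pi>] radd_assoc)
    also have "\<dots> = g n z"
      using rlin_radd[OF g cQ vQ] split by simp
    finally show "\<pi> n (m n z) = g n z" .
  qed
  \<comment> \<open>A boundary has the zero class, so the \<open>u\<close>-term disappears and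
    exactly the value dictated by \<open>l\<close> is left.\<close>
  have m_bounds: "m n b = radd (gcomp E n) (gd E (n + 1) (l n b)) (rneg (gcomp E n) (w (n + 1) (s n b)))"
    if b: "b \<in> bounds Q n" for n b
  proof -
    have bQ: "b \<in> rcar (gcomp Q n)" using b Bsub by blast
    have z: "rzero (gcomp Q n) \<in> cycles Q n" by (simp add: cycles_def)
    have "?cos n b = ?cos n (rzero (gcomp Q n))"
      using b bQ by (simp add: coset_eq_iff)
    also have "\<dots> = rzero (?H n)"
      using rlin_rzero[OF lin_cos rZ rH, of n] by simp
    finally have 0: "?cos n b = rzero (?H n)" .
    have "v n b = b"
      using bQ rlin_rzero[OF c(1) rH rZ, of n] by (simp add: v_def 0)
    moreover have "l n b \<in> rcar (gcomp E (n + 1))" using rlin_in[OF l(1)] b by simp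
    moreover have "w (n + 1) (s n b) \<in> rcar (gcomp E n)" using rlin_in[OF w s_in[OF b]] by simp
    ultimately show ?thesis
      using rlin_rzero[OF u(1) rH E.rmodule_gcomp, of n] by (simp add: m_def 0)
  qed

  \<comment> \<open>Subtracting the chosen primitive of d q makes q a cycle, which gives the
    splitting of q into a cycle and an element of the copy of B_{n-1}.\<close>
  define z where "z n q = radd (gcomp Q n) q (rneg (gcomp Q n) (s (n - 1) (gd Q n q)))" for n q
  have z_in: "z n q \<in> cycles Q n" if "q \<in> rcar (gcomp Q n)" for n q
  proof -
    have b: "gd Q n q \<in> bounds Q (n - 1)" using that by (rule Q.gd_bounds)
    show ?thesis
      using that s(2)[OF b] s_in[OF b] unfolding z_def cycles_def by simp
  qed
  have lin_d: "rlin (gcomp Q n) (?B (n - 1)) (gd Q n)" for n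
    using Q.rlin_gd by (intro rlin_into_subm Q.gd_bounds)
  have lin_id: "rlin (gcomp Q n) (gcomp Q n) (\<lambda>x. x)" for n
    by (simp add: rlin_def)
  have lin_z: "rlin (gcomp Q n) (?Z n) (z n)" for n
  proof -
    have "rlin (gcomp Q n) (gcomp Q n) (\<lambda>q. s (n - 1) (gd Q n q))"
      using rlin_comp[OF lin_d s(1)] by simp
    then have "rlin (gcomp Q n) (gcomp Q n) (z n)"
      unfolding z_def by (intro rlin_sum rlin_scale lin_id Q.rmodule_gcomp)
    then show ?thesis using z_in by (intro rlin_into_subm) auto
  qed
  define k where "k n q = radd (gcomp E n) (l (n - 1) (gd Q n q)) (m n (z n q))" for n q
  show thesis
  proof
    show "rlin (gcomp Q n) (gcomp E n) (k n)" for n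
    proof -
      have "rlin (gcomp Q n) (gcomp E n) (\<lambda>q. l (n - 1) (gd Q n q))"
        using rlin_comp[OF lin_d l(1)] by simp
      then show ?thesis
        unfolding k_def by (intro rlin_sum rlin_comp[OF lin_z lin_m] E.rmodule_gcomp)
    qed
    fix n q assume q: "q \<in> rcar (gcomp Q n)"
    let ?b = "gd Q n q"
    let ?s = "s (n - 1) ?b"
    have b: "?b \<in> bounds Q (n - 1)" using q by (rule Q.gd_bounds)
    have bQ: "?b \<in> rcar (gcomp Q (n - 1))" using q by simp
    have sQ: "?s \<in> rcar (gcomp Q n)" using s_in[OF b] by simp
    have lE: "l (n - 1) ?b \<in> rcar (gcomp E n)" using rlin_in[OF l(1), of ?b "n - 1"] b by simp
    have zQ: "z n q \<in> rcar (gcomp Q n)" using z_in[OF q] Zsub by blast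
    have mE: "m n (z n q) \<in> rcar (gcomp E n)" using rlin_in[OF lin_m] z_in[OF q] by simp
    have split: "q = radd (gcomp Q n) (z n q) ?s"
      using q sQ by (simp add: z_def radd_ac)
    have wE: "w n ?s \<in> rcar (gcomp E (n - 1))" "w n (z n q) \<in> rcar (gcomp E (n - 1))"
      using rlin_in[OF w] sQ zQ by blast+
    have dlE: "gd E n (l (n - 1) ?b) \<in> rcar (gcomp E (n - 1))" using lE by simp
    have wq: "w n q = radd (gcomp E (n - 1)) (w n (z n q)) (w n ?s)"
      using rlin_radd[OF w zQ sQ] split by simp
    have 0: "gd Q (n - 1) ?b = rzero (gcomp Q (n - 2))" using q by simp
    have lr: "l (n - 1) (rzero (gcomp Q (n - 1))) = rzero (gcomp E n)" for n
      using rlin_rzero[OF l(1) rB, of "n - 1"] by simp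
    have sr: "s (n - 1) (rzero (gcomp Q (n - 1))) = rzero (gcomp Q n)" for n
      using rlin_rzero[OF s(1) rB, of "n - 1"] by simp
    have lk: "l (n - 1 - 1) (gd Q (n - 1) ?b) = rzero (gcomp E (n - 1))"
      using lr[of "n - 1"] 0 by simp
    have zk: "z (n - 1) ?b = ?b"
      using sr[of "n - 1"] 0 bQ by (simp add: z_def)
    \<comment> \<open>Because d d q = 0, the element d q is its own cycle part and k (d q) = d (l (d
      q)) - w (s (d q)). Adding w q cancels the last term and leaves d (l (d q)) + w z, where z is
      the cycle part of q; this is d (k q).\<close>
    have "k (n - 1) ?b = radd (gcomp E (n - 1)) (gd E n (l (n - 1) ?b)) (rneg (gcomp E (n - 1)) (w n ?s))"
      using m_bounds[OF b] lk dlE wE unfolding k_def zk by simp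
    then show "gd E n (k n q) = radd (gcomp E (n - 1)) (k (n - 1) (gd Q n q)) (w n q)"
      using lE mE m(1)[OF z_in[OF q]] dlE wE by (simp add: k_def[of n] wq radd_ac)
    have "g n q = radd (gcomp N n) (g n (z n q)) (g n ?s)"
      using rlin_radd[OF g zQ sQ] split by simp
    then show "\<pi> n (k n q) = g n q"
      using lE mE m(2)[OF z_in[OF q]] l(2)[OF b] rlin_in[OF g zQ] rlin_in[OF g sQ]
      by (simp add: k_def rlin_radd[OF lin\<pi>] radd_commute)
  qed
qed

text \<open>Solve the equation on \<open>Q\<close>, extend the solution linearly over A, and
  propagate both identities from \<open>Q\<close> to products. The sign in \<open>w_act\<close> is
  the one that a map of degree -1 acquires when it passes a scalar of degree i.\<close>

lemma (in dg_tensor) relative_lift: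
  fixes E :: "('r, 'a, 'e) dgamod" and N :: "('r, 'a, 'n) dgamod"
  assumes sp: "s_projective Q" and E: "dg_amodule A E" and N: "dg_amodule A N" and \<pi>: "dg_amap A E N \<pi>"
    and qi: "quasi_iso E N \<pi>" and surj: "\<And>n. \<pi> n ` rcar (gcomp E n) = rcar (gcomp N n)"
    and w: "\<And>n. rlin (gcomp X n) (gcomp E (n - 1)) (w n)"
    and w_act: "\<And>i j a x. \<lbrakk>a \<in> rcar (gcomp A i); x \<in> rcar (gcomp X j)\<rbrakk> \<Longrightarrow>
      w (i + j) (mact X i j a x) = rsmul (gcomp E (i + j - 1)) (sgnr i) (mact E i (j - 1) a (w j x))"
    and g: "\<And>n. rlin (gcomp X n) (gcomp N n) (g n)"
    and g_act: "\<And>i j a x. \<lbrakk>a \<in> rcar (gcomp A i); x \<in> rcar (gcomp X j)\<rbrakk> \<Longrightarrow> g (i + j) (mact X i j a x) = mact N i j a (g j x)"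
    and dw: "\<And>n x. x \<in> rcar (gcomp X n) \<Longrightarrow>
      gd E (n - 1) (w n x) = rneg (gcomp E (n - 2)) (w (n - 1) (gd X n x))"
    and dg: "\<And>n x. x \<in> rcar (gcomp X n) \<Longrightarrow>
      gd N n (g n x) = radd (gcomp N (n - 1)) (g (n - 1) (gd X n x)) (\<pi> (n - 1) (w n x))"
  shows "\<exists>h. (\<forall>n. rlin (gcomp X n) (gcomp E n) (h n)) \<and>
    (\<forall>i j. \<forall>a\<in>rcar (gcomp A i). \<forall>x\<in>rcar (gcomp X j). h (i + j) (mact X i j a x) = mact E i j a (h j x)) \<and>
    (\<forall>n. \<forall>x\<in>rcar (gcomp X n). gd E n (h n x) = radd (gcomp E (n - 1)) (h (n - 1) (gd X n x)) (w n x)) \<and>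
    (\<forall>n. \<forall>x\<in>rcar (gcomp X n). \<pi> n (h n x) = g n x)"
proof -
  interpret E: dg_amod A E by (rule dg_amodI[OF A.dg_algebra E])
  interpret N: dg_amod A N by (rule dg_amodI[OF A.dg_algebra N])
  note \<pi>r = dg_amap_rmap[OF \<pi>] and \<pi>lin = dg_amap_rlin[OF \<pi>]
  note \<iota> = dg_rmap_rlin[OF map] dg_rmap_gd[OF map]
  have w\<iota>: "rlin (gcomp Q n) (gcomp E (n - 1)) (\<lambda>q. w n (\<iota> n q))" for n by (rule rlin_comp[OF \<iota>(1) w])
  have g\<iota>: "rlin (gcomp Q n) (gcomp N n) (\<lambda>q. g n (\<iota> n q))" for n by (rule rlin_comp[OF \<iota>(1) g])
  have dw\<iota>: "gd E (n - 1) (w n (\<iota> n q)) = rneg (gcomp E (n - 2)) (w (n - 1) (\<iota> (n - 1) (gd Q n q)))"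
    and dg\<iota>: "gd N n (g n (\<iota> n q)) = radd (gcomp N (n - 1)) (g (n - 1) (\<iota> (n - 1) (gd Q n q))) (\<pi> (n - 1) (w n (\<iota> n q)))"
    if "q \<in> rcar (gcomp Q n)" for n q
    using that by (simp_all add: \<iota>(2) dw dg)
  obtain k where k: "\<And>n. rlin (gcomp Q n) (gcomp E n) (k n)"
    "\<And>n q. q \<in> rcar (gcomp Q n) \<Longrightarrow> gd E n (k n q) = radd (gcomp E (n - 1)) (k (n - 1) (gd Q n q)) (w n (\<iota> n q))"
    "\<And>n q. q \<in> rcar (gcomp Q n) \<Longrightarrow> \<pi> n (k n q) = g n (\<iota> n q)"
    using s_projective_lift[OF Q.dg_rmodule sp E.dg_rmodule N.dg_rmodule \<pi>r qi surj,
        where w = "\<lambda>n q. w n (\<iota> n q)" and g = "\<lambda>n q. g n (\<iota> n q)", OF w\<iota> g\<iota> dw\<iota> dg\<iota>]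
    by blast
  obtain h where h: "\<And>n. rlin (gcomp X n) (gcomp E n) (h n)"
    "\<And>i j a x. \<lbrakk>a \<in> rcar (gcomp A i); x \<in> rcar (gcomp X j)\<rbrakk> \<Longrightarrow> h (i + j) (mact X i j a x) = mact E i j a (h j x)"
    "\<And>n q. q \<in> rcar (gcomp Q n) \<Longrightarrow> h n (\<iota> n q) = k n q"
    using tensor_extend_linear[OF E k(1)] by blast
  have h_act: "h m (mact X i j a x) = mact E i j a (h j x)"
    if "a \<in> rcar (gcomp A i)" "x \<in> rcar (gcomp X j)" "m = i + j" for m i j a x
    using h(2) that by simp
  have [simp]: "h n x \<in> rcar (gcomp E m)" if "x \<in> rcar (gcomp X n)" "m = n" for n m x
    using rlin_in[OF h(1)] that by simp
  have [simp]: "w n x \<in> rcar (gcomp E m)" if "x \<in> rcar (gcomp X n)" "m = n - 1" for n m x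
    using rlin_in[OF w] that by simp
  have main: "gd E n (h n x) = radd (gcomp E (n - 1)) (h (n - 1) (gd X n x)) (w n x) \<and> \<pi> n (h n x) = g n x"
    if "x \<in> rcar (gcomp X n)" for n x
    using that
  proof (induction x rule: tensor_induct)
    case (zero n)
    show ?case
      using rlin_rzero[OF h(1), of n] rlin_rzero[OF h(1), of "n - 1"] rlin_rzero[OF w, of n]
        rlin_rzero[OF g, of n] rlin_rzero[OF \<pi>lin, of n] by simp
  next
    case (add i j a q x)
    let ?y = "\<iota> j q"
    let ?ay = "mact X i j a ?y"
    have y: "?y \<in> rcar (gcomp X j)" using add by simp
    have ay: "?ay \<in> rcar (gcomp X (i + j))" using add by simp
    have dhy: "gd E j (h j ?y) = radd (gcomp E (j - 1)) (h (j - 1) (gd X j ?y)) (w j ?y)"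
      using add(2) by (simp add: h(3) k(2) \<iota>(2)[symmetric])
    have \<pi>hy: "\<pi> j (h j ?y) = g j ?y"
      using add(2) by (simp add: h(3) k(3))
    have hay: "h (i + j) ?ay = mact E i j a (h j ?y)" using h_act add(1) y by simp
    \<comment> \<open>Both sides are expanded by the Leibniz rule. The terms with d a agree by
      linearity of \<open>h\<close>; the equation at y, multiplied by a, contributes the term with
      \<open>w\<close>, whose sign agrees with \<open>w_act\<close>.\<close>
    have "gd E (i + j) (h (i + j) ?ay) = radd (gcomp E (i + j - 1)) (h (i + j - 1) (gd X (i + j) ?ay)) (w (i + j) ?ay)"
      using add(1) y
      by (simp add: hay E.gd_mact gd_mact dhy w_act add_diff_eq diff_add_eq rlin_radd[OF h(1)]
          rlin_rsmul[OF h(1)] h_act radd_assoc)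
    moreover have "\<pi> (i + j) (h (i + j) ?ay) = g (i + j) ?ay"
      using add(1) y by (simp add: hay dg_amap_mact[OF \<pi>] \<pi>hy g_act)
    ultimately show ?case
      using add(3,4) ay
      by (simp add: rlin_radd[OF h(1)] rlin_radd[OF w] rlin_radd[OF g] rlin_radd[OF \<pi>lin] radd_ac)
  qed
  show ?thesis
    using h(1,2) main by (intro exI[of _ h]) simp
qed

section \<open>Total complexes\<close>

text \<open>In the application \<open>X p\<close> is the regraded module with \<open>P\<^sub>p\<^sub>,\<^sub>n\<^sub>-\<^sub>p\<close> in degree \<open>n\<close>,
  so that no bidegrees appear, and \<open>\<delta>\<close> is the differential \<open>d\<^sup>1\<close> including its sign.\<close>

locale dg_family = A: dg_alg A
  for A :: "('r::comm_ring_1, 'a) dgalg" +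
  fixes X :: "nat \<Rightarrow> ('r, 'a, 'p) dgamod" and \<delta> :: "nat \<Rightarrow> int \<Rightarrow> 'p \<Rightarrow> 'p"
  assumes X: "dg_amodule A (X p)"
    and rlin_\<delta>: "rlin (gcomp (X (Suc p)) n) (gcomp (X p) (n - 1)) (\<delta> p n)"
    and gd_\<delta>: "x \<in> rcar (gcomp (X (Suc p)) n) \<Longrightarrow>
      gd (X p) (n - 1) (\<delta> p n x) = rneg (gcomp (X p) (n - 2)) (\<delta> p (n - 1) (gd (X (Suc p)) n x))"
    and \<delta>_\<delta>: "x \<in> rcar (gcomp (X (Suc (Suc p))) n) \<Longrightarrow> \<delta> p (n - 1) (\<delta> (Suc p) n x) = rzero (gcomp (X p) (n - 2))"
    and \<delta>_mact: "\<lbrakk>a \<in> rcar (gcomp A i); x \<in> rcar (gcomp (X (Suc p)) j)\<rbrakk> \<Longrightarrow>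
      \<delta> p (i + j) (mact (X (Suc p)) i j a x) = rsmul (gcomp (X p) (i + j - 1)) (sgnr i) (mact (X p) i (j - 1) a (\<delta> p j x))"

sublocale dg_family \<subseteq> X: dg_amod A "X p" for p
  by (rule dg_amodI[OF A.dg_algebra X])

context dg_family
begin

definition tot :: "('r, 'a, nat \<Rightarrow> 'p) dgamod" where
  "tot = \<lparr> gcomp = (\<lambda>n. dsum (\<lambda>p. gcomp (X p) n)),
     gd = (\<lambda>n x p. radd (gcomp (X p) (n - 1)) (gd (X p) n (x p)) (\<delta> p n (x (Suc p)))),
     mact = (\<lambda>i j a x p. mact (X p) i j a (x p)) \<rparr>"

lemma tot_simps [simp]:
  "gcomp tot n = dsum (\<lambda>p. gcomp (X p) n)"
  "gd tot n x = (\<lambda>p. radd (gcomp (X p) (n - 1)) (gd (X p) n (x p)) (\<delta> p n (x (Suc p))))"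
  "mact tot i j a x = (\<lambda>p. mact (X p) i j a (x p))"
  unfolding tot_def by simp_all

lemma \<delta>_in [simp]: "\<lbrakk>x \<in> rcar (gcomp (X (Suc p)) n); m = n - 1\<rbrakk> \<Longrightarrow> \<delta> p n x \<in> rcar (gcomp (X p) m)"
  using rlin_in[OF rlin_\<delta>] by simp

lemma \<delta>_radd [simp]:
  "\<lbrakk>x \<in> rcar (gcomp (X (Suc p)) n); y \<in> rcar (gcomp (X (Suc p)) n)\<rbrakk> \<Longrightarrow>
    \<delta> p n (radd (gcomp (X (Suc p)) n) x y) = radd (gcomp (X p) (n - 1)) (\<delta> p n x) (\<delta> p n y)"
  and \<delta>_rsmul [simp]: "x \<in> rcar (gcomp (X (Suc p)) n) \<Longrightarrow>
    \<delta> p n (rsmul (gcomp (X (Suc p)) n) r x) = rsmul (gcomp (X p) (n - 1)) r (\<delta> p n x)"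
  and \<delta>_rzero [simp]: "\<delta> p n (rzero (gcomp (X (Suc p)) n)) = rzero (gcomp (X p) (n - 1))"
  using rlin_radd[OF rlin_\<delta>] rlin_rsmul[OF rlin_\<delta>] rlin_rzero[OF rlin_\<delta>] by auto

text \<open>Component p of the differential involves x p and x (p + 1), so its support lies in the
  union of the support of x and its preimage under \<open>Suc\<close>.\<close>

lemma gd_tot_in:
  assumes "x \<in> rcar (gcomp tot n)"
  shows "gd tot n x \<in> rcar (gcomp tot (n - 1))"
proof -
  let ?S = "{p. x p \<noteq> rzero (gcomp (X p) n)}"
  have "{p. x (Suc p) \<noteq> rzero (gcomp (X (Suc p)) n)} = Suc -` ?S" by auto
  moreover have "finite ?S" using assms by simp
  then have "finite (Suc -` ?S)" by (rule finite_vimageI) simp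
  ultimately have "finite (?S \<union> {p. x (Suc p) \<noteq> rzero (gcomp (X (Suc p)) n)})"
    using \<open>finite ?S\<close> by simp
  moreover have "{p. gd tot n x p \<noteq> rzero (gcomp (X p) (n - 1))} \<subseteq>
      ?S \<union> {p. x (Suc p) \<noteq> rzero (gcomp (X (Suc p)) n)}"
    by auto
  ultimately show ?thesis
    using assms by (auto intro: finite_subset)
qed

lemma mact_tot_in:
  assumes "a \<in> rcar (gcomp A i)" "x \<in> rcar (gcomp tot j)"
  shows "mact tot i j a x \<in> rcar (gcomp tot (i + j))"
proof -
  have "{p. mact tot i j a x p \<noteq> rzero (gcomp (X p) (i + j))} \<subseteq> {p. x p \<noteq> rzero (gcomp (X p) j)}"
    using assms(1) by auto
  then show ?thesis
    using assms by (auto intro: finite_subset)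
qed

lemma dg_amodule_tot: "dg_amodule A tot"
proof (rule dg_amoduleI)
  show "dg_rmodule tot"
    unfolding dg_rmodule_def
  proof (intro conjI allI ballI)
    show "rmodule (gcomp tot n)" for n by simp
    show "rlin (gcomp tot n) (gcomp tot (n - 1)) (gd tot n)" for n
      unfolding rlin_def
    proof (intro conjI ballI allI)
      show "gd tot n x \<in> rcar (gcomp tot (n - 1))" if "x \<in> rcar (gcomp tot n)" for x
        using that by (rule gd_tot_in)
    qed (auto simp: radd_ac)
    \<comment> \<open>The squares of the two differentials vanish separately and the mixed terms
      cancel by the sign in \<open>gd_\<delta>\<close>.\<close>
    show "gd tot (n - 1) (gd tot n x) = rzero (gcomp tot (n - 2))" if "x \<in> rcar (gcomp tot n)" for n x
      using that by (auto simp: \<delta>_\<delta> gd_\<delta> radd_ac)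
  qed
  show "mact tot i j a x \<in> rcar (gcomp tot (i + j))" if "a \<in> rcar (gcomp A i)" "x \<in> rcar (gcomp tot j)" for i j a x
    using that by (rule mact_tot_in)
  show "gd tot (i + j) (mact tot i j a x) = radd (gcomp tot (i + j - 1)) (mact tot (i - 1) j (gd A i a) x)
        (rsmul (gcomp tot (i + j - 1)) (sgnr i) (mact tot i (j - 1) a (gd tot j x)))"
    if "a \<in> rcar (gcomp A i)" "x \<in> rcar (gcomp tot j)" for i j a x
    using that by (auto simp: X.gd_mact \<delta>_mact radd_assoc add_diff_eq diff_add_eq)
qed (auto simp: X.mact_amul)

abbreviation inc :: "nat \<Rightarrow> int \<Rightarrow> 'p \<Rightarrow> nat \<Rightarrow> 'p" where
  "inc p n x \<equiv> single (\<lambda>p. gcomp (X p) n) p x"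

lemma inc_in: "x \<in> rcar (gcomp (X p) n) \<Longrightarrow> inc p n x \<in> rcar (gcomp tot n)"
  using single_in[of "\<lambda>p. gcomp (X p) n" x p] by simp

lemma gd_inc_0: "x \<in> rcar (gcomp (X 0) n) \<Longrightarrow> gd tot n (inc 0 n x) = inc 0 (n - 1) (gd (X 0) n x)"
  by (auto simp: single_def)

lemma gd_inc_Suc:
  "x \<in> rcar (gcomp (X (Suc p)) n) \<Longrightarrow> gd tot n (inc (Suc p) n x) =
    radd (gcomp tot (n - 1)) (inc (Suc p) (n - 1) (gd (X (Suc p)) n x)) (inc p (n - 1) (\<delta> p n x))"
  by (auto simp: single_def)

lemma mact_inc:
  "\<lbrakk>a \<in> rcar (gcomp A i); x \<in> rcar (gcomp (X p) j)\<rbrakk> \<Longrightarrow> mact tot i j a (inc p j x) = inc p (i + j) (mact (X p) i j a x)"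
  by (auto simp: single_def)

lemma rlin_inc: "rlin (gcomp (X p) n) (gcomp tot n) (inc p n)"
  using rlin_single[of "\<lambda>p. gcomp (X p) n" p] by simp

lemma tot_induct [consumes 1, case_names zero add]:
  assumes "x \<in> rcar (gcomp tot n)"
    and "Pr (rzero (gcomp tot n))"
    and "\<And>p y z. \<lbrakk>y \<in> rcar (gcomp (X p) n); z \<in> rcar (gcomp tot n); Pr z\<rbrakk> \<Longrightarrow> Pr (radd (gcomp tot n) (inc p n y) z)"
  shows "Pr x"
  using dsum_induct[of "\<lambda>p. gcomp (X p) n" x Pr] assms X.rmodule_gcomp by (simp only: tot_simps)

end

section \<open>Lifting maps out of the total complex\<close>

context dg_family
begin

text \<open>The lift on each summand is not unique, and the equation on summand p + 1 depends on the
  lift chosen on summand p. Hence a dependent choice along p, followed by gluing over the direct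
  sum.\<close>

lemma tot_lift:
  fixes E :: "('r, 'a, 'e) dgamod" and N :: "('r, 'a, 'n) dgamod"
    and Q :: "nat \<Rightarrow> ('r, 'q) dgmod" and \<iota> :: "nat \<Rightarrow> int \<Rightarrow> 'q \<Rightarrow> 'p"
  assumes tensor: "\<And>p. dg_tensor A (X p) (Q p) (\<iota> p)" and sp: "\<And>p. s_projective (Q p)"
    and E: "dg_amodule A E" and N: "dg_amodule A N" and \<pi>: "dg_amap A E N \<pi>"
    and qi: "quasi_iso E N \<pi>" and surj: "\<And>n. \<pi> n ` rcar (gcomp E n) = rcar (gcomp N n)"
    and g: "dg_amap A tot N g"
  shows "\<exists>h. dg_amap A tot E h \<and> (\<forall>n. \<forall>x\<in>rcar (gcomp tot n). \<pi> n (h n x) = g n x)"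
proof -
  interpret E: dg_amod A E by (rule dg_amodI[OF A.dg_algebra E])
  interpret N: dg_amod A N by (rule dg_amodI[OF A.dg_algebra N])
  interpret T: dg_amod A tot by (rule dg_amodI[OF A.dg_algebra dg_amodule_tot])
  note \<pi>lin = dg_amap_rlin[OF \<pi>] and glin = dg_amap_rlin[OF g]
  define lift where "lift p h w \<longleftrightarrow> (\<forall>n. rlin (gcomp (X p) n) (gcomp E n) (h n)) \<and>
    (\<forall>i j. \<forall>a\<in>rcar (gcomp A i). \<forall>x\<in>rcar (gcomp (X p) j). h (i + j) (mact (X p) i j a x) = mact E i j a (h j x)) \<and>
    (\<forall>n. \<forall>x\<in>rcar (gcomp (X p) n). gd E n (h n x) = radd (gcomp E (n - 1)) (h (n - 1) (gd (X p) n x)) (w n x)) \<and>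
    (\<forall>n. \<forall>x\<in>rcar (gcomp (X p) n). \<pi> n (h n x) = g n (inc p n x))"
    for p and h w :: "int \<Rightarrow> 'p \<Rightarrow> 'e"
  have g_inc: "rlin (gcomp (X p) n) (gcomp N n) (\<lambda>x. g n (inc p n x))" for p n
    by (rule rlin_comp[OF rlin_inc glin])
  have g_inc_act: "g (i + j) (inc p (i + j) (mact (X p) i j a x)) = mact N i j a (g j (inc p j x))"
    if "a \<in> rcar (gcomp A i)" "x \<in> rcar (gcomp (X p) j)" for p i j a x
    using dg_amap_mact[OF g that(1) inc_in[OF that(2)]] mact_inc[OF that] by simp
  have step: "\<exists>h. lift p h w"
    if w: "\<And>n. rlin (gcomp (X p) n) (gcomp E (n - 1)) (w n)"
      "\<And>i j a x. \<lbrakk>a \<in> rcar (gcomp A i); x \<in> rcar (gcomp (X p) j)\<rbrakk> \<Longrightarrow>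
        w (i + j) (mact (X p) i j a x) = rsmul (gcomp E (i + j - 1)) (sgnr i) (mact E i (j - 1) a (w j x))"
      "\<And>n x. x \<in> rcar (gcomp (X p) n) \<Longrightarrow> gd E (n - 1) (w n x) = rneg (gcomp E (n - 2)) (w (n - 1) (gd (X p) n x))"
      "\<And>n x. x \<in> rcar (gcomp (X p) n) \<Longrightarrow> gd N n (g n (inc p n x)) =
        radd (gcomp N (n - 1)) (g (n - 1) (inc p (n - 1) (gd (X p) n x))) (\<pi> (n - 1) (w n x))" for p w
  proof -
    interpret Q: dg_tensor A "X p" "Q p" "\<iota> p" by (rule tensor)
    show ?thesis
      unfolding lift_def
      by (rule Q.relative_lift[OF sp E N \<pi> qi surj, where w = w and g = "\<lambda>n x. g n (inc p n x)",
          OF w(1,2) g_inc g_inc_act w(3,4)])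
  qed
  \<comment> \<open>The pair keeps a lift together with the perturbation for which it was built. The
    last conjunct, that the perturbation vanishes after \<delta>, is the invariant that makes the
    next perturbation admissible.\<close>
  define ok where "ok p hw \<longleftrightarrow> lift p (fst hw) (snd hw) \<and>
    (p = 0 \<longrightarrow> snd hw = (\<lambda>n x. rzero (gcomp E (n - 1)))) \<and>
    (\<forall>n. \<forall>x\<in>rcar (gcomp (X (Suc p)) n). snd hw (n - 1) (\<delta> p n x) = rzero (gcomp E (n - 2)))"
    for p and hw :: "(int \<Rightarrow> 'p \<Rightarrow> 'e) \<times> (int \<Rightarrow> 'p \<Rightarrow> 'e)"
  have "\<exists>hw. ok 0 hw"
  proof -
    have "gd N n (g n (inc 0 n x)) = radd (gcomp N (n - 1)) (g (n - 1) (inc 0 (n - 1) (gd (X 0) n x)))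
          (\<pi> (n - 1) (rzero (gcomp E (n - 1))))" if "x \<in> rcar (gcomp (X 0) n)" for n x
      using dg_amap_gd[OF g inc_in[OF that]] gd_inc_0[OF that] rlin_rzero[OF \<pi>lin, of "n - 1"]
        rlin_in[OF g_inc, of "gd (X 0) n x" 0 "n - 1"] that by simp
    then obtain h where "lift 0 h (\<lambda>n x. rzero (gcomp E (n - 1)))"
      using step[of 0 "\<lambda>n x. rzero (gcomp E (n - 1))"] by (auto simp: rlin_zero add_diff_eq)
    then show ?thesis
      unfolding ok_def by (intro exI[of _ "(h, \<lambda>n x. rzero (gcomp E (n - 1)))"]) simp
  qed
  moreover have "\<exists>hw'. ok (Suc p) hw' \<and> (\<forall>n. \<forall>x\<in>rcar (gcomp (X (Suc p)) n). snd hw' n x = fst hw (n - 1) (\<delta> p n x))"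
    if ok: "ok p hw" for p hw
  proof -
    obtain h w where hw: "hw = (h, w)" by (cases hw)
    have h: "rlin (gcomp (X p) n) (gcomp E n) (h n)" for n
      using ok by (simp add: ok_def lift_def hw)
    have h_act: "h k (mact (X p) i j a x) = mact E i j a (h j x)"
      if "a \<in> rcar (gcomp A i)" "x \<in> rcar (gcomp (X p) j)" "k = i + j" for i j k a x
      using ok that by (simp add: ok_def lift_def hw)
    have dh: "gd E n (h n x) = radd (gcomp E (n - 1)) (h (n - 1) (gd (X p) n x)) (w n x)"
      and \<pi>h: "\<pi> n (h n x) = g n (inc p n x)" if "x \<in> rcar (gcomp (X p) n)" for n x
      using ok that by (simp_all add: ok_def lift_def hw)
    have w\<delta>: "w (n - 1) (\<delta> p n x) = rzero (gcomp E (n - 2))" if "x \<in> rcar (gcomp (X (Suc p)) n)" for n x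
      using ok that by (simp add: ok_def hw)
    have hE: "h n x \<in> rcar (gcomp E n)" if "x \<in> rcar (gcomp (X p) n)" for n x
      using rlin_in[OF h that] .
    let ?w = "\<lambda>n x. h (n - 1) (\<delta> p n x)"
    have "\<exists>h'. lift (Suc p) h' ?w"
    proof (rule step)
      show "rlin (gcomp (X (Suc p)) n) (gcomp E (n - 1)) (?w n)" for n by (rule rlin_comp[OF rlin_\<delta> h])
      show "?w (i + j) (mact (X (Suc p)) i j a x) = rsmul (gcomp E (i + j - 1)) (sgnr i) (mact E i (j - 1) a (?w j x))"
        if "a \<in> rcar (gcomp A i)" "x \<in> rcar (gcomp (X (Suc p)) j)" for i j a x
        using that by (simp add: \<delta>_mact rlin_rsmul[OF h] h_act)
      \<comment> \<open>The equation for \<open>h\<close> at \<delta> x gives d h \<delta> = h d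
        \<delta> + w \<delta>. The invariant kills the second term, and moving d past \<delta>
        produces the sign.\<close>
      show "gd E (n - 1) (?w n x) = rneg (gcomp E (n - 2)) (?w (n - 1) (gd (X (Suc p)) n x))"
        if "x \<in> rcar (gcomp (X (Suc p)) n)" for n x
      proof -
        have "h (n - 2) (\<delta> p (n - 1) (gd (X (Suc p)) n x)) \<in> rcar (gcomp E (n - 2))"
          using that by (intro hE) simp
        moreover have "h (n - 2) (rneg (gcomp (X p) (n - 2)) (\<delta> p (n - 1) (gd (X (Suc p)) n x)))
            = rneg (gcomp E (n - 2)) (h (n - 2) (\<delta> p (n - 1) (gd (X (Suc p)) n x)))"
          using that by (intro rlin_rsmul[OF h]) simp
        ultimately show ?thesis
          using that by (simp add: dh gd_\<delta> w\<delta>)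
      qed
      show "gd N n (g n (inc (Suc p) n x)) = radd (gcomp N (n - 1))
          (g (n - 1) (inc (Suc p) (n - 1) (gd (X (Suc p)) n x))) (\<pi> (n - 1) (?w n x))"
        if x: "x \<in> rcar (gcomp (X (Suc p)) n)" for n x
      proof -
        have "gd N n (g n (inc (Suc p) n x)) = g (n - 1) (radd (gcomp tot (n - 1))
            (inc (Suc p) (n - 1) (gd (X (Suc p)) n x)) (inc p (n - 1) (\<delta> p n x)))"
          using dg_amap_gd[OF g inc_in[OF x]] gd_inc_Suc[OF x] by simp
        also have "\<dots> = radd (gcomp N (n - 1)) (g (n - 1) (inc (Suc p) (n - 1) (gd (X (Suc p)) n x)))
            (g (n - 1) (inc p (n - 1) (\<delta> p n x)))"
          using x by (intro rlin_radd[OF glin] inc_in) simp_all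
        also have "g (n - 1) (inc p (n - 1) (\<delta> p n x)) = \<pi> (n - 1) (?w n x)"
          using x by (simp add: \<pi>h)
        finally show ?thesis .
      qed
    qed
    then obtain h' where "lift (Suc p) h' ?w" ..
    moreover have "?w (n - 1) (\<delta> (Suc p) n x) = rzero (gcomp E (n - 2))"
      if "x \<in> rcar (gcomp (X (Suc (Suc p))) n)" for n x
      using that \<delta>_\<delta>[OF that] rlin_rzero[OF h, of "n - 2"] by simp
    ultimately show ?thesis
      unfolding ok_def by (intro exI[of _ "(h', ?w)"]) (simp add: hw)
  qed
  ultimately obtain f where f: "\<And>p. ok p (f p)"
    "\<And>p n x. x \<in> rcar (gcomp (X (Suc p)) n) \<Longrightarrow> snd (f (Suc p)) n x = fst (f p) (n - 1) (\<delta> p n x)"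
    using dependent_nat_choice[of ok "\<lambda>p hw hw'. \<forall>n. \<forall>x\<in>rcar (gcomp (X (Suc p)) n). snd hw' n x = fst hw (n - 1) (\<delta> p n x)"]
    by blast
  define h where "h p = fst (f p)" for p
  have h: "rlin (gcomp (X p) n) (gcomp E n) (h p n)" for p n
    using f(1)[of p] by (simp add: ok_def lift_def h_def)
  have h_act: "h p (i + j) (mact (X p) i j a x) = mact E i j a (h p j x)"
    if "a \<in> rcar (gcomp A i)" "x \<in> rcar (gcomp (X p) j)" for p i j a x
    using f(1)[of p] that by (simp add: ok_def lift_def h_def)
  have dh: "gd E n (h p n x) = radd (gcomp E (n - 1)) (h p (n - 1) (gd (X p) n x)) (snd (f p) n x)"
    and \<pi>h: "\<pi> n (h p n x) = g n (inc p n x)" if "x \<in> rcar (gcomp (X p) n)" for p n x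
    using f(1)[of p] that by (simp_all add: ok_def lift_def h_def)
  have "\<exists>H. rlin (gcomp tot n) (gcomp E n) H \<and> (\<forall>p. \<forall>x\<in>rcar (gcomp (X p) n). H (inc p n x) = h p n x)" for n
    using dsum_extension[of "\<lambda>p. gcomp (X p) n" "gcomp E n" "\<lambda>p. h p n"] h by simp
  then obtain H where H: "\<And>n. rlin (gcomp tot n) (gcomp E n) (H n)"
    "\<And>n p x. x \<in> rcar (gcomp (X p) n) \<Longrightarrow> H n (inc p n x) = h p n x"
    by metis
  have w0: "snd (f 0) n x = rzero (gcomp E (n - 1))" for n x
    using f(1)[of 0] by (simp add: ok_def)
  have HE: "H n x \<in> rcar (gcomp E n)" if "x \<in> rcar (gcomp tot n)" for n x
    using rlin_in[OF H(1) that] .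
  have H0: "H n (rzero (gcomp tot n)) = rzero (gcomp E n)" for n
    using rlin_rzero[OF H(1) T.rmodule_gcomp E.rmodule_gcomp] .
  \<comment> \<open>On summand p + 1 the total differential has an extra component in summand p, and
    its image under \<open>H\<close> is the perturbation stored with the lift on summand p + 1. So
    the perturbed equations are the chain condition for \<open>H\<close>.\<close>
  have chain_inc: "H (n - 1) (gd tot n (inc p n y)) = gd E n (H n (inc p n y))"
    if y: "y \<in> rcar (gcomp (X p) n)" for p n y
  proof (cases p)
    case 0
    have "h 0 (n - 1) (gd (X 0) n y) \<in> rcar (gcomp E (n - 1))"
      using y rlin_in[OF h, of "gd (X 0) n y" 0 "n - 1"] 0 by simp
    then show ?thesis
      using y gd_inc_0[of y n] H(2) dh[of y 0 n] w0 0 by simp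
  next
    case (Suc p')
    then have y': "y \<in> rcar (gcomp (X (Suc p')) n)" using y by simp
    have "H (n - 1) (gd tot n (inc (Suc p') n y)) = radd (gcomp E (n - 1))
        (H (n - 1) (inc (Suc p') (n - 1) (gd (X (Suc p')) n y))) (H (n - 1) (inc p' (n - 1) (\<delta> p' n y)))"
      unfolding gd_inc_Suc[OF y'] using y' by (intro rlin_radd[OF H(1)] inc_in) simp_all
    then show ?thesis
      using y' H(2) dh[OF y'] f(2)[OF y'] Suc by (simp add: h_def)
  qed
  have chain: "H (n - 1) (gd tot n x) = gd E n (H n x)" if "x \<in> rcar (gcomp tot n)" for n x
    using that
  proof (induction x rule: tot_induct)
    case zero
    show ?case unfolding T.gd_rzero H0 by simp
  next
    case (add p y z)
    note i = inc_in[OF add(1)]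
    show ?case
      unfolding T.gd_radd[OF i add(2)] rlin_radd[OF H(1) i add(2)]
        rlin_radd[OF H(1) gd_tot_in[OF i] gd_tot_in[OF add(2)]] chain_inc[OF add(1)] add(3)
        E.gd_radd[OF HE[OF i] HE[OF add(2)]] ..
  qed
  have act: "H (i + j) (mact tot i j a x) = mact E i j a (H j x)"
    if a: "a \<in> rcar (gcomp A i)" and x: "x \<in> rcar (gcomp tot j)" for i j a x
    using x
  proof (induction x rule: tot_induct)
    case zero
    show ?case unfolding T.mact_rzero(2)[OF a] H0 using a by simp
  next
    case (add p y z)
    note i = inc_in[OF add(1)]
    have "H (i + j) (mact tot i j a (inc p j y)) = mact E i j a (H j (inc p j y))"
      using mact_inc[OF a add(1)] H(2) h_act[OF a add(1)] add(1) a by simp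
    then show ?case
      unfolding T.mact_radd_right[OF a i add(2)] rlin_radd[OF H(1) i add(2)]
        rlin_radd[OF H(1) mact_tot_in[OF a i] mact_tot_in[OF a add(2)]] add(3)
        E.mact_radd_right[OF a HE[OF i] HE[OF add(2)]] by simp
  qed
  have lift: "\<pi> n (H n x) = g n x" if "x \<in> rcar (gcomp tot n)" for n x
    using that
  proof (induction x rule: tot_induct)
    case zero
    show ?case
      unfolding H0 using rlin_rzero[OF \<pi>lin E.rmodule_gcomp N.rmodule_gcomp] rlin_rzero[OF glin T.rmodule_gcomp N.rmodule_gcomp]
      by simp
  next
    case (add p y z)
    note i = inc_in[OF add(1)]
    have "\<pi> n (H n (inc p n y)) = g n (inc p n y)" by (simp only: H(2)[OF add(1)] \<pi>h[OF add(1)])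
    then show ?case
      unfolding rlin_radd[OF H(1) i add(2)] rlin_radd[OF \<pi>lin HE[OF i] HE[OF add(2)]]
        rlin_radd[OF glin i add(2)] add(3) by simp
  qed
  show ?thesis
    using H(1) chain act lift unfolding dg_amap_def dg_rmap_def by blast
qed

end

section \<open>The augmentation as a quasi-isomorphism\<close>

lemma closed_sub_cancel:
  assumes "rmodule M" "closed_sub M S" "x \<in> rcar M" "b \<in> S" "radd M x (rneg M b) \<in> S"
  shows "x \<in> S"
proof -
  have "b \<in> rcar M" using assms by (auto simp: closed_sub_def)
  then have "x = radd M (radd M x (rneg M b)) b" using assms(1,3) by (simp add: radd_assoc)
  then show ?thesis using assms(2,4,5) unfolding closed_sub_def by metis
qed

context dg_family
begin

text \<open>A cycle of the total complex is killed from the lowest component upwards.  Each step moves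
  the lowest component up by one; exactness on cycles is what makes the process stop at the top.\<close>

lemma tot_cycle_bounds:
  fixes M :: "('r, 'b, 'z) dgmod_scheme" and \<epsilon> :: "int \<Rightarrow> 'p \<Rightarrow> 'b"
  assumes exact: "\<And>p n x. \<lbrakk>x \<in> rcar (gcomp (X p) n);
      case p of 0 \<Rightarrow> \<epsilon> n x = rzero (gcomp M n) | Suc p' \<Rightarrow> \<delta> p' n x = rzero (gcomp (X p') (n - 1))\<rbrakk>
      \<Longrightarrow> \<exists>z\<in>rcar (gcomp (X (Suc p)) (n + 1)). \<delta> p (n + 1) z = x"
    and exact_cycles: "\<And>p n x. \<lbrakk>x \<in> cycles (X p) n;
      case p of 0 \<Rightarrow> \<epsilon> n x = rzero (gcomp M n) | Suc p' \<Rightarrow> \<delta> p' n x = rzero (gcomp (X p') (n - 1))\<rbrakk>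
      \<Longrightarrow> \<exists>z\<in>cycles (X (Suc p)) (n + 1). \<delta> p (n + 1) z = x"
  shows "\<lbrakk>x \<in> cycles tot n; \<forall>p<k. x p = rzero (gcomp (X p) n); \<forall>p>k + m. x p = rzero (gcomp (X p) n);
    k = 0 \<Longrightarrow> \<epsilon> n (x 0) = rzero (gcomp M n)\<rbrakk> \<Longrightarrow> x \<in> bounds tot n"
\<comment> \<open>The components of x live in the window from k to k + m. Each step raises k by one
  and lowers m by one, keeping the upper end fixed.\<close>
proof (induction m arbitrary: x k)
  interpret T: dg_amod A tot by (rule dg_amodI[OF A.dg_algebra dg_amodule_tot])
  have gd_p: "radd (gcomp (X p) (n - 1)) (gd (X p) n (x p)) (\<delta> p n (x (Suc p))) = rzero (gcomp (X p) (n - 1))"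
    if "x \<in> cycles tot n" for x p
  proof -
    have "gd tot n x p = rzero (gcomp tot (n - 1)) p" using that by (simp add: cycles_def)
    then show ?thesis by simp
  qed
  have x_in: "x p \<in> rcar (gcomp (X p) n)" if "x \<in> cycles tot n" for x p
    using T.cycles_in[OF that] by simp
  \<comment> \<open>For positive k, component k - 1 of d x = 0 reduces to \<delta> applied to x k,
    because x (k - 1) = 0. For k = 0 this role is played by the assumption on \<epsilon>.\<close>
  have ker: "case k of 0 \<Rightarrow> \<epsilon> n (x k) = rzero (gcomp M n) | Suc p' \<Rightarrow> \<delta> p' n (x k) = rzero (gcomp (X p') (n - 1))"
    if "x \<in> cycles tot n" "\<forall>p<k. x p = rzero (gcomp (X p) n)" "k = 0 \<Longrightarrow> \<epsilon> n (x 0) = rzero (gcomp M n)" for x k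
  proof (cases k)
    case (Suc k')
    then show ?thesis
      using gd_p[OF that(1), of k'] that(2) x_in[OF that(1), of "Suc k'"] by simp
  qed (simp add: that)
  {
    case 0
    \<comment> \<open>With a single component left, nothing from x (k + 1) interferes and x k is a
      cycle. Its preimage under \<delta> can then be taken to be a cycle, so no new component
      appears at k + 1.\<close>
    have "gd (X k) n (x k) = rzero (gcomp (X k) (n - 1))"
      using gd_p[OF 0(1), of k] 0(3) x_in[OF 0(1), of k] by simp
    then have "x k \<in> cycles (X k) n" using x_in[OF 0(1)] by (simp add: cycles_def)
    then obtain z where z: "z \<in> cycles (X (Suc k)) (n + 1)" "\<delta> k (n + 1) z = x k"
      using exact_cycles ker[OF 0(1,2,4)] by blast
    have zX: "z \<in> rcar (gcomp (X (Suc k)) (n + 1))" using z(1) X.cycles_in by blast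
    have "x = gd tot (n + 1) (inc (Suc k) (n + 1) z)"
    proof
      fix p
      have "x p = rzero (gcomp (X p) n)" if "p \<noteq> k"
        using that 0(2,3) by (cases "p < k") simp_all
      then show "x p = gd tot (n + 1) (inc (Suc k) (n + 1) z) p"
        unfolding gd_inc_Suc[OF zX] using z x_in[OF 0(1), of k] by (auto simp: single_def cycles_def)
    qed
    then show ?case
      using inc_in[OF zX] unfolding T.bounds_iff by blast
  next
    case (Suc m)
    obtain z where z: "z \<in> rcar (gcomp (X (Suc k)) (n + 1))" "\<delta> k (n + 1) z = x k"
      using exact[OF x_in[OF Suc(2)] ker[OF Suc(2,3,5)]] by blast
    let ?b = "gd tot (n + 1) (inc (Suc k) (n + 1) z)"
    have b: "?b \<in> bounds tot n"
      using inc_in[OF z(1)] unfolding T.bounds_iff by blast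
    \<comment> \<open>The boundary cancels x k and otherwise only changes component k + 1, which
      still lies in the window as its length is positive.\<close>
    have b_p: "?b p = (if p = Suc k then gd (X p) (n + 1) z else if p = k then x k else rzero (gcomp (X p) n))" for p
      unfolding gd_inc_Suc[OF z(1)] using z x_in[OF Suc(2), of k] by (auto simp: single_def)
    let ?x = "radd (gcomp tot n) x (rneg (gcomp tot n) ?b)"
    have "?x \<in> bounds tot n"
    proof (rule Suc(1))
      show "?x \<in> cycles tot n"
        using T.closed_sub_cycles[of n] Suc(2) T.bounds_cycles[OF b] unfolding closed_sub_def by blast
      show "\<forall>p<Suc k. ?x p = rzero (gcomp (X p) n)"
        using Suc(3) x_in[OF Suc(2), of k] b_p by (auto simp: less_Suc_eq)
      show "\<forall>p>Suc k + m. ?x p = rzero (gcomp (X p) n)"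
        using Suc(4) b_p by auto
    qed simp
    then show ?case
      using closed_sub_cancel[OF T.rmodule_gcomp T.closed_sub_bounds T.cycles_in[OF Suc(2)] b] by blast
  }
qed

text \<open>Surjectivity on homology comes from lifting cycles along \<epsilon>. For injectivity, a
  boundary in the summand X 0 is subtracted to reach a cycle killed by \<epsilon>, to which
  \<open>tot_cycle_bounds\<close> applies.\<close>

lemma tot_quasi_iso:
  fixes M :: "('r, 'b, 'z) dgmod_scheme" and \<epsilon> :: "int \<Rightarrow> 'p \<Rightarrow> 'b"
  assumes M: "dg_rmodule M" and \<epsilon>: "dg_rmap (X 0) M \<epsilon>" and tot_\<epsilon>: "dg_rmap tot M (\<lambda>n x. \<epsilon> n (x 0))"
    and epi: "s_epi (X 0) M \<epsilon>"
    and exact: "\<And>p n x. \<lbrakk>x \<in> rcar (gcomp (X p) n);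
      case p of 0 \<Rightarrow> \<epsilon> n x = rzero (gcomp M n) | Suc p' \<Rightarrow> \<delta> p' n x = rzero (gcomp (X p') (n - 1))\<rbrakk>
      \<Longrightarrow> \<exists>z\<in>rcar (gcomp (X (Suc p)) (n + 1)). \<delta> p (n + 1) z = x"
    and exact_cycles: "\<And>p n x. \<lbrakk>x \<in> cycles (X p) n;
      case p of 0 \<Rightarrow> \<epsilon> n x = rzero (gcomp M n) | Suc p' \<Rightarrow> \<delta> p' n x = rzero (gcomp (X p') (n - 1))\<rbrakk>
      \<Longrightarrow> \<exists>z\<in>cycles (X (Suc p)) (n + 1). \<delta> p (n + 1) z = x"
  shows "quasi_iso tot M (\<lambda>n x. \<epsilon> n (x 0))"
proof -
  interpret T: dg_amod A tot by (rule dg_amodI[OF A.dg_algebra dg_amodule_tot])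
  interpret M: dg_rmod M by unfold_locales (fact M)
  note lin = dg_rmap_rlin[OF \<epsilon>]
  show ?thesis
    unfolding quasi_iso_iff[OF T.dg_rmodule M tot_\<epsilon>]
  proof (intro allI conjI ballI impI)
    fix n x assume x: "x \<in> cycles tot n" and "\<epsilon> n (x 0) \<in> bounds M n"
    then obtain m where m: "m \<in> rcar (gcomp M (n + 1))" "\<epsilon> n (x 0) = gd M (n + 1) m"
      unfolding M.bounds_iff by blast
    have x0: "x 0 \<in> rcar (gcomp (X 0) n)" using T.cycles_in[OF x] by simp
    obtain y where y: "y \<in> rcar (gcomp (X 0) (n + 1))" "m = \<epsilon> (n + 1) y"
      using epi m(1) unfolding s_epi_def by blast
    let ?b = "gd tot (n + 1) (inc 0 (n + 1) y)"
    have b: "?b \<in> bounds tot n"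
      using inc_in[OF y(1)] unfolding T.bounds_iff by blast
    have b0: "?b 0 = gd (X 0) (n + 1) y"
      unfolding gd_inc_0[OF y(1)] by (simp add: single_def)
    let ?x = "radd (gcomp tot n) x (rneg (gcomp tot n) ?b)"
    have cyc: "?x \<in> cycles tot n"
      using T.closed_sub_cycles[of n] x T.bounds_cycles[OF b] unfolding closed_sub_def by blast
    have dy: "gd (X 0) (n + 1) y \<in> rcar (gcomp (X 0) n)" using y(1) by simp
    have "\<epsilon> n (gd (X 0) (n + 1) y) = \<epsilon> n (x 0)"
      using dg_rmap_gd[OF \<epsilon> y(1)] m(2) y(2) by simp
    then have "\<epsilon> n (radd (gcomp (X 0) n) (x 0) (rneg (gcomp (X 0) n) (gd (X 0) (n + 1) y))) = rzero (gcomp M n)"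
      using x0 dy rlin_in[OF lin x0] by (simp add: rlin_radd[OF lin] rlin_rsmul[OF lin])
    then have \<epsilon>0: "\<epsilon> n (?x 0) = rzero (gcomp M n)"
      using b0 by simp
    have "finite {p. ?x p \<noteq> rzero (gcomp (X p) n)}" using T.cycles_in[OF cyc] by simp
    \<comment> \<open>Finite support is what bounds the window above and lets the pushing process
      terminate.\<close>
    then obtain N where "\<forall>p\<in>{p. ?x p \<noteq> rzero (gcomp (X p) n)}. p \<le> N"
      using finite_nat_set_iff_bounded_le by blast
    then have "\<forall>p>0 + N. ?x p = rzero (gcomp (X p) n)" by force
    then have "?x \<in> bounds tot n"
      using tot_cycle_bounds[OF exact exact_cycles cyc, where k = 0 and m = N] \<epsilon>0 by blast
    then show "x \<in> bounds tot n"
      using closed_sub_cancel[OF T.rmodule_gcomp T.closed_sub_bounds T.cycles_in[OF x] b] by blast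
  next
    fix n y assume "y \<in> cycles M n"
    then obtain x where x: "x \<in> cycles (X 0) n" "y = \<epsilon> n x"
      using epi unfolding s_epi_def by blast
    have xX: "x \<in> rcar (gcomp (X 0) n)" using x(1) X.cycles_in by blast
    have "inc 0 n x \<in> cycles tot n"
      using inc_in[OF xX] gd_inc_0[OF xX] x(1) by (simp add: cycles_def single_def fun_eq_iff)
    \<comment> \<open>A cycle of X 0 stays a cycle in the total complex because nothing lies below
      filtration 0; its image is y on the nose.\<close>
    moreover have "radd (gcomp M n) y (rneg (gcomp M n) (\<epsilon> n (inc 0 n x 0))) = rzero (gcomp M n)"
      using x(2) rlin_in[OF lin xX] by (simp add: single_def)
    moreover have "rzero (gcomp M n) \<in> bounds M n"
      using M.closed_sub_bounds[of n] by (simp add: closed_sub_def)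
    ultimately show "\<exists>x\<in>cycles tot n. radd (gcomp M n) y (rneg (gcomp M n) (\<epsilon> n (x 0))) \<in> bounds M n"
      by (metis (no_types, lifting))
  qed
qed

end

section \<open>Regrading\<close>

text \<open>Pure reindexing: unlike the usual suspension, it puts no sign on the differential or on
  the action. The signs of the total complex are all carried by \<delta>.\<close>

definition shift :: "int \<Rightarrow> ('r, 'a, 'm) dgamod \<Rightarrow> ('r, 'a, 'm) dgamod" where
  "shift k M = \<lparr>gcomp = (\<lambda>n. gcomp M (n - k)), gd = (\<lambda>n. gd M (n - k)), mact = (\<lambda>i j. mact M i (j - k))\<rparr>"

definition shift_r :: "int \<Rightarrow> ('r, 'm) dgmod \<Rightarrow> ('r, 'm) dgmod" where
  "shift_r k M = \<lparr>gcomp = (\<lambda>n. gcomp M (n - k)), gd = (\<lambda>n. gd M (n - k))\<rparr>"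

lemma shift_simps [simp]:
  "gcomp (shift k M) n = gcomp M (n - k)" "gd (shift k M) n = gd M (n - k)"
  "mact (shift k M) i j = mact M i (j - k)"
  "gcomp (shift_r k Q) n = gcomp Q (n - k)" "gd (shift_r k Q) n = gd Q (n - k)"
  by (simp_all add: shift_def shift_r_def)

lemma shift_index: "n - 1 - k = n - k - (1::int)" "n - 2 - k = n - k - (2::int)" "n + 1 - k = n - k + (1::int)"
  by simp_all

lemma cycles_shift [simp]: "cycles (shift k M) n = cycles M (n - k)" "cycles (shift_r k Q) n = cycles Q (n - k)"
  by (simp_all add: cycles_def shift_index)

lemma bounds_shift_r [simp]: "bounds (shift_r k Q) n = bounds Q (n - k)"
  by (simp add: bounds_def shift_index)

lemma s_projective_shift_r: "s_projective Q \<Longrightarrow> s_projective (shift_r k Q)"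
  by (simp add: s_projective_def homology_def)

lemma dg_rmodule_shift: "dg_rmodule M \<Longrightarrow> dg_rmodule (shift k M)"
  by (simp add: dg_rmodule_def shift_index)

lemma dg_rmodule_shift_r: "dg_rmodule Q \<Longrightarrow> dg_rmodule (shift_r k Q)"
  by (simp add: dg_rmodule_def shift_index)

lemma (in dg_amod) dg_amodule_shift: "dg_amodule A (shift k M)"
proof (rule dg_amoduleI)
  show "dg_rmodule (shift k M)" using dg_rmodule by (rule dg_rmodule_shift)
  show "gd (shift k M) (i + j) (mact (shift k M) i j a x) =
      radd (gcomp (shift k M) (i + j - 1)) (mact (shift k M) (i - 1) j (gd A i a) x)
        (rsmul (gcomp (shift k M) (i + j - 1)) (sgnr i) (mact (shift k M) i (j - 1) a (gd (shift k M) j x)))"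
    if "a \<in> rcar (gcomp A i)" "x \<in> rcar (gcomp (shift k M) j)" for i j a x
    using that by (simp add: gd_mact shift_index add_diff_eq)
qed (simp_all add: add_diff_eq[symmetric] mact_amul)

lemma dg_rmap_shift_iff: "dg_rmap (shift_r k Q) N g \<longleftrightarrow> dg_rmap Q (shift (- k) N) (\<lambda>n. g (n + k))"
proof
  assume g: "dg_rmap (shift_r k Q) N g"
  show "dg_rmap Q (shift (- k) N) (\<lambda>n. g (n + k))"
    unfolding dg_rmap_def
  proof (intro conjI allI ballI)
    show "rlin (gcomp Q n) (gcomp (shift (- k) N) n) (g (n + k))" for n
      using dg_rmap_rlin[OF g, of "n + k"] by simp
    show "g (n - 1 + k) (gd Q n x) = gd (shift (- k) N) n (g (n + k) x)" if "x \<in> rcar (gcomp Q n)" for n x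
      using dg_rmap_gd[OF g, of x "n + k"] that by (simp add: diff_add_eq)
  qed
next
  assume g: "dg_rmap Q (shift (- k) N) (\<lambda>n. g (n + k))"
  show "dg_rmap (shift_r k Q) N g"
    unfolding dg_rmap_def
  proof (intro conjI allI ballI)
    show "rlin (gcomp (shift_r k Q) n) (gcomp N n) (g n)" for n
      using dg_rmap_rlin[OF g, of "n - k"] by simp
    show "g (n - 1) (gd (shift_r k Q) n x) = gd N n (g n x)" if "x \<in> rcar (gcomp (shift_r k Q) n)" for n x
      using dg_rmap_gd[OF g, of x "n - k"] that by simp
  qed
qed

lemma dg_amap_shift_iff: "dg_amap A (shift k X) N g \<longleftrightarrow> dg_amap A X (shift (- k) N) (\<lambda>n. g (n + k))"
proof
  assume g: "dg_amap A (shift k X) N g"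
  show "dg_amap A X (shift (- k) N) (\<lambda>n. g (n + k))"
    unfolding dg_amap_def dg_rmap_def
  proof (intro conjI allI ballI)
    show "rlin (gcomp X n) (gcomp (shift (- k) N) n) (g (n + k))" for n
      using dg_amap_rlin[OF g, of "n + k"] by simp
    show "g (n - 1 + k) (gd X n x) = gd (shift (- k) N) n (g (n + k) x)" if "x \<in> rcar (gcomp X n)" for n x
      using dg_amap_gd[OF g, of x "n + k"] that by (simp add: diff_add_eq)
    show "g (i + j + k) (mact X i j a x) = mact (shift (- k) N) i j a (g (j + k) x)"
      if "a \<in> rcar (gcomp A i)" "x \<in> rcar (gcomp X j)" for i j a x
      using dg_amap_mact[OF g, of a i x "j + k"] that by (simp add: add.assoc)
  qed
next
  assume g: "dg_amap A X (shift (- k) N) (\<lambda>n. g (n + k))"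
  show "dg_amap A (shift k X) N g"
    unfolding dg_amap_def dg_rmap_def
  proof (intro conjI allI ballI)
    show "rlin (gcomp (shift k X) n) (gcomp N n) (g n)" for n
      using dg_amap_rlin[OF g, of "n - k"] by simp
    show "g (n - 1) (gd (shift k X) n x) = gd N n (g n x)" if "x \<in> rcar (gcomp (shift k X) n)" for n x
      using dg_amap_gd[OF g, of x "n - k"] that by simp
    show "g (i + j) (mact (shift k X) i j a x) = mact N i j a (g j x)"
      if "a \<in> rcar (gcomp A i)" "x \<in> rcar (gcomp (shift k X) j)" for i j a x
      using dg_amap_mact[OF g, of a i x "j - k"] that by (simp add: add_diff_eq)
  qed
qed

text \<open>Maps out of a shifted object are maps into the oppositely shifted target, and shifting a
  target does not change its element type. The universal property at \<open>shift (- k) N\<close> is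
  therefore the one wanted at \<open>N\<close>.\<close>

lemma ext_up_shift:
  fixes A :: "('r::comm_ring_1, 'a) dgalg" and X :: "('r, 'a, 'p) dgamod"
  assumes A: "dg_algebra A" and ext: "ext_up TYPE('t) A Q X \<iota>"
  shows "ext_up TYPE('t) A (shift_r k Q) (shift k X) (\<lambda>n. \<iota> (n - k))"
  unfolding ext_up_def
proof (intro allI impI, elim conjE)
  fix N :: "('r, 'a, 't) dgamod" and g
  assume N: "dg_amodule A N" and g: "dg_rmap (shift_r k Q) N g"
  interpret N: dg_amod A N by (rule dg_amodI[OF A N])
  have "dg_rmap Q (shift (- k) N) (\<lambda>n. g (n + k))"
    using g by (simp add: dg_rmap_shift_iff)
  with N.dg_amodule_shift[of "- k"] ext obtain h where h: "dg_amap A X (shift (- k) N) h"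
    "\<forall>n. \<forall>x\<in>rcar (gcomp Q n). h n (\<iota> n x) = g (n + k) x"
    "\<forall>h'. dg_amap A X (shift (- k) N) h' \<and> (\<forall>n. \<forall>x\<in>rcar (gcomp Q n). h' n (\<iota> n x) = g (n + k) x)
      \<longrightarrow> (\<forall>n. \<forall>x\<in>rcar (gcomp X n). h' n x = h n x)"
    unfolding ext_up_def by (elim allE[of _ "shift (- k) N"] allE[of _ "\<lambda>n. g (n + k)"]) auto
  show "\<exists>h. dg_amap A (shift k X) N h \<and> (\<forall>n. \<forall>x\<in>rcar (gcomp (shift_r k Q) n). h n (\<iota> (n - k) x) = g n x) \<and>
      (\<forall>h'. dg_amap A (shift k X) N h' \<and> (\<forall>n. \<forall>x\<in>rcar (gcomp (shift_r k Q) n). h' n (\<iota> (n - k) x) = g n x)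
        \<longrightarrow> (\<forall>n. \<forall>x\<in>rcar (gcomp (shift k X) n). h' n x = h n x))"
  proof (intro exI[of _ "\<lambda>n. h (n - k)"] conjI allI impI ballI)
    show "dg_amap A (shift k X) N (\<lambda>n. h (n - k))"
      using h(1) by (simp add: dg_amap_shift_iff)
    show "h (n - k) (\<iota> (n - k) x) = g n x" if "x \<in> rcar (gcomp (shift_r k Q) n)" for n x
      using h(2)[rule_format, of x "n - k"] that by simp
    fix h' n x
    assume h': "dg_amap A (shift k X) N h' \<and> (\<forall>n. \<forall>x\<in>rcar (gcomp (shift_r k Q) n). h' n (\<iota> (n - k) x) = g n x)"
      and x: "x \<in> rcar (gcomp (shift k X) n)"
    have "dg_amap A X (shift (- k) N) (\<lambda>n. h' (n + k))"
      using h' by (simp add: dg_amap_shift_iff)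
    moreover have "h' (n + k) (\<iota> n x) = g (n + k) x" if "x \<in> rcar (gcomp Q n)" for n x
      using h'[THEN conjunct2, rule_format, of x "n + k"] that by simp
    ultimately show "h' n x = h (n - k) x"
      using h(3)[rule_format, of "\<lambda>n. h' (n + k)" x "n - k"] x by simp
  qed
qed

lemma is_tensor_ext_shift:
  fixes A :: "('r::comm_ring_1, 'a) dgalg" and X :: "('r, 'a, 'p) dgamod"
  assumes "dg_algebra A" "is_tensor_ext A Q X \<iota>"
  shows "is_tensor_ext A (shift_r k Q) (shift k X) (\<lambda>n. \<iota> (n - k))"
proof -
  have "shift (- k) (shift k X) = X" by (simp add: shift_def)
  then show ?thesis
    using assms unfolding is_tensor_ext_def by (simp add: dg_rmap_shift_iff ext_up_shift)
qed

section \<open>The total complex of a projective resolution\<close>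

lemma sgnr_diff [simp]: "sgnr (i - j) = sgnr i * sgnr j" "sgnr 1 = - 1"
  by (auto simp: sgnr_def)

lemma s_exact_rules:
  assumes "s_exact L f N g N'"
  shows s_exact_zero: "y \<in> rcar (gcomp L n) \<Longrightarrow> g n (f n y) = rzero (gcomp N' n)"
    and s_exact_lift: "\<lbrakk>g n x = rzero (gcomp N' n); x \<in> rcar (gcomp N n)\<rbrakk> \<Longrightarrow> \<exists>y\<in>rcar (gcomp L n). f n y = x"
    and s_exact_lift_cycles: "\<lbrakk>g n x = rzero (gcomp N' n); x \<in> cycles N n\<rbrakk> \<Longrightarrow> \<exists>y\<in>cycles L n. f n y = x"
proof -
  have im: "f n ` rcar (gcomp L n) = {x \<in> rcar (gcomp N n). g n x = rzero (gcomp N' n)}"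
    and im': "f n ` cycles L n = {x \<in> cycles N n. g n x = rzero (gcomp N' n)}"
    using assms unfolding s_exact_def by blast+
  show "g n (f n y) = rzero (gcomp N' n)" if "y \<in> rcar (gcomp L n)"
    using im that by blast
  show "\<exists>y\<in>rcar (gcomp L n). f n y = x" if "g n x = rzero (gcomp N' n)" "x \<in> rcar (gcomp N n)"
  proof -
    have "x \<in> f n ` rcar (gcomp L n)" unfolding im using that by simp
    then show ?thesis by blast
  qed
  show "\<exists>y\<in>cycles L n. f n y = x" if "g n x = rzero (gcomp N' n)" "x \<in> cycles N n"
  proof -
    have "x \<in> f n ` cycles L n" unfolding im' using that by simp
    then show ?thesis by blast
  qed
qed

theorem theorem8p22:
  fixes A :: "('r::comm_ring_1, 'a) dgalg"
    and M :: "('r, 'a, 'm) dgamod"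
    and P :: "nat \<Rightarrow> ('r, 'a, 'p) dgamod"
    and dres :: "nat \<Rightarrow> int \<Rightarrow> 'p \<Rightarrow> 'p"
    and eps :: "int \<Rightarrow> 'p \<Rightarrow> 'm"
    and Q :: "nat \<Rightarrow> ('r, 'q) dgmod"
    and iota :: "nat \<Rightarrow> int \<Rightarrow> 'q \<Rightarrow> 'p"
  assumes "dg_algebra A"
    and "dg_amodule A M"
    and "\<forall>p. dg_amodule A (P p)"
    and "\<forall>p. dg_amap A (P (Suc p)) (P p) (dres p)"
    and "dg_amap A (P 0) M eps"
    and "\<forall>p. s_exact (P (Suc (Suc p))) (dres (Suc p)) (P (Suc p)) (dres p) (P p)"
    and "s_exact (P 1) (dres 0) (P 0) eps M"
    and "s_epi (P 0) M eps"
    and "\<forall>p. dg_rmodule (Q p) \<and> s_projective (Q p) \<and> is_tensor_ext A (Q p) (P p) (iota p)"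
  shows "q_cofibrant TYPE('e) TYPE('n) A (totalc P dres) \<and>
         dg_amap A (totalc P dres) M (total_aug eps) \<and>
         (\<forall>n. total_aug eps n ` rcar (gcomp (totalc P dres) n) = rcar (gcomp M n)) \<and>
         quasi_iso (totalc P dres) M (total_aug eps)"
proof -
  note A = assms(1) and eps = assms(5) and epi = assms(8)
  note d = assms(4)[rule_format]
  interpret A: dg_alg A by (rule dg_algI[OF A])
  interpret M: dg_amod A M by (rule dg_amodI[OF A assms(2)])
  interpret P: dg_amod A "P p" for p by (rule dg_amodI[OF A assms(3)[rule_format]])
  have d_in: "dres p n x \<in> rcar (gcomp (P p) n)" if "x \<in> rcar (gcomp (P (Suc p)) n)" for p n x
    using rlin_in[OF dg_amap_rlin[OF d] that] .
  have dd: "dres p n (dres (Suc p) n x) = rzero (gcomp (P p) n)" if "x \<in> rcar (gcomp (P (Suc (Suc p))) n)" for p n x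
    using s_exact_zero[OF assms(6)[rule_format] that] .
  have ed: "eps n (dres 0 n x) = rzero (gcomp M n)" if "x \<in> rcar (gcomp (P (Suc 0)) n)" for n x
    using s_exact_zero[OF assms(7)] that by simp
  define X where "X p = shift (int p) (P p)" for p
  \<comment> \<open>In total degree n, the summand p + 1 has internal degree q = n - 1 - p. The map
    \<open>dres\<close> preserves q while p drops by one, so \<delta> lowers the total degree by one
    and the sign is (-1)^q.\<close>
  define \<delta> where "\<delta> p n x = rsmul (gcomp (P p) (n - 1 - int p)) (sgnr (n - 1 - int p)) (dres p (n - 1 - int p) x)"
    for p n x
  have idx: "n - int (Suc p) = n - 1 - int p" for n p by simp
  have X_simps [simp]: "gcomp (X p) n = gcomp (P p) (n - int p)" "gd (X p) n = gd (P p) (n - int p)"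
    "mact (X p) i j = mact (P p) i (j - int p)" "cycles (X p) n = cycles (P p) (n - int p)" for p n i j
    by (simp_all add: X_def)
  interpret F: dg_family A X \<delta>
  proof unfold_locales
    fix p
    show "dg_amodule A (X p)" unfolding X_def by (rule P.dg_amodule_shift)
    show "rlin (gcomp (X (Suc p)) n) (gcomp (X p) (n - 1)) (\<delta> p n)" for n
      unfolding \<delta>_def X_simps idx by (intro rlin_scale P.rmodule_gcomp dg_amap_rlin[OF d])
    show "gd (X p) (n - 1) (\<delta> p n x) = rneg (gcomp (X p) (n - 2)) (\<delta> p (n - 1) (gd (X (Suc p)) n x))"
      if "x \<in> rcar (gcomp (X (Suc p)) n)" for n x
    proof -
      \<comment> \<open>The common internal degree; expressing n through it makes the various
        indices syntactically equal. The internal differential changes the sign index from m to m -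
        1, which is the source of anticommutation.\<close>
      define m where "m = n - 1 - int p"
      have n: "n = m + 1 + int p" by (simp add: m_def)
      have x: "x \<in> rcar (gcomp (P (Suc p)) m)" using that by (simp add: n)
      have dgx: "dres p (m - 1) (gd (P (Suc p)) m x) \<in> rcar (gcomp (P p) (m - 1))"
        using x by (intro d_in) simp
      show ?thesis
        using x d_in[OF x] dg_amap_gd[OF d x] dgx by (simp add: n \<delta>_def)
    qed
    show "\<delta> p (n - 1) (\<delta> (Suc p) n x) = rzero (gcomp (X p) (n - 2))"
      if "x \<in> rcar (gcomp (X (Suc (Suc p))) n)" for n x
    proof -
      define m where "m = n - 2 - int p"
      have n: "n = m + 2 + int p" by (simp add: m_def)
      have x: "x \<in> rcar (gcomp (P (Suc (Suc p))) m)" using that by (simp add: n)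
      show ?thesis
        using d_in[OF x] dd[OF x] by (simp add: n \<delta>_def rlin_rsmul[OF dg_amap_rlin[OF d]])
    qed
    show "\<delta> p (i + j) (mact (X (Suc p)) i j a x) = rsmul (gcomp (X p) (i + j - 1)) (sgnr i) (mact (X p) i (j - 1) a (\<delta> p j x))"
      if "a \<in> rcar (gcomp A i)" "x \<in> rcar (gcomp (X (Suc p)) j)" for i j a x
    proof -
      define m where "m = j - 1 - int p"
      have j: "j = m + 1 + int p" by (simp add: m_def)
      have x: "x \<in> rcar (gcomp (P (Suc p)) m)" using that by (simp add: j)
      \<comment> \<open>The sign index grows by i under multiplication by a, and
        \<open>sgnr (i + m)\<close> splits off the factor \<open>sgnr i\<close>.\<close>
      have "i + (m + 1 + int p) - 1 - int p = i + m" by simp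
      then show ?thesis
        using that(1) d_in[OF x] dg_amap_mact[OF d that(1) x] P.mact_in[OF that(1) d_in[OF x]]
        by (simp add: j \<delta>_def ac_simps)
    qed
  qed
  have tot: "totalc P dres = F.tot"
    by (simp add: totalc_def F.tot_def dsum_def \<delta>_def)
  have aug: "total_aug eps = (\<lambda>n x. eps n (x 0))"
    by (simp add: total_aug_def fun_eq_iff)
  interpret T: dg_amod A F.tot by (rule dg_amodI[OF A F.dg_amodule_tot])
  note elin = dg_amap_rlin[OF eps]
  have amap: "dg_amap A F.tot M (\<lambda>n x. eps n (x 0))"
    unfolding dg_amap_def dg_rmap_def
  proof (intro conjI allI ballI)
    have x0: "x 0 \<in> rcar (gcomp (P 0) n)" and x1: "x (Suc 0) \<in> rcar (gcomp (P (Suc 0)) (n - 1))"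
      if "x \<in> rcar (gcomp F.tot n)" for n x
      using that by (auto dest: spec[of _ 0] spec[of _ "Suc 0"])
    show "rlin (gcomp F.tot n) (gcomp M n) (\<lambda>x. eps n (x 0))" for n
      unfolding rlin_def using x0 rlin_in[OF elin] rlin_radd[OF elin] rlin_rsmul[OF elin] by auto
    show "eps (n - 1) (gd F.tot n x 0) = gd M n (eps n (x 0))" if "x \<in> rcar (gcomp F.tot n)" for n x
    proof -
      \<comment> \<open>The augmentation kills the contribution of filtration 1 to component 0; this
        is what makes the map that ignores all higher components a chain map.\<close>
      have "eps (n - 1) (\<delta> 0 n (x (Suc 0))) = rzero (gcomp M (n - 1))"
        using d_in[OF x1[OF that]] ed[OF x1[OF that]] by (simp add: \<delta>_def rlin_rsmul[OF elin])
      moreover have "\<delta> 0 n (x (Suc 0)) \<in> rcar (gcomp (P 0) (n - 1))"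
        using d_in[OF x1[OF that]] by (simp add: \<delta>_def)
      ultimately show ?thesis
        using x0[OF that] rlin_in[OF elin x0[OF that]] dg_amap_gd[OF eps x0[OF that]]
        by (simp add: rlin_radd[OF elin])
    qed
    show "eps (i + j) (mact F.tot i j a x 0) = mact M i j a (eps j (x 0))"
      if "a \<in> rcar (gcomp A i)" "x \<in> rcar (gcomp F.tot j)" for i j a x
      using dg_amap_mact[OF eps that(1) x0[OF that(2)]] by simp
  qed
  have "quasi_iso F.tot M (\<lambda>n x. eps n (x 0))"
  proof (rule F.tot_quasi_iso)
    show "dg_rmodule M" by (rule M.dg_rmodule)
    show "dg_rmap F.tot M (\<lambda>n x. eps n (x 0))" by (rule dg_amap_rmap[OF amap])
    show "dg_rmap (X 0) M eps" using dg_amap_rmap[OF eps] by (simp add: dg_rmap_def)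
    show "s_epi (X 0) M eps" using epi by (simp add: s_epi_def)
    fix p n x
    assume ker: "case p of 0 \<Rightarrow> eps n x = rzero (gcomp M n) | Suc p' \<Rightarrow> \<delta> p' n x = rzero (gcomp (X p') (n - 1))"
    let ?q = "n - int p"
    \<comment> \<open>Exactness in unsigned form, at \<open>M\<close> and at the later stages alike;
      the signs are then put back by \<open>\<delta>_dres\<close>.\<close>
    have lift: "(x \<in> rcar (gcomp (P p) ?q) \<longrightarrow> (\<exists>y\<in>rcar (gcomp (P (Suc p)) ?q). dres p ?q y = x)) \<and>
        (x \<in> cycles (P p) ?q \<longrightarrow> (\<exists>y\<in>cycles (P (Suc p)) ?q. dres p ?q y = x))"
    proof (cases p)
      case 0
      then show ?thesis
        using ker s_exact_lift[OF assms(7)] s_exact_lift_cycles[OF assms(7)] by simp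
    next
      case (Suc p')
      have "dres p' ?q x = rzero (gcomp (P p') ?q)" if x: "x \<in> rcar (gcomp (P (Suc p')) ?q)"
      proof -
        have q: "n - 1 - int p' = ?q" by (simp add: Suc)
        have "rsmul (gcomp (P p') ?q) (sgnr ?q) (dres p' ?q x) = rzero (gcomp (P p') ?q)"
          using ker unfolding Suc by (simp add: \<delta>_def q[unfolded Suc])
        \<comment> \<open>A sign squares to 1, so multiplying by it once more recovers the statement
          about \<open>dres\<close> itself.\<close>
        then have "rsmul (gcomp (P p') ?q) (sgnr ?q) (rsmul (gcomp (P p') ?q) (sgnr ?q) (dres p' ?q x))
            = rzero (gcomp (P p') ?q)"
          by simp
        then show ?thesis using d_in[OF x] by (simp del: sgnr_diff)
      qed
      then show ?thesis
        using s_exact_lift[OF assms(6)[rule_format]] s_exact_lift_cycles[OF assms(6)[rule_format]] P.cycles_in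
        unfolding Suc by blast
    qed
    \<comment> \<open>Scaling the preimage by the same sign compensates the sign inside \<delta>;
      carriers and cycles are closed under this scaling.\<close>
    have \<delta>_dres: "\<delta> p (n + 1) (rsmul (gcomp (P (Suc p)) ?q) (sgnr ?q) y) = dres p ?q y"
      if y: "y \<in> rcar (gcomp (P (Suc p)) ?q)" for y
    proof -
      have q: "n + 1 - 1 - int p = ?q" by simp
      show ?thesis
        unfolding \<delta>_def q using y d_in[OF y] by (simp add: rlin_rsmul[OF dg_amap_rlin[OF d]] del: sgnr_diff)
    qed
    have q: "n + 1 - int (Suc p) = ?q" by simp
    show "\<exists>z\<in>rcar (gcomp (X (Suc p)) (n + 1)). \<delta> p (n + 1) z = x" if "x \<in> rcar (gcomp (X p) n)"
    proof -
      obtain y where y: "y \<in> rcar (gcomp (P (Suc p)) ?q)" "dres p ?q y = x"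
        using lift \<open>x \<in> rcar (gcomp (X p) n)\<close> by auto
      have "rsmul (gcomp (P (Suc p)) ?q) (sgnr ?q) y \<in> rcar (gcomp (X (Suc p)) (n + 1))"
        using y(1) unfolding X_simps q by simp
      then show ?thesis using \<delta>_dres[OF y(1)] y(2) by blast
    qed
    show "\<exists>z\<in>cycles (X (Suc p)) (n + 1). \<delta> p (n + 1) z = x" if "x \<in> cycles (X p) n"
    proof -
      obtain y where y: "y \<in> cycles (P (Suc p)) ?q" "dres p ?q y = x"
        using lift \<open>x \<in> cycles (X p) n\<close> by auto
      have "rsmul (gcomp (P (Suc p)) ?q) (sgnr ?q) y \<in> cycles (X (Suc p)) (n + 1)"
        using y(1) P.closed_sub_cycles[of "Suc p" ?q] unfolding X_simps q closed_sub_def by blast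
      then show ?thesis using \<delta>_dres[OF P.cycles_in[OF y(1)]] y(2) by blast
    qed
  qed
  moreover have "(\<lambda>x. eps n (x 0)) ` rcar (gcomp F.tot n) = rcar (gcomp M n)" for n
  proof
    show "(\<lambda>x. eps n (x 0)) ` rcar (gcomp F.tot n) \<subseteq> rcar (gcomp M n)"
      using rlin_in[OF dg_amap_rlin[OF amap]] by blast
    show "rcar (gcomp M n) \<subseteq> (\<lambda>x. eps n (x 0)) ` rcar (gcomp F.tot n)"
    proof
      fix y assume "y \<in> rcar (gcomp M n)"
      then have "y \<in> eps n ` rcar (gcomp (X 0) n)" using epi by (simp add: s_epi_def)
      then obtain x where x: "x \<in> rcar (gcomp (X 0) n)" "y = eps n x" by blast
      then have "y = eps n (F.inc 0 n x 0)" by (simp add: single_def)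
      then show "y \<in> (\<lambda>x. eps n (x 0)) ` rcar (gcomp F.tot n)"
        using F.inc_in[OF x(1)] by blast
    qed
  qed
  moreover have "q_cofibrant TYPE('e) TYPE('n) A F.tot"
    unfolding q_cofibrant_def
  proof (intro conjI allI impI, rule F.dg_amodule_tot, elim conjE)
    fix E :: "('r, 'a, 'e) dgamod" and N :: "('r, 'a, 'n) dgamod" and \<pi> g
    assume E: "dg_amodule A E" and N: "dg_amodule A N" and \<pi>: "dg_amap A E N \<pi>"
      and surj: "\<forall>n. \<pi> n ` rcar (gcomp E n) = rcar (gcomp N n)" and qi: "quasi_iso E N \<pi>"
      and g: "dg_amap A F.tot N g"
    \<comment> \<open>The regraded row is again a tensor product, over the equally regraded
      \<open>Q p\<close>, which remains s-projective.\<close>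
    have tensor: "dg_tensor A (X p) (shift_r (int p) (Q p)) (\<lambda>n. iota p (n - int p))" for p
    proof -
      interpret Q: dg_rmod "shift_r (int p) (Q p)"
        by unfold_locales (simp add: assms(9) dg_rmodule_shift_r)
      have "is_tensor_ext A (shift_r (int p) (Q p)) (X p) (\<lambda>n. iota p (n - int p))"
        unfolding X_def using assms(9) by (intro is_tensor_ext_shift A) simp
      then show ?thesis
        by unfold_locales (simp_all add: is_tensor_ext_def)
    qed
    show "\<exists>h. dg_amap A F.tot E h \<and> (\<forall>n. \<forall>x\<in>rcar (gcomp F.tot n). \<pi> n (h n x) = g n x)"
      by (rule F.tot_lift[OF tensor _ E N \<pi> qi surj[rule_format] g])
        (simp add: assms(9) s_projective_shift_r)
  qed
  ultimately show ?thesis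
    unfolding tot aug using amap by blast
qed

end
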